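(* For each integer $p\ge2$ let $\zeta_{1,p},\dots,\zeta_{p,p}\in\mathbb{C}$ and $a_{1,p},\dots,a_{p,p}>0$, and let $Q_{2,p},Q_{1,p}\in\mathbb{C}[z]$ be determined by $Q_{2,p}(z)=\prod_{l=1}^{p}(z-\zeta_{l,p})$ and $\frac{Q_{1,p}(z)}{Q_{2,p}(z)}=\sum_{l=1}^{p}\frac{a_{l,p}}{z-\zeta_{l,p}}$. Assume that for every $p\ge2$ the equation $Q_{2,p}y''+Q_{1,p}y'+Q_0y=0$ is solvable, and that $K\subset\mathbb{C}$ is a convex compact set containing all zeros of $Q_{2,p}$ for every $p\ge2$. For all $p\ge2$ and $n\in\mathbb{N}$ let $S_{p,n}$ be a monic Heine-Stieltjes polynomial of degree $n$ for this equation and $V_{p,n}$ a corresponding Van Vleck polynomial with $\deg V_{p,n}=p-2$, normalized (by multiplication by a nonzero constant) to be monic. Let $p\mapsto n(p)\in\mathbb{N}$ be any function. Then there is an infinite set $\Gamma\subset\mathbb{N}$ such that the weak-$^*$ limits ${}_*\mu_V=\lim_{\Gamma\ni p\to\infty}\mu_{V_{p,n(p)}}$ and ${}_*\mu_{Q_2}=\lim_{\Gamma\ni p\to\infty}\mu_{Q_{2,p}}$ exist and $${}_*\mu_V\prec{}_*\mu_{Q_2}$$ in the Choquet order. Hence there exists a dilation $T$ on $K$ such that ${}_*\mu_{Q_2}=T({}_*\mu_V)$. In particular, $${}_*\mu_V^{(m)}\le{}_*\mu_{Q_2}^{(m)}\quad\text{for all integers }m\ge0,$$ and $$U^{{}_*\mu_V}(z)\ge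 U^{{}_*\mu_{Q_2}}(z)\quad\text{for every }z\in\mathbb{C}\setminus K.$$
   Context: Solvable means: for every $n\in\mathbb{N}=\{1,2,\dots\}$ there are polynomials $V$ with $\deg V\le p-2$ and $S$ with $\deg S=n$ such that $Q_{2,p}S''+Q_{1,p}S'+VS=0$. Such an $S$ is a Heine-Stieltjes polynomial and $V$ a corresponding Van Vleck polynomial. For a polynomial $P$ of degree $d\ge1$ with zeros $z_1,\dots,z_d$ (with multiplicity), $\mu_P=\frac1d\sum_{i=1}^d\delta_{z_i}$ is its root-counting measure. For a compactly supported probability measure $\mu$ on $\mathbb{C}$, $\mu^{(m)}=\int|w|^m\,d\mu(w)$ and $U^{\mu}(z)=\int\log|z-w|\,d\mu(w)$. Choquet order: for a convex compact set $K\subset\mathbb{C}$ and probability measures $\mu,\nu$ on $K$, $\mu\prec\nu$ means $\int f\,d\mu\le\int f\,d\nu$ for every continuous convex $f:K\to\mathbb{R}$. A dilation on $K$ is a map $T:x\mapsto T_x$ from $K$ to the probability measures on $K$ such that $T_x$ has barycenter $\int y\,dT_x(y)=x$ for every $x\in K$ and $x\mapsto\int f\,dT_x$ is Borel for every continuous $f:K\to\mathbb{R}$. For a probability measure $\mu$ on $K$, $T(\mu)$ is defined by $\int f\,dT(\mu)=\int_K\big(\int f\,dT_x\big)d\mu(x)$ for continuous $f$. *)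

theory Defs
  imports
    "HOL-Probability.Probability"
    "HOL-Computational_Algebra.Computational_Algebra"
begin

definition stieltjes_pair ::
  "nat \<Rightarrow> complex poly \<Rightarrow> complex poly \<Rightarrow> complex poly \<Rightarrow> complex poly \<Rightarrow> bool" where
  "stieltjes_pair p Q2 Q1 V S \<longleftrightarrow>
     degree V \<le> p - 2 \<and>
     Q2 * pderiv (pderiv S) + Q1 * pderiv S + V * S = 0"

definition solvable_eq :: "nat \<Rightarrow> complex poly \<Rightarrow> complex poly \<Rightarrow> bool" where
  "solvable_eq p Q2 Q1 \<longleftrightarrow>
     (\<forall>n\<ge>1. \<exists>V S. degree S = n \<and> stieltjes_pair p Q2 Q1 V S)"

(* The uniform distribution on the multiset of roots, viewed on the Borel sigma-algebra.
   It has no meaning for constant polynomials, where the multiset is empty. *)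
definition root_measure :: "complex poly \<Rightarrow> complex measure" where
  "root_measure P = distr (measure_pmf (pmf_of_multiset (proots P))) borel (\<lambda>z. z)"

(* Probability measures on K are represented as Borel measures on the whole plane
   that give K full mass. *)
definition prob_measures_on :: "complex set \<Rightarrow> complex measure set" where
  "prob_measures_on K = {M. prob_space M \<and> sets M = sets borel \<and> measure M K = 1}"

(* Weak-* convergence along the index set Gamma to a probability measure. For a probability
   limit, testing against bounded continuous functions amounts to testing against compactly
   supported ones; for measures on a compact K it is the weak-* topology of the dual of C(K). *)
definition weak_star_lim ::
  "nat set \<Rightarrow> (nat \<Rightarrow> complex measure) \<Rightarrow> complex measure \<Rightarrow> bool" where
  "weak_star_lim \<Gamma> M N \<longleftrightarrow>
     prob_space N \<and> sets N = sets borel \<and>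
     (\<forall>f :: complex \<Rightarrow> real. continuous_on UNIV f \<longrightarrow> bounded (range f) \<longrightarrow>
        ((\<lambda>p. LINT w|M p. f w) \<longlongrightarrow> (LINT w|N. f w)) (inf sequentially (principal \<Gamma>)))"

definition choquet_le :: "complex set \<Rightarrow> complex measure \<Rightarrow> complex measure \<Rightarrow> bool" where
  "choquet_le K \<mu> \<nu> \<longleftrightarrow>
     \<mu> \<in> prob_measures_on K \<and> \<nu> \<in> prob_measures_on K \<and>
     (\<forall>f :: complex \<Rightarrow> real. continuous_on K f \<longrightarrow> convex_on K f \<longrightarrow>
        (LINT x:K|\<mu>. f x) \<le> (LINT x:K|\<nu>. f x))"

definition dilation_on :: "complex set \<Rightarrow> (complex \<Rightarrow> complex measure) \<Rightarrow> bool" where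
  "dilation_on K T \<longleftrightarrow>
     (\<forall>x\<in>K. T x \<in> prob_measures_on K \<and> (LINT y:K|T x. y) = x) \<and>
     (\<forall>f :: complex \<Rightarrow> real. continuous_on K f \<longrightarrow>
        (\<lambda>x. LINT y:K|T x. f y) \<in> borel_measurable (restrict_space borel K))"

(* For compact K, the measure is determined by its integrals of continuous functions. *)
definition dilate ::
  "complex set \<Rightarrow> (complex \<Rightarrow> complex measure) \<Rightarrow> complex measure \<Rightarrow> complex measure" where
  "dilate K T \<mu> = (THE \<nu>. \<nu> \<in> prob_measures_on K \<and>
     (\<forall>f :: complex \<Rightarrow> real. continuous_on K f \<longrightarrow>
        (LINT y:K|\<nu>. f y) = (LINT x:K|\<mu>. (LINT y:K|T x. f y))))"

definition abs_moment :: "nat \<Rightarrow> complex measure \<Rightarrow> real" where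
  "abs_moment m \<mu> = (LINT w|\<mu>. norm w ^ m)"

(* Real-valued, with ln 0 = 0: meaningful only for z off the support of the measure. *)
definition log_potential :: "complex measure \<Rightarrow> complex \<Rightarrow> real" where
  "log_potential \<mu> z = (LINT w|\<mu>. ln (norm (z - w)))"

end

theory Submission
  imports Defs
begin

text \<open>
  Writing \<open>Q\<^sub>1 / Q\<^sub>2 = \<Sum> a\<^sub>l / (z - \<zeta>\<^sub>l)\<close>, the differential equation says that the zeros of \<open>V S\<close> are the zeros of
  the weighted logarithmic derivative \<open>Q\<^sub>1 / Q\<^sub>2 + S'' / S'\<close>, whose weights are positive. Such zeros are the
  eigenvalues of the compression of a diagonal matrix to a hyperplane, so Schur triangularization
  writes them as means of the poles by a stochastic matrix whose columns have sum at most one. The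
  same holds for \<open>S' / S\<close>, with column sums at most \<open>1 - 1 / n\<close>. Composing the two matrices and eliminating the
  zeros of \<open>S\<close> as transient states leaves a stochastic matrix taking the zeros of \<open>Q\<^sub>2\<close> to
  those of \<open>V\<close>, with column sums at most one: a finite martingale coupling whose marginals are
  \<open>\<mu>\<^sub>V\<close> and, up to total variation \<open>O(1 / p)\<close>, \<open>\<mu>\<^sub>Q\<close>.

  A space-filling curve onto \<open>K \<times> K\<close> lifts these couplings to the real line, where Helly's
  theorem gives a limit martingale coupling. Its disintegration is the dilation.

  Outside \<open>K\<close> the Cauchy transforms of probability measures on \<open>K\<close> are bounded away from zero, so
  \<open>|V / Q\<^sub>2|\<close> is bounded below independently of \<open>p\<close>; this gives the inequality between the
  potentials, which does not follow from the Choquet order alone.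
\<close>

section \<open>Weighted Gauss--Lucas majorization\<close>

text \<open>A pole of normalized weight \<open>c\<close> gets a column sum at most
  \<open>1 - c\<close>, because a unit point mass loses the share \<open>c\<close> of its squared
  norm when projected off the constants. This gain makes the zeros of \<open>S\<close> transient, so
  that the elimination divides only by positive numbers. For \<open>V\<close> and \<open>Q2\<close>
  only the bound 1 remains; with \<open>p - 2\<close> rows and \<open>p\<close> columns, the total
  deficiency of the columns is 2.

  The martingale property is carried along as the vanishing of the integrals of
  \<open>h (X t) * (Y t - X t)\<close>, a form that passes to weak limits, while conditional kernels
  need not. The curve parameter helps twice: probability measures on a fixed interval are tight, and
  conditional laws of a real variable come from distribution functions at rational points.

  For \<open>z\<close> off \<open>K\<close> the function \<open>ln |z - w|\<close> is harmonic in
  \<open>w\<close> with indefinite Hessian, so the convex order does not control it. Instead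
  \<open>V / Q2\<close> is factored into two Cauchy transforms of modulus at least
  \<open>\<delta>\<close>; the constant \<open>\<delta>^2\<close> disappears after taking logarithms
  and dividing by \<open>p - 2\<close>.\<close>

lemma sum_poly_over_diffs_eq_0:
  fixes u :: "'i \<Rightarrow> 'a::field"
  assumes fin: "finite I" and inj: "inj_on u I" and deg: "degree g + 1 < card I"
  shows "(\<Sum>i\<in>I. poly g (u i) / (\<Prod>k\<in>I-{i}. u i - u k)) = 0"
proof -
  \<comment> \<open>\<open>h\<close> is the Lagrange interpolant of \<open>g\<close> at the points
    \<open>u i\<close>, hence \<open>g\<close> itself. The sum in the claim is its coefficient in
    degree \<open>card I - 1\<close>, which exceeds \<open>degree g\<close>.\<close>
  define L where "L i = (\<Prod>k\<in>I-{i}. [:- u k, 1:])" for i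
  define h where "h = (\<Sum>i\<in>I. smult (poly g (u i) / (\<Prod>k\<in>I-{i}. u i - u k)) (L i))"
  have degL: "degree (L i) = card I - 1" if "i \<in> I" for i
    unfolding L_def using fin that by (subst degree_prod_sum_eq) auto
  have lcL: "coeff (L i) (card I - 1) = 1" if "i \<in> I" for i
  proof -
    have "lead_coeff (L i) = 1" unfolding L_def by (simp add: lead_coeff_prod)
    with degL[OF that] show ?thesis by simp
  qed
  have degh: "degree h \<le> card I - 1"
    unfolding h_def using degL by (intro degree_sum_le fin) (auto intro: order.trans[OF degree_smult_le])
  have hu: "poly h (u j) = poly g (u j)" if j: "j \<in> I" for j
  proof -
    have nz: "(\<Prod>k\<in>I-{j}. u j - u k) \<noteq> 0"
      using fin inj j by (auto simp: inj_on_def)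
    have "poly h (u j) = (\<Sum>i\<in>I. poly g (u i) / (\<Prod>k\<in>I-{i}. u i - u k) * (\<Prod>k\<in>I-{i}. u j - u k))"
      unfolding h_def L_def by (simp add: poly_sum poly_prod)
    also have "\<dots> = (\<Sum>i\<in>I. if i = j then poly g (u j) else 0)"
    proof (rule sum.cong)
      fix i assume "i \<in> I"
      show "poly g (u i) / (\<Prod>k\<in>I-{i}. u i - u k) * (\<Prod>k\<in>I-{i}. u j - u k) =
            (if i = j then poly g (u j) else 0)"
      proof (cases "i = j")
        case False
        then have "(\<Prod>k\<in>I-{i}. u j - u k) = 0" using j fin by (auto simp: prod_zero_iff)
        with False show ?thesis by simp
      qed (use nz in auto)
    qed simp
    also have "\<dots> = poly g (u j)" using j fin by simp
    finally show ?thesis .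
  qed
  have "h = g"
  proof (rule ccontr)
    assume "h \<noteq> g"
    then have nz: "h - g \<noteq> 0" by simp
    have "u ` I \<subseteq> {x. poly (h - g) x = 0}" using hu by auto
    then have "card (u ` I) \<le> card {x. poly (h - g) x = 0}"
      by (intro card_mono poly_roots_finite nz)
    also have "\<dots> \<le> degree (h - g)" by (rule card_poly_roots_bound[OF nz])
    also have "\<dots> \<le> card I - 1" using degh deg by (intro degree_diff_le) auto
    finally show False using card_image[OF inj] deg by simp
  qed
  then have "coeff h (card I - 1) = 0" using deg by (simp add: coeff_eq_0)
  then show ?thesis unfolding h_def
    by (simp add: coeff_sum lcL[simplified])
qed

section \<open>Weighted inner products and numerators of partial fractions\<close>

lemma of_real_norm_sq: "(complex_of_real (norm z))\<^sup>2 = z * cnj z"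
  by (metis complex_norm_square of_real_power)

text \<open>The difference of the two sides is the squared norm of \<open>g\<close> minus its
  projection \<open>h\<close>. Weights may vanish, so the form is only a semi-inner product.\<close>

lemma bessel_weighted:
  fixes c :: "'i \<Rightarrow> real" and b :: "'j \<Rightarrow> 'i \<Rightarrow> complex" and g :: "'i \<Rightarrow> complex"
  assumes "finite I" "finite J" and c: "\<And>i. i \<in> I \<Longrightarrow> c i \<ge> 0"
    and on: "\<And>j k. j \<in> J \<Longrightarrow> k \<in> J \<Longrightarrow>
      (\<Sum>i\<in>I. c i * b j i * cnj (b k i)) = (if j = k then 1 else 0)"
  shows "(\<Sum>j\<in>J. (norm (\<Sum>i\<in>I. c i * g i * cnj (b j i)))\<^sup>2) \<le> (\<Sum>i\<in>I. c i * (norm (g i))\<^sup>2)"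
proof -
  define x where "x j = (\<Sum>i\<in>I. c i * g i * cnj (b j i))" for j
  define h where "h i = (\<Sum>j\<in>J. x j * b j i)" for i
  have gh: "(\<Sum>i\<in>I. c i * g i * cnj (h i)) = (\<Sum>j\<in>J. x j * cnj (x j))"
  proof -
    have "(\<Sum>i\<in>I. c i * g i * cnj (h i)) = (\<Sum>i\<in>I. \<Sum>j\<in>J. cnj (x j) * (c i * g i * cnj (b j i)))"
      unfolding h_def by (simp add: sum_distrib_left mult_ac)
    also have "\<dots> = (\<Sum>j\<in>J. cnj (x j) * x j)"
      by (subst sum.swap) (simp add: x_def sum_distrib_left)
    finally show ?thesis by (simp add: mult_ac)
  qed
  have hh: "(\<Sum>i\<in>I. c i * h i * cnj (h i)) = (\<Sum>j\<in>J. x j * cnj (x j))"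
  proof -
    have "(\<Sum>i\<in>I. c i * h i * cnj (h i)) = (\<Sum>i\<in>I. \<Sum>j\<in>J. \<Sum>k\<in>J. x j * cnj (x k) * (c i * b j i * cnj (b k i)))"
      unfolding h_def by (simp add: sum_product sum_distrib_left mult_ac)
    also have "\<dots> = (\<Sum>j\<in>J. \<Sum>k\<in>J. \<Sum>i\<in>I. x j * cnj (x k) * (c i * b j i * cnj (b k i)))"
      by (subst sum.swap, intro sum.cong refl, subst sum.swap) simp
    also have "\<dots> = (\<Sum>j\<in>J. \<Sum>k\<in>J. if j = k then x j * cnj (x k) else 0)"
      by (intro sum.cong refl) (simp add: on sum_distrib_left[symmetric])
    also have "\<dots> = (\<Sum>j\<in>J. x j * cnj (x j))" using assms(2) by simp
    finally show ?thesis .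
  qed
  have hg: "(\<Sum>i\<in>I. c i * h i * cnj (g i)) = (\<Sum>j\<in>J. x j * cnj (x j))"
    using arg_cong[OF gh, of cnj] by (simp add: mult_ac)
  have "(\<Sum>i\<in>I. complex_of_real (c i) * ((g i - h i) * cnj (g i - h i))) =
        (\<Sum>i\<in>I. c i * g i * cnj (g i)) - (\<Sum>i\<in>I. c i * g i * cnj (h i))
        - (\<Sum>i\<in>I. c i * h i * cnj (g i)) + (\<Sum>i\<in>I. c i * h i * cnj (h i))"
    by (simp add: algebra_simps sum_subtractf sum.distrib)
  also have "\<dots> = (\<Sum>i\<in>I. c i * g i * cnj (g i)) - (\<Sum>j\<in>J. x j * cnj (x j))"
    by (simp add: gh hh hg)
  finally have "complex_of_real (\<Sum>i\<in>I. c i * (norm (g i - h i))\<^sup>2) =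
      complex_of_real ((\<Sum>i\<in>I. c i * (norm (g i))\<^sup>2) - (\<Sum>j\<in>J. (norm (x j))\<^sup>2))"
    by (simp add: of_real_norm_sq mult.assoc)
  then have "(\<Sum>i\<in>I. c i * (norm (g i - h i))\<^sup>2) = (\<Sum>i\<in>I. c i * (norm (g i))\<^sup>2) - (\<Sum>j\<in>J. (norm (x j))\<^sup>2)"
    using of_real_eq_iff by blast
  moreover have "(\<Sum>i\<in>I. c i * (norm (g i - h i))\<^sup>2) \<ge> 0"
    using c by (intro sum_nonneg) auto
  ultimately show ?thesis unfolding x_def by simp
qed

lemma coeff_prod_linear_top:
  assumes "finite I"
  shows "coeff (\<Prod>k\<in>I. [:- u k, 1::'a::field:]) (card I) = 1"
proof -
  have "lead_coeff (\<Prod>k\<in>I. [:- u k, 1::'a:]) = 1" by (simp add: lead_coeff_prod)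
  moreover have "degree (\<Prod>k\<in>I. [:- u k, 1::'a:]) = card I"
    using assms by (subst degree_prod_sum_eq) auto
  ultimately show ?thesis by simp
qed

lemma degree_prod_linear:
  assumes "finite I"
  shows "degree (\<Prod>k\<in>I. [:- u k, 1::'a::field:]) = card I"
    using assms by (subst degree_prod_sum_eq) auto

text \<open>The polynomial is the numerator of \<open>\<Sum> c i / (z - u i)\<close> over the common
  denominator, so its coefficient in degree \<open>card I - 1\<close> is the total weight.\<close>

lemma monic_weighted_partial_fractions:
  fixes u :: "'i \<Rightarrow> complex" and c :: "'i \<Rightarrow> real"
  assumes "finite I" and sumc: "sum c I = 1"
  shows "lead_coeff (\<Sum>i\<in>I. smult (c i) (\<Prod>k\<in>I-{i}. [:- u k, 1:])) = 1"
    and "degree (\<Sum>i\<in>I. smult (c i) (\<Prod>k\<in>I-{i}. [:- u k, 1:])) = card I - 1"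
proof -
  define F where "F = (\<Sum>i\<in>I. smult (complex_of_real (c i)) (\<Prod>k\<in>I-{i}. [:- u k, 1:]))"
  have "coeff F (card I - 1) = (\<Sum>i\<in>I. complex_of_real (c i))"
    unfolding F_def coeff_sum
  proof (rule sum.cong)
    fix i assume "i \<in> I"
    then have "card (I - {i}) = card I - 1" using assms(1) by simp
    then show "coeff (smult (complex_of_real (c i)) (\<Prod>k\<in>I-{i}. [:- u k, 1:])) (card I - 1) = complex_of_real (c i)"
      using coeff_prod_linear_top[of "I - {i}" u] assms(1) by simp
  qed simp
  also have "\<dots> = 1" using sumc of_real_sum[of c I, where ?'a=complex] by simp
  finally have 1: "coeff F (card I - 1) = 1" .
  have 2: "degree F \<le> card I - 1"
    unfolding F_def using assms(1)
    by (intro degree_sum_le) (auto simp: degree_prod_linear intro!: order.trans[OF degree_smult_le])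
  have 3: "degree F = card I - 1" using 1 2 by (intro antisym le_degree) auto
  show "lead_coeff (\<Sum>i\<in>I. smult (c i) (\<Prod>k\<in>I-{i}. [:- u k, 1:])) = 1"
    and "degree (\<Sum>i\<in>I. smult (c i) (\<Prod>k\<in>I-{i}. [:- u k, 1:])) = card I - 1"
    using 1 3 unfolding F_def by simp_all
qed

lemma card_of_weighted_partial_fractions:
  fixes u :: "'i \<Rightarrow> complex" and c :: "'i \<Rightarrow> real" and r :: "'j \<Rightarrow> complex"
  assumes "finite I" "finite J" and sumc: "sum c I = 1"
    and R: "(\<Prod>j\<in>J. [:- r j, 1:]) = (\<Sum>i\<in>I. smult (c i) (\<Prod>k\<in>I-{i}. [:- u k, 1:]))"
  shows "card I = Suc (card J)"
proof -
  have "I \<noteq> {}" using sumc by auto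
  then have "card I > 0" using assms(1) by (simp add: card_gt_0_iff)
  moreover have "card J = card I - 1"
    using monic_weighted_partial_fractions(2)[OF assms(1) sumc, of u] degree_prod_linear[OF assms(2), of r]
    unfolding R by simp
  ultimately show ?thesis by simp
qed

text \<open>Gram--Schmidt in \<open>L\<^sup>2(c)\<close> along the spaces \<open>{q / \<Prod>(u - r\<^sub>j) | deg q < card J}\<close>, which are orthogonal to
  the constants by hypothesis. Multiplication by \<open>u - r\<^sub>k\<close> maps each of them into the
  previous one plus the constants, so the compression of multiplication by \<open>u\<close> to the
  orthogonal complement of the constants is triangular with diagonal entries \<open>r\<^sub>j\<close>.\<close>

lemma orthonormal_flag:
  fixes u :: "'i \<Rightarrow> complex" and c :: "'i \<Rightarrow> real" and r :: "'j \<Rightarrow> complex"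
  assumes fin: "finite I" "finite J" and c: "\<And>i. i \<in> I \<Longrightarrow> c i > 0"
    and inj: "inj_on u I" and cardJ: "card J < card I"
    and nz: "\<And>i j. i \<in> I \<Longrightarrow> j \<in> J \<Longrightarrow> u i \<noteq> r j"
    and orth: "\<And>J' q. J' \<subseteq> J \<Longrightarrow> degree q < card J' \<Longrightarrow>
      (\<Sum>i\<in>I. c i * (poly q (u i) / (\<Prod>j\<in>J'. u i - r j))) = 0"
  shows "\<exists>b :: 'j \<Rightarrow> 'i \<Rightarrow> complex.
    (\<forall>j\<in>J. \<exists>q. degree q < card J \<and> (\<forall>i\<in>I. b j i = poly q (u i) / (\<Prod>k\<in>J. u i - r k))) \<and>
    (\<forall>j\<in>J. \<forall>k\<in>J. (\<Sum>i\<in>I. c i * b j i * cnj (b k i)) = (if j = k then 1 else 0)) \<and>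
    (\<forall>q. degree q < card J \<longrightarrow>
       (\<exists>x. \<forall>i\<in>I. poly q (u i) / (\<Prod>k\<in>J. u i - r k) = (\<Sum>j\<in>J. x j * b j i))) \<and>
    (\<forall>j\<in>J. (\<Sum>i\<in>I. c i * u i * b j i * cnj (b j i)) = r j)"
  \<comment> \<open>Orthogonality is assumed for all subsets of \<open>J\<close> so that it survives
    the induction on \<open>J\<close>.\<close>
  using fin(2) cardJ nz orth
proof (induction J rule: finite_induct)
  case empty
  then show ?case by simp
next
  case (insert k J)
  define \<rho> where "\<rho> i = (\<Prod>j\<in>J. u i - r j)" for i
  define \<rho>' where "\<rho>' i = (u i - r k) * \<rho> i" for i
  have prod_ins: "(\<Prod>j\<in>insert k J. u i - r j) = \<rho>' i" for i
    using insert.hyps unfolding \<rho>_def \<rho>'_def by simp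
  have card_ins: "card (insert k J) = Suc (card J)" using insert.hyps by simp
  have \<rho>nz: "\<rho> i \<noteq> 0" if "i \<in> I" for i
    using insert.prems(2)[OF that] insert.hyps(1) unfolding \<rho>_def by auto
  have knz: "u i - r k \<noteq> 0" if "i \<in> I" for i
    using insert.prems(2)[OF that, of k] by simp
  have "\<exists>b :: 'j \<Rightarrow> 'i \<Rightarrow> complex.
    (\<forall>j\<in>J. \<exists>q. degree q < card J \<and> (\<forall>i\<in>I. b j i = poly q (u i) / (\<Prod>k\<in>J. u i - r k))) \<and>
    (\<forall>j\<in>J. \<forall>k\<in>J. (\<Sum>i\<in>I. c i * b j i * cnj (b k i)) = (if j = k then 1 else 0)) \<and>
    (\<forall>q. degree q < card J \<longrightarrow>
       (\<exists>x. \<forall>i\<in>I. poly q (u i) / (\<Prod>k\<in>J. u i - r k) = (\<Sum>j\<in>J. x j * b j i))) \<and>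
    (\<forall>j\<in>J. (\<Sum>i\<in>I. c i * u i * b j i * cnj (b j i)) = r j)"
  proof (rule insert.IH)
    show "card J < card I" using insert.prems(1) card_ins by simp
    show "u i \<noteq> r j" if "i \<in> I" "j \<in> J" for i j using insert.prems(2) that by simp
    show "(\<Sum>i\<in>I. c i * (poly q (u i) / (\<Prod>j\<in>J'. u i - r j))) = 0"
      if "J' \<subseteq> J" "degree q < card J'" for J' q
      using that by (intro insert.prems(3)) auto
  qed
  then obtain b :: "'j \<Rightarrow> 'i \<Rightarrow> complex" where
    b_H: "\<And>j. j \<in> J \<Longrightarrow> \<exists>q. degree q < card J \<and> (\<forall>i\<in>I. b j i = poly q (u i) / \<rho> i)" and
    b_on: "\<And>j l. j \<in> J \<Longrightarrow> l \<in> J \<Longrightarrow> (\<Sum>i\<in>I. c i * b j i * cnj (b l i)) = (if j = l then 1 else 0)" and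
    b_span: "\<And>q. degree q < card J \<Longrightarrow>
       \<exists>x. \<forall>i\<in>I. poly q (u i) / \<rho> i = (\<Sum>j\<in>J. x j * b j i)" and
    b_r: "\<And>j. j \<in> J \<Longrightarrow> (\<Sum>i\<in>I. c i * u i * b j i * cnj (b j i)) = r j"
    unfolding \<rho>_def by blast
  \<comment> \<open>The enlarged space is the old one, rewritten over \<open>\<rho>'\<close>, plus
    the line through \<open>1 / \<rho>'\<close>; \<open>h\<close> is the part of this new function
    orthogonal to the old space.\<close>
  define x where "x j = (\<Sum>i\<in>I. c i * (1 / \<rho>' i) * cnj (b j i))" for j
  define h where "h i = 1 / \<rho>' i - (\<Sum>j\<in>J. x j * b j i)" for i
  have h_orth: "(\<Sum>i\<in>I. c i * h i * cnj (b l i)) = 0" if l: "l \<in> J" for l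
  proof -
    have "(\<Sum>i\<in>I. c i * h i * cnj (b l i)) =
        (\<Sum>i\<in>I. c i * (1 / \<rho>' i) * cnj (b l i)) - (\<Sum>i\<in>I. \<Sum>j\<in>J. x j * (c i * b j i * cnj (b l i)))"
      unfolding h_def by (simp add: algebra_simps sum_subtractf sum_distrib_left)
    also have "(\<Sum>i\<in>I. \<Sum>j\<in>J. x j * (c i * b j i * cnj (b l i))) =
        (\<Sum>j\<in>J. if j = l then x j else 0)"
      by (subst sum.swap) (auto simp: sum_distrib_left[symmetric] b_on l intro!: sum.cong)
    also have "\<dots> = x l" using l insert.hyps(1) by simp
    finally show ?thesis unfolding x_def by simp
  qed
  obtain Q where Q: "\<And>j. j \<in> J \<Longrightarrow> degree (Q j) < card J"
     "\<And>i j. j \<in> J \<Longrightarrow> i \<in> I \<Longrightarrow> b j i = poly (Q j) (u i) / \<rho> i"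
    using b_H by metis
  \<comment> \<open>The numerator of \<open>h\<close> over \<open>\<rho>'\<close>. It takes the
    value 1 at \<open>r k\<close>, so it is a nonzero polynomial of degree at most
    \<open>card J\<close> and cannot vanish at all of the \<open>card I\<close> distinct points
    \<open>u i\<close>. Hence \<open>h\<close> can be normalized.\<close>
  define G where "G = 1 - [:- r k, 1:] * (\<Sum>j\<in>J. smult (x j) (Q j))"
  have deg_sum: "degree (\<Sum>j\<in>J. smult (x j) (Q j)) < card J \<or> J = {}"
  proof (cases "J = {}")
    case False
    then have "card J > 0" using insert.hyps(1) by (simp add: card_gt_0_iff)
    then show ?thesis
      using Q(1) by (intro disjI1 degree_sum_less) (auto intro: le_less_trans[OF degree_smult_le])
  qed simp
  have degG: "degree G \<le> card J"
  proof (cases "J = {}")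
    case False
    have "degree ([:- r k, 1:] * (\<Sum>j\<in>J. smult (x j) (Q j))) \<le> 1 + degree (\<Sum>j\<in>J. smult (x j) (Q j))"
      by (rule order.trans[OF degree_mult_le]) simp
    also have "\<dots> \<le> card J" using deg_sum False by auto
    finally show ?thesis unfolding G_def by (intro degree_diff_le) auto
  qed (simp add: G_def)
  have hG: "h i = poly G (u i) / \<rho>' i" if i: "i \<in> I" for i
  proof -
    have "(\<Sum>j\<in>J. x j * b j i) = (\<Sum>j\<in>J. x j * poly (Q j) (u i)) / \<rho> i"
      using Q(2)[OF _ i] by (simp add: sum_divide_distrib)
    also have "\<dots> = (u i - r k) * (\<Sum>j\<in>J. x j * poly (Q j) (u i)) / \<rho>' i"
      using knz[OF i] unfolding \<rho>'_def by simp
    finally show ?thesis unfolding h_def G_def by (simp add: poly_sum diff_divide_distrib left_diff_distrib)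
  qed
  have Gnz: "G \<noteq> 0"
  proof
    assume "G = 0"
    then have "poly G (r k) = 0" by simp
    then show False unfolding G_def by simp
  qed
  define N where "N = (\<Sum>i\<in>I. c i * (norm (h i))\<^sup>2)"
  have "\<exists>i\<in>I. h i \<noteq> 0"
  proof (rule ccontr)
    assume "\<not> (\<exists>i\<in>I. h i \<noteq> 0)"
    then have "poly G (u i) = 0" if "i \<in> I" for i
      using that hG[OF that] \<rho>nz[OF that] knz[OF that] by (auto simp: \<rho>'_def)
    then have "u ` I \<subseteq> {y. poly G y = 0}" by auto
    then have "card (u ` I) \<le> card {y. poly G y = 0}"
      by (intro card_mono poly_roots_finite Gnz)
    also have "\<dots> \<le> degree G" by (rule card_poly_roots_bound[OF Gnz])
    finally show False using card_image[OF inj] degG insert.prems(1) card_ins by simp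
  qed
  then obtain i0 where i0: "i0 \<in> I" "h i0 \<noteq> 0" by blast
  have "N > 0"
    unfolding N_def using c i0 fin(1)
    by (intro sum_pos2[of I i0]) (auto intro!: mult_nonneg_nonneg less_imp_le[OF c])
  define s where "s = complex_of_real (1 / sqrt N)"
  have s: "s * s * N = 1" "cnj s = s" "s \<noteq> 0"
    unfolding s_def using \<open>N > 0\<close> by (auto simp flip: of_real_mult simp: field_simps)
  define b' where "b' = b(k := \<lambda>i. s * h i)"
  have b'k: "b' k = (\<lambda>i. s * h i)" and b'J: "\<And>j. j \<in> J \<Longrightarrow> b' j = b j"
    using insert.hyps(2) unfolding b'_def by auto
  have hN: "(\<Sum>i\<in>I. c i * h i * cnj (h i)) = N"
    unfolding N_def by (simp add: of_real_norm_sq mult.assoc)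
  have on1: "(\<Sum>i\<in>I. c i * b' k i * cnj (b' k i)) = 1"
  proof -
    have "(\<Sum>i\<in>I. c i * b' k i * cnj (b' k i)) = s * s * (\<Sum>i\<in>I. c i * h i * cnj (h i))"
      unfolding b'k by (simp add: sum_distrib_left s mult_ac)
    then show ?thesis using hN s by simp
  qed
  have on2: "(\<Sum>i\<in>I. c i * b' k i * cnj (b' l i)) = 0" if "l \<in> J" for l
  proof -
    have "(\<Sum>i\<in>I. c i * b' k i * cnj (b' l i)) = s * (\<Sum>i\<in>I. c i * h i * cnj (b l i))"
      unfolding b'k b'J[OF that] by (simp add: sum_distrib_left mult_ac)
    then show ?thesis using h_orth[OF that] by simp
  qed
  have on3: "(\<Sum>i\<in>I. c i * b' l i * cnj (b' k i)) = 0" if "l \<in> J" for l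
    using arg_cong[OF on2[OF that], of cnj] by (simp add: mult_ac)
  have on: "(\<Sum>i\<in>I. c i * b' j i * cnj (b' l i)) = (if j = l then 1 else 0)"
    if "j \<in> insert k J" "l \<in> insert k J" for j l
    using that on1 on2 on3 b_on b'J insert.hyps(2) by auto
  have H: "\<exists>q. degree q < card (insert k J) \<and> (\<forall>i\<in>I. b' j i = poly q (u i) / \<rho>' i)"
    if "j \<in> insert k J" for j
  proof (cases "j = k")
    case True
    show ?thesis
      using degG hG True card_ins
      by (intro exI[of _ "smult s G"]) (auto simp: b'k intro: le_less_trans[OF degree_smult_le])
  next
    case False
    then have j: "j \<in> J" using that by simp
    have "degree ([:- r k, 1:] * Q j) \<le> 1 + degree (Q j)"
      by (rule order.trans[OF degree_mult_le]) simp
    moreover have "b' j i = poly ([:- r k, 1:] * Q j) (u i) / \<rho>' i" if i: "i \<in> I" for i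
    proof -
      have "poly ([:- r k, 1:] * Q j) (u i) = (u i - r k) * poly (Q j) (u i)"
        by (simp add: algebra_simps)
      then show ?thesis using Q(2)[OF j i] knz[OF i] unfolding b'J[OF j] \<rho>'_def by simp
    qed
    ultimately show ?thesis
      using Q(1)[OF j] card_ins by (intro exI[of _ "[:- r k, 1:] * Q j"]) auto
  qed
  have span: "\<exists>y. \<forall>i\<in>I. poly q (u i) / \<rho>' i = (\<Sum>j\<in>insert k J. y j * b' j i)"
    if q: "degree q < card (insert k J)" for q
  proof -
    \<comment> \<open>Division by \<open>z - r k\<close> splits \<open>q / \<rho>'\<close> into
      \<open>q1 / \<rho>\<close>, an element of the old space, and a multiple of
      \<open>1 / \<rho>'\<close>.\<close>
    define q1 where "q1 = synthetic_div q (r k)"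
    have qq: "q = [:- r k, 1:] * q1 + [:poly q (r k):]"
      using synthetic_div_correct'[of "r k" q] unfolding q1_def by simp
    obtain y where y: "\<forall>i\<in>I. poly q1 (u i) / \<rho> i = (\<Sum>j\<in>J. y j * b j i)"
    proof (cases "card J = 0")
      case True
      then have "degree q = 0" using q card_ins by simp
      then have "q1 = 0" unfolding q1_def by (simp add: synthetic_div_eq_0_iff)
      then show thesis using True insert.hyps(1) by (intro that) auto
    next
      case False
      then have "degree q1 < card J" using q card_ins unfolding q1_def by (simp add: degree_synthetic_div)
      then show thesis using b_span that by blast
    qed
    define t where "t = poly q (r k)"
    have "poly q (u i) / \<rho>' i = (\<Sum>j\<in>J. (y j + t * x j) * b j i) + (t / s) * b' k i" if i: "i \<in> I" for i
    proof -
      have "poly q (u i) = (u i - r k) * poly q1 (u i) + t"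
        unfolding t_def using arg_cong[OF qq, of "\<lambda>p. poly p (u i)"] by (simp add: left_diff_distrib)
      then have "poly q (u i) / \<rho>' i = poly q1 (u i) / \<rho> i + t * (1 / \<rho>' i)"
        using knz[OF i] \<rho>nz[OF i] unfolding \<rho>'_def by (simp add: add_divide_distrib)
      also have "1 / \<rho>' i = (\<Sum>j\<in>J. x j * b j i) + h i" unfolding h_def by simp
      also have "poly q1 (u i) / \<rho> i = (\<Sum>j\<in>J. y j * b j i)" using y i by blast
      finally have "poly q (u i) / \<rho>' i = (\<Sum>j\<in>J. y j * b j i) + t * ((\<Sum>j\<in>J. x j * b j i) + h i)" .
      moreover have "(\<Sum>j\<in>J. (y j + t * x j) * b j i) = (\<Sum>j\<in>J. y j * b j i) + t * (\<Sum>j\<in>J. x j * b j i)"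
        by (simp add: distrib_right sum.distrib sum_distrib_left mult.assoc)
      ultimately show ?thesis using s(3) by (simp add: b'k distrib_left)
    qed
    moreover have "(\<Sum>j\<in>insert k J. (if j = k then t / s else y j + t * x j) * b' j i) =
        (\<Sum>j\<in>J. (y j + t * x j) * b j i) + (t / s) * b' k i" for i
    proof -
      have "(\<Sum>j\<in>J. (if j = k then t / s else y j + t * x j) * b' j i) =
          (\<Sum>j\<in>J. (y j + t * x j) * b j i)"
        using insert.hyps(2) b'J by (intro sum.cong) auto
      then show ?thesis using insert.hyps by simp
    qed
    ultimately show ?thesis
      by (intro exI[of _ "\<lambda>j. if j = k then t / s else y j + t * x j"]) simp
  qed
  have diag: "(\<Sum>i\<in>I. c i * u i * b' j i * cnj (b' j i)) = r j" if "j \<in> insert k J" for j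
  proof (cases "j = k")
    case False
    then show ?thesis using that b_r b'J by simp
  next
    case True
    \<comment> \<open>\<open>(u - r k) h\<close> equals \<open>G / \<rho>\<close>. Subtracting the
      constant \<open>m\<close> lowers the degree of the numerator and leaves an element of the old
      space. As \<open>h\<close> is orthogonal to that space and to the constants,
      \<open>(u - r k) h\<close> is orthogonal to \<open>h\<close>, so the diagonal entry is
      \<open>r k\<close>.\<close>
    define m where "m = coeff G (card J)"
    define q where "q = G - smult m (\<Prod>j\<in>J. [:- r j, 1:])"
    have P: "degree (\<Prod>j\<in>J. [:- r j, 1:]) = card J" "coeff (\<Prod>j\<in>J. [:- r j, 1:]) (card J) = 1"
      using insert.hyps(1) by (auto simp: degree_prod_linear coeff_prod_linear_top)
    have dq: "degree q < card J \<or> q = 0"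
    proof (cases "q = 0")
      case False
      have le: "degree q \<le> card J" unfolding q_def using degG P
        by (intro degree_diff_le) (auto intro: order.trans[OF degree_smult_le])
      have "coeff q (card J) = 0" unfolding q_def m_def using P by simp
      then show ?thesis using le False by (metis leading_coeff_0_iff le_neq_implies_less)
    qed simp
    obtain y where y: "\<forall>i\<in>I. poly q (u i) / \<rho> i = (\<Sum>j\<in>J. y j * b j i)"
    proof (cases "q = 0")
      case True
      then show thesis by (intro that[of "\<lambda>_. 0"]) auto
    next
      case False
      then show thesis using dq b_span that by blast
    qed
    have hh: "(u i - r k) * h i = (\<Sum>j\<in>J. y j * b j i) + m" if i: "i \<in> I" for i
    proof -
      have "(u i - r k) * h i = poly G (u i) / \<rho> i"
        using hG[OF i] knz[OF i] unfolding \<rho>'_def by simp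
      also have "poly G (u i) = poly q (u i) + m * \<rho> i"
        unfolding q_def \<rho>_def by (simp add: poly_prod)
      finally show ?thesis using \<rho>nz[OF i] y i by (simp add: add_divide_distrib)
    qed
    have h1: "(\<Sum>i\<in>I. c i * cnj (h i)) = 0"
    proof -
      have "(\<Sum>i\<in>I. c i * (poly G (u i) / (\<Prod>j\<in>insert k J. u i - r j))) = 0"
        using degG card_ins by (intro insert.prems(3)) auto
      then have "(\<Sum>i\<in>I. c i * h i) = 0" using hG by (simp add: prod_ins)
      from arg_cong[OF this, of cnj] show ?thesis by simp
    qed
    have h2: "(\<Sum>i\<in>I. c i * b j i * cnj (h i)) = 0" if "j \<in> J" for j
      using arg_cong[OF h_orth[OF that], of cnj] by (simp add: mult_ac)
    have "(\<Sum>i\<in>I. c i * ((u i - r k) * h i) * cnj (h i)) =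
        (\<Sum>i\<in>I. c i * ((\<Sum>j\<in>J. y j * b j i) + m) * cnj (h i))"
      by (intro sum.cong refl) (simp add: hh)
    also have "\<dots> = (\<Sum>i\<in>I. \<Sum>j\<in>J. y j * (c i * b j i * cnj (h i))) + m * (\<Sum>i\<in>I. c i * cnj (h i))"
      by (simp add: algebra_simps sum.distrib sum_distrib_left)
    also have "(\<Sum>i\<in>I. \<Sum>j\<in>J. y j * (c i * b j i * cnj (h i))) = 0"
      by (subst sum.swap) (simp add: sum_distrib_left[symmetric] h2)
    finally have "(\<Sum>i\<in>I. c i * ((u i - r k) * h i) * cnj (h i)) = 0" using h1 by simp
    then have "(\<Sum>i\<in>I. c i * u i * h i * cnj (h i)) = r k * (\<Sum>i\<in>I. c i * h i * cnj (h i))"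
      by (simp add: algebra_simps sum_subtractf sum_distrib_left)
    then have "(\<Sum>i\<in>I. c i * u i * h i * cnj (h i)) = r k * N" unfolding hN .
    moreover have "(\<Sum>i\<in>I. c i * u i * b' k i * cnj (b' k i)) = s * s * (\<Sum>i\<in>I. c i * u i * h i * cnj (h i))"
      unfolding b'k by (simp add: sum_distrib_left s mult_ac)
    ultimately have "(\<Sum>i\<in>I. c i * u i * b' k i * cnj (b' k i)) = r k * (s * s * N)"
      by (simp add: mult_ac)
    then show ?thesis using True s(1) by simp
  qed
  show ?case
    unfolding prod_ins
  proof (intro exI[of _ b'] conjI)
    show "\<forall>j\<in>insert k J. \<forall>l\<in>insert k J. (\<Sum>i\<in>I. c i * b' j i * cnj (b' l i)) = (if j = l then 1 else 0)"
      using on by blast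
    show "\<forall>j\<in>insert k J. (\<Sum>i\<in>I. c i * u i * b' j i * cnj (b' j i)) = r j"
      using diag by blast
  qed (use H span in blast)+
qed

text \<open>The weights are \<open>A j i = c i * |b j i|^2\<close> for the orthonormal flag
  \<open>b\<close>: normalization gives the row sums, the triangular diagonal gives the barycentres,
  and Bessel's inequality gives the columns.\<close>

lemma gauss_lucas_majorization_inj:
  fixes u :: "'i \<Rightarrow> complex" and c :: "'i \<Rightarrow> real" and r :: "'j \<Rightarrow> complex"
  assumes fin: "finite I" "finite J" and c: "\<And>i. i \<in> I \<Longrightarrow> c i > 0" and sumc: "sum c I = 1"
    and inj: "inj_on u I"
    and R: "(\<Prod>j\<in>J. [:- r j, 1:]) = (\<Sum>i\<in>I. smult (c i) (\<Prod>k\<in>I-{i}. [:- u k, 1:]))"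
  shows "\<exists>A :: 'j \<Rightarrow> 'i \<Rightarrow> real. (\<forall>j\<in>J. \<forall>i\<in>I. A j i \<ge> 0) \<and> (\<forall>j\<in>J. (\<Sum>i\<in>I. A j i) = 1) \<and>
    (\<forall>j\<in>J. (\<Sum>i\<in>I. A j i * u i) = r j) \<and> (\<forall>i\<in>I. (\<Sum>j\<in>J. A j i) \<le> 1 - c i)"
proof -
  have card: "card I = Suc (card J)" by (rule card_of_weighted_partial_fractions[OF fin sumc R])
  have ci: "c i * (\<Prod>k\<in>I-{i}. u i - u k) = (\<Prod>j\<in>J. u i - r j)" if i: "i \<in> I" for i
  proof -
    have "(\<Prod>j\<in>J. u i - r j) = poly (\<Prod>j\<in>J. [:- r j, 1:]) (u i)" by (simp add: poly_prod)
    also have "\<dots> = (\<Sum>l\<in>I. c l * (\<Prod>k\<in>I-{l}. u i - u k))"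
      unfolding R by (simp add: poly_prod poly_sum)
    also have "\<dots> = (\<Sum>l\<in>I. if l = i then c i * (\<Prod>k\<in>I-{i}. u i - u k) else 0)"
    proof (intro sum.cong refl)
      fix l assume "l \<in> I"
      show "c l * (\<Prod>k\<in>I-{l}. u i - u k) = (if l = i then c i * (\<Prod>k\<in>I-{i}. u i - u k) else 0)"
      proof (cases "l = i")
        case False
        then have "(\<Prod>k\<in>I-{l}. u i - u k) = 0" using i fin by (auto simp: prod_zero_iff)
        with False show ?thesis by simp
      qed auto
    qed
    also have "\<dots> = c i * (\<Prod>k\<in>I-{i}. u i - u k)" using i fin by simp
    finally show ?thesis by simp
  qed
  have Wnz: "(\<Prod>k\<in>I-{i}. u i - u k) \<noteq> 0" if "i \<in> I" for i
    using fin inj that by (auto simp: inj_on_def)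
  have Rnz: "(\<Prod>j\<in>J. u i - r j) \<noteq> 0" if "i \<in> I" for i
    using ci[OF that] Wnz[OF that] c[OF that] by (metis mult_eq_0_iff of_real_eq_0_iff order_less_irrefl)
  have nz: "u i \<noteq> r j" if "i \<in> I" "j \<in> J" for i j
    using Rnz[OF that(1)] that(2) fin(2) by auto
  \<comment> \<open>By \<open>ci\<close> the weight \<open>c i\<close> cancels the denominator up to
    the factors from \<open>J - J'\<close>, which are moved to the numerator \<open>g\<close>. What
    remains is a divided difference at \<open>card I\<close> nodes of a polynomial of degree at most
    \<open>card I - 2\<close>.\<close>
  have orth: "(\<Sum>i\<in>I. c i * (poly q (u i) / (\<Prod>j\<in>J'. u i - r j))) = 0"
    if J': "J' \<subseteq> J" and q: "degree q < card J'" for J' q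
  proof -
    define g where "g = q * (\<Prod>j\<in>J-J'. [:- r j, 1:])"
    have finJ': "finite J'" using J' fin(2) finite_subset by blast
    have "degree g \<le> degree q + card (J - J')"
      unfolding g_def using fin(2)
      by (intro order.trans[OF degree_mult_le]) (simp add: degree_prod_linear)
    moreover have "card (J - J') + card J' = card J"
      using J' fin(2) by (metis card_Diff_subset card_mono finJ' le_add_diff_inverse2)
    ultimately have "degree g + 1 < card I" using q card by linarith
    then have 0: "(\<Sum>i\<in>I. poly g (u i) / (\<Prod>k\<in>I-{i}. u i - u k)) = 0"
      by (intro sum_poly_over_diffs_eq_0 fin inj)
    have "c i * (poly q (u i) / (\<Prod>j\<in>J'. u i - r j)) = poly g (u i) / (\<Prod>k\<in>I-{i}. u i - u k)"
      if i: "i \<in> I" for i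
    proof -
      have split: "(\<Prod>j\<in>J. u i - r j) = (\<Prod>j\<in>J-J'. u i - r j) * (\<Prod>j\<in>J'. u i - r j)"
        by (rule prod.subset_diff[OF J' fin(2)])
      have "(\<Prod>j\<in>J'. u i - r j) \<noteq> 0" using Rnz[OF i] split by auto
      moreover have "poly g (u i) = poly q (u i) * (\<Prod>j\<in>J-J'. u i - r j)"
        unfolding g_def by (simp add: poly_prod)
      moreover have "c i = (\<Prod>j\<in>J-J'. u i - r j) * (\<Prod>j\<in>J'. u i - r j) / (\<Prod>k\<in>I-{i}. u i - u k)"
        using ci[OF i] Wnz[OF i] split by (simp add: field_simps)
      ultimately show ?thesis by simp
    qed
    then show ?thesis using 0 by simp
  qed
  obtain b :: "'j \<Rightarrow> 'i \<Rightarrow> complex" where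
    bH: "\<forall>j\<in>J. \<exists>q. degree q < card J \<and> (\<forall>i\<in>I. b j i = poly q (u i) / (\<Prod>k\<in>J. u i - r k))" and
    on: "\<forall>j\<in>J. \<forall>k\<in>J. (\<Sum>i\<in>I. c i * b j i * cnj (b k i)) = (if j = k then 1 else 0)" and
    diag: "\<forall>j\<in>J. (\<Sum>i\<in>I. c i * u i * b j i * cnj (b j i)) = r j"
    using orthonormal_flag[OF fin c inj _ nz orth] card by force
  define A where "A j i = c i * (norm (b j i))\<^sup>2" for j i
  have row: "(\<Sum>i\<in>I. A j i) = 1" if "j \<in> J" for j
  proof -
    have "complex_of_real (\<Sum>i\<in>I. A j i) = (\<Sum>i\<in>I. c i * b j i * cnj (b j i))"
      unfolding A_def by (simp add: of_real_norm_sq mult.assoc)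
    also have "\<dots> = 1" using on that by simp
    finally show ?thesis using of_real_eq_1_iff by blast
  qed
  have bary: "(\<Sum>i\<in>I. A j i * u i) = r j" if "j \<in> J" for j
  proof -
    have "(\<Sum>i\<in>I. A j i * u i) = (\<Sum>i\<in>I. c i * u i * b j i * cnj (b j i))"
      unfolding A_def by (simp add: of_real_norm_sq mult_ac)
    then show ?thesis using diag that by simp
  qed
  have b1: "(\<Sum>i\<in>I. c i * b j i) = 0" if j: "j \<in> J" for j
  proof -
    obtain q where q: "degree q < card J" "\<forall>i\<in>I. b j i = poly q (u i) / (\<Prod>k\<in>J. u i - r k)"
      using bH j by blast
    then show ?thesis using orth[OF order.refl q(1)] by simp
  qed
  have col: "(\<Sum>j\<in>J. A j i) \<le> 1 - c i" if i: "i \<in> I" for i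
  proof -
    \<comment> \<open>The point mass at \<open>i\<close> with its mean removed. Each
      \<open>b j\<close> is orthogonal to the constants, so the coefficients are still those of the
      point mass, \<open>c i * cnj (b j i)\<close>, while the squared norm drops from
      \<open>c i\<close> to \<open>c i * (1 - c i)\<close>. This drop is the gain in the column
      bound.\<close>
    define g where "g l = (if l = i then 1 else 0) - complex_of_real (c i)" for l
    have "(\<Sum>l\<in>I. c l * g l * cnj (b j l)) = c i * cnj (b j i)" if j: "j \<in> J" for j
    proof -
      have "(\<Sum>l\<in>I. c l * g l * cnj (b j l)) =
          (\<Sum>l\<in>I. (if l = i then c l * cnj (b j l) else 0)) - c i * cnj (\<Sum>l\<in>I. c l * b j l)"
        unfolding cnj_sum sum_distrib_left sum_subtractf[symmetric]
        by (intro sum.cong) (auto simp: g_def algebra_simps)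
      then show ?thesis using b1[OF j] i fin by simp
    qed
    then have "(norm (\<Sum>l\<in>I. c l * g l * cnj (b j l)))\<^sup>2 = c i * A j i" if "j \<in> J" for j
      using that c[OF i] unfolding A_def by (simp add: norm_mult power2_eq_square)
    then have L: "(\<Sum>j\<in>J. (norm (\<Sum>l\<in>I. c l * g l * cnj (b j l)))\<^sup>2) = c i * (\<Sum>j\<in>J. A j i)"
      unfolding sum_distrib_left by (intro sum.cong) auto
    have "(\<Sum>l\<in>I. c l * (norm (g l))\<^sup>2) = (\<Sum>l\<in>I. (if l = i then c l * (1 - 2 * c i) else 0) + c l * (c i)\<^sup>2)"
    proof (intro sum.cong refl)
      fix l
      have "g l = complex_of_real ((if l = i then 1 else 0) - c i)" unfolding g_def by simp
      then have "norm (g l) = \<bar>(if l = i then 1 else 0) - c i\<bar>" by (simp only: norm_of_real)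
      then show "c l * (norm (g l))\<^sup>2 = (if l = i then c l * (1 - 2 * c i) else 0) + c l * (c i)\<^sup>2"
        by (simp add: power2_eq_square algebra_simps)
    qed
    also have "\<dots> = c i * (1 - 2 * c i) + (\<Sum>l\<in>I. c l) * (c i)\<^sup>2"
      using i fin by (simp add: sum.distrib sum_distrib_right)
    also have "\<dots> = c i * (1 - c i)" using sumc by (simp add: power2_eq_square algebra_simps)
    finally have Rr: "(\<Sum>l\<in>I. c l * (norm (g l))\<^sup>2) = c i * (1 - c i)" .
    have "c i * (\<Sum>j\<in>J. A j i) \<le> c i * (1 - c i)"
      unfolding L[symmetric] Rr[symmetric]
      by (rule bessel_weighted) (use fin c on in \<open>auto intro: less_imp_le\<close>)
    then show ?thesis using c[OF i] by simp
  qed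
  have "A j i \<ge> 0" if "i \<in> I" for j i unfolding A_def using c[OF that] by simp
  then show ?thesis using row bary col by blast
qed

text \<open>Coinciding poles are removed one at a time. If \<open>u m = u k\<close>, the whole sum
  is divisible by \<open>z - u k\<close>, so some \<open>r l\<close> equals \<open>u k\<close>;
  cancelling the factor leaves the same problem without the pole \<open>k\<close> and the root
  \<open>l\<close>, and with weight \<open>c m + c k\<close> at \<open>m\<close>.\<close>

lemma gauss_lucas_majorization:
  fixes u :: "'i \<Rightarrow> complex" and c :: "'i \<Rightarrow> real" and r :: "'j \<Rightarrow> complex"
  assumes fin: "finite I" "finite J" and c: "\<And>i. i \<in> I \<Longrightarrow> c i > 0" and sumc: "sum c I = 1"
    and R: "(\<Prod>j\<in>J. [:- r j, 1:]) = (\<Sum>i\<in>I. smult (c i) (\<Prod>k\<in>I-{i}. [:- u k, 1:]))"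
  shows "\<exists>A :: 'j \<Rightarrow> 'i \<Rightarrow> real. (\<forall>j\<in>J. \<forall>i\<in>I. A j i \<ge> 0) \<and> (\<forall>j\<in>J. (\<Sum>i\<in>I. A j i) = 1) \<and>
    (\<forall>j\<in>J. (\<Sum>i\<in>I. A j i * u i) = r j) \<and> (\<forall>i\<in>I. (\<Sum>j\<in>J. A j i) \<le> 1 - c i)"
  using assms
proof (induction "card I" arbitrary: I J c rule: less_induct)
  case less
  note fin = less.prems(1,2) and c = less.prems(3) and sumc = less.prems(4) and R = less.prems(5)
  show ?case
  proof (cases "inj_on u I")
    case True
    then show ?thesis using gauss_lucas_majorization_inj[OF fin c sumc True R] by blast
  next
    case False
    then obtain m k where mk: "m \<in> I" "k \<in> I" "m \<noteq> k" "u m = u k" by (auto simp: inj_on_def)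
    define I' where "I' = I - {k}"
    define c' where "c' = c(m := c m + c k)"
    have finI': "finite I'" and I: "I = insert k I'" "k \<notin> I'" and m: "m \<in> I'"
      using fin mk unfolding I'_def by auto
    define L where "L B = (\<Prod>k\<in>B. [:- u k, 1:])" for B
    have Ldel: "L (B - {i}) = [:- u k, 1:] * L (B - {k} - {i})"
      if "finite B" "k \<in> B" "i \<noteq> k" for B i
    proof -
      have eq: "B - {i} = insert k (B - {k} - {i})" using that by auto
      show ?thesis unfolding L_def eq by (rule prod.insert) (use that in auto)
    qed
    have Lk: "L (I - {k}) = [:- u k, 1:] * L (I' - {m})"
      unfolding L_def I'_def[symmetric] using finI' m mk(4) by (simp add: prod.remove)
    have Rf: "(\<Sum>i\<in>I. smult (c i) (L (I - {i}))) = [:- u k, 1:] * (\<Sum>i\<in>I'. smult (c' i) (L (I' - {i})))"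
    proof -
      have "(\<Sum>i\<in>I. smult (c i) (L (I - {i}))) =
          smult (c k) (L (I - {k})) + (\<Sum>i\<in>I'. smult (c i) (L (I - {i})))"
        using I finI' by simp
      also have "(\<Sum>i\<in>I'. smult (c i) (L (I - {i}))) = [:- u k, 1:] * (\<Sum>i\<in>I'. smult (c i) (L (I' - {i})))"
        unfolding sum_distrib_left
      proof (intro sum.cong refl)
        fix i assume "i \<in> I'"
        then have "L (I - {i}) = [:- u k, 1:] * L (I' - {i})"
          unfolding I'_def using Ldel[OF fin(1) mk(2), of i] by blast
        then show "smult (c i) (L (I - {i})) = [:- u k, 1:] * smult (c i) (L (I' - {i}))"
          by (simp only: mult_smult_right)
      qed
      also have "smult (c k) (L (I - {k})) = [:- u k, 1:] * (\<Sum>i\<in>I'. if i = m then smult (c k) (L (I' - {m})) else 0)"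
        using finI' m unfolding Lk mult_smult_right by simp
      finally have "(\<Sum>i\<in>I. smult (c i) (L (I - {i}))) =
        [:- u k, 1:] * (\<Sum>i\<in>I'. (if i = m then smult (c k) (L (I' - {m})) else 0) + smult (c i) (L (I' - {i})))"
        unfolding sum.distrib distrib_left .
      also have "(\<Sum>i\<in>I'. (if i = m then smult (c k) (L (I' - {m})) else 0) + smult (c i) (L (I' - {i}))) =
         (\<Sum>i\<in>I'. smult (c' i) (L (I' - {i})))"
        by (intro sum.cong refl) (auto simp: c'_def smult_add_left)
      finally show ?thesis .
    qed
    have R': "(\<Prod>j\<in>J. [:- r j, 1:]) = [:- u k, 1:] * (\<Sum>i\<in>I'. smult (c' i) (L (I' - {i})))"
      using R Rf unfolding L_def by simp
    have "poly (\<Prod>j\<in>J. [:- r j, 1:]) (u k) = 0" unfolding R' by simp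
    then obtain l where l: "l \<in> J" "r l = u k" using fin(2) by (auto simp: poly_prod)
    define J' where "J' = J - {l}"
    have finJ': "finite J'" and J: "J = insert l J'" "l \<notin> J'" using fin l unfolding J'_def by auto
    have "[:- u k, 1:] * (\<Prod>j\<in>J'. [:- r j, 1:]) = [:- u k, 1:] * (\<Sum>i\<in>I'. smult (c' i) (L (I' - {i})))"
      unfolding R'[symmetric] J(1) using J(2) finJ' l(2) by simp
    then have R'': "(\<Prod>j\<in>J'. [:- r j, 1:]) = (\<Sum>i\<in>I'. smult (c' i) (\<Prod>k\<in>I'-{i}. [:- u k, 1:]))"
      unfolding L_def by (subst (asm) mult_cancel_left) simp
    have sumc': "sum c' I' = 1"
    proof -
      have "sum c' I' = (\<Sum>i\<in>I'. c i + (if i = m then c k else 0))"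
        unfolding c'_def by (intro sum.cong) auto
      also have "\<dots> = sum c I" using I finI' m by (simp add: sum.distrib)
      finally show ?thesis using sumc by simp
    qed
    have lt: "card I' < card I" using fin(1) mk(2) unfolding I'_def by (intro card_Diff1_less)
    have c'pos: "c' i > 0" if "i \<in> I'" for i
      using that c mk unfolding c'_def I by (auto intro: add_pos_pos)
    obtain A :: "'j \<Rightarrow> 'i \<Rightarrow> real" where A0: "\<And>j i. j \<in> J' \<Longrightarrow> i \<in> I' \<Longrightarrow> A j i \<ge> 0"
      and A1: "\<And>j. j \<in> J' \<Longrightarrow> (\<Sum>i\<in>I'. A j i) = 1"
      and Ar: "\<And>j. j \<in> J' \<Longrightarrow> (\<Sum>i\<in>I'. A j i * u i) = r j"
      and Ac: "\<And>i. i \<in> I' \<Longrightarrow> (\<Sum>j\<in>J'. A j i) \<le> 1 - c' i"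
      using less.hyps[OF lt finI' finJ' c'pos sumc' R''] by (auto simp: Ball_def)
    \<comment> \<open>The rows inherited from the merged problem keep all their mass at \<open>m\<close>; the row of the
      split-off root, which sits at the double point, is shared so as to respect both columns.\<close>
    define B where "B j i = (if j = l then (if i = m then c k else if i = k then 1 - c k else 0)
                             else if i = k then 0 else A j i)" for j i
    have ck1: "c k \<le> 1"
      using member_le_sum[of k I c] sumc c mk fin by (auto intro: less_imp_le)
    have Bk: "B j k = (if j = l then 1 - c k else 0)" for j
      using mk(3) unfolding B_def by simp
    have BJ: "B j i = A j i" if "j \<in> J'" "i \<in> I'" for j i
      using that I J unfolding B_def by auto
    have Bl: "B l i = (if i = m then c k else 0)" if "i \<in> I'" for i
      using that I(2) unfolding B_def by auto
    have "B j i \<ge> 0" if "j \<in> J" "i \<in> I" for j i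
      using that ck1 c[OF mk(2)] A0 I J unfolding B_def by auto
    moreover have "(\<Sum>i\<in>I. B j i) = 1" if "j \<in> J" for j
    proof (cases "j = l")
      case True
      then show ?thesis using I finI' m by (simp add: Bk Bl)
    next
      case False
      then show ?thesis using that I J finI' by (simp add: Bk BJ A1)
    qed
    moreover have "(\<Sum>i\<in>I. B j i * u i) = r j" if "j \<in> J" for j
    proof (cases "j = l")
      case True
      have "(\<Sum>i\<in>I'. B l i * u i) = (\<Sum>i\<in>I'. if i = m then c k * u m else 0)"
        by (intro sum.cong refl) (simp add: Bl)
      then have "(\<Sum>i\<in>I. B l i * u i) = (1 - c k) * u k + (\<Sum>i\<in>I'. if i = m then c k * u m else 0)"
        unfolding I(1) using I(2) finI' by (simp add: Bk)
      also have "\<dots> = u k" using finI' m mk(4) by (simp add: algebra_simps)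
      finally show ?thesis using True l by simp
    next
      case False
      then show ?thesis using that I J finI' by (simp add: Bk BJ Ar)
    qed
    \<comment> \<open>Column \<open>m\<close> inherits at most \<open>1 - (c m + c k)\<close> and
      receives \<open>c k\<close> from row \<open>l\<close>; in column \<open>k\<close> only the
      entry \<open>1 - c k\<close> is present.\<close>
    moreover have "(\<Sum>j\<in>J. B j i) \<le> 1 - c i" if "i \<in> I" for i
    proof (cases "i = k")
      case True
      then show ?thesis using fin l by (simp add: Bk)
    next
      case False
      then have i: "i \<in> I'" using that I by simp
      then show ?thesis using Ac[OF i] J finJ' by (auto simp: Bl BJ c'_def split: if_splits)
    qed
    ultimately show ?thesis by blast
  qed
qed

text \<open>Censoring a Markov chain on a finite set of transient states: they are removed one at a
  time, and the bounds on the column sums survive.\<close>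

lemma eliminate_transient:
  fixes x y :: "'i \<Rightarrow> complex" and C :: "'i \<Rightarrow> 'i \<Rightarrow> real"
  assumes "finite Z" "finite I" "finite J" "Z \<inter> I = {}" "Z \<inter> J = {}"
    and "\<And>i j. i \<in> I \<union> Z \<Longrightarrow> j \<in> J \<union> Z \<Longrightarrow> C i j \<ge> 0"
    and "\<And>i. i \<in> I \<union> Z \<Longrightarrow> (\<Sum>j\<in>J \<union> Z. C i j) = 1"
    and "\<And>i. i \<in> I \<union> Z \<Longrightarrow> (\<Sum>j\<in>J \<union> Z. C i j * y j) = x i"
    and "\<And>j. j \<in> J \<Longrightarrow> (\<Sum>i\<in>I \<union> Z. C i j) \<le> 1"
    and "\<And>j. j \<in> Z \<Longrightarrow> (\<Sum>i\<in>I \<union> Z. C i j) < 1"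
    and "\<And>k. k \<in> Z \<Longrightarrow> x k = y k"
  shows "\<exists>M :: 'i \<Rightarrow> 'i \<Rightarrow> real. (\<forall>i\<in>I. \<forall>j\<in>J. M i j \<ge> 0) \<and> (\<forall>i\<in>I. (\<Sum>j\<in>J. M i j) = 1) \<and>
    (\<forall>i\<in>I. (\<Sum>j\<in>J. M i j * y j) = x i) \<and> (\<forall>j\<in>J. (\<Sum>i\<in>I. M i j) \<le> 1)"
  using assms
proof (induction Z arbitrary: C rule: finite_induct)
  case empty
  then show ?case by (intro exI[of _ C]) auto
next
  case (insert k Z)
  note prems = insert.prems
  have k: "k \<notin> I \<union> Z" "k \<notin> J \<union> Z" and fin: "finite (I \<union> Z)" "finite (J \<union> Z)"
    using insert.hyps prems by auto
  have ins: "I \<union> insert k Z = insert k (I \<union> Z)" "J \<union> insert k Z = insert k (J \<union> Z)" by auto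
  note nn = prems(5)[unfolded ins] and row = prems(6)[unfolded ins] and bary = prems(7)[unfolded ins]
    and col = prems(8)[unfolded ins] and colZ = prems(9)[unfolded ins]
  have colk: "C k k + (\<Sum>i\<in>I \<union> Z. C i k) < 1" using colZ[of k] k fin by simp
  have "(\<Sum>i\<in>I \<union> Z. C i k) \<ge> 0" using nn by (intro sum_nonneg) auto
  then have d: "1 - C k k > 0" using colk by simp
  \<comment> \<open>The chain watched off \<open>k\<close>: an excursion may stay at
    \<open>k\<close> for any number of steps, and the geometric series over these stays gives the
    factor \<open>1 / (1 - C k k)\<close>.\<close>
  define C' where "C' i j = C i j + C i k * C k j / (1 - C k k)" for i j
  have rowk: "(\<Sum>j\<in>J \<union> Z. C k j) = 1 - C k k" using row[of k] k fin by simp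
  have row': "(\<Sum>j\<in>J \<union> Z. C' i j) = 1" if "i \<in> I \<union> Z" for i
  proof -
    have "(\<Sum>j\<in>J \<union> Z. C' i j) = (\<Sum>j\<in>J \<union> Z. C i j) + C i k * (\<Sum>j\<in>J \<union> Z. C k j) / (1 - C k k)"
      unfolding C'_def by (simp add: sum.distrib sum_distrib_left sum_divide_distrib)
    also have "\<dots> = (\<Sum>j\<in>J \<union> Z. C i j) + C i k" using d rowk by simp
    also have "\<dots> = 1" using row[of i] that k fin by simp
    finally show ?thesis .
  qed
  have baryk: "(\<Sum>j\<in>J \<union> Z. C k j * y j) = (1 - C k k) * y k"
    using bary[of k] k fin prems(10)[of k] by (simp add: algebra_simps)
  have bary': "(\<Sum>j\<in>J \<union> Z. C' i j * y j) = x i" if "i \<in> I \<union> Z" for i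
  proof -
    have "(\<Sum>j\<in>J \<union> Z. C' i j * y j) =
        (\<Sum>j\<in>J \<union> Z. C i j * y j) + C i k * (\<Sum>j\<in>J \<union> Z. C k j * y j) / (1 - C k k)"
      unfolding C'_def by (simp add: sum.distrib sum_distrib_left sum_divide_distrib algebra_simps)
    also have "\<dots> = (\<Sum>j\<in>J \<union> Z. C i j * y j) + C i k * (y k * ((1 - C k k) / (1 - C k k)))"
      unfolding baryk by simp
    also have "complex_of_real ((1 - C k k) / (1 - C k k)) = 1"
      using d by simp
    also have "(\<Sum>j\<in>J \<union> Z. C i j * y j) + C i k * (y k * 1) = x i"
      using bary[of i] that k fin by (simp add: add.commute)
    finally show ?thesis .
  qed
  \<comment> \<open>Redistributing the visits to \<open>k\<close> adds at most \<open>C k j\<close>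
    to column \<open>j\<close>, because the inflow into \<open>k\<close> is at most
    \<open>1 - C k k\<close> by the bound on column \<open>k\<close>; dropping row \<open>k\<close>
    removes just \<open>C k j\<close>. So weak and strict column bounds are both inherited.\<close>
  have col': "(\<Sum>i\<in>I \<union> Z. C' i j) \<le> (\<Sum>i\<in>insert k (I \<union> Z). C i j)" if "j \<in> J \<union> Z" for j
  proof -
    have "(\<Sum>i\<in>I \<union> Z. C' i j) = (\<Sum>i\<in>I \<union> Z. C i j) + C k j * ((\<Sum>i\<in>I \<union> Z. C i k) / (1 - C k k))"
      unfolding C'_def by (simp add: sum.distrib sum_distrib_left sum_divide_distrib mult_ac)
    also have "C k j * ((\<Sum>i\<in>I \<union> Z. C i k) / (1 - C k k)) \<le> C k j * 1"
      using nn[of k j] that colk d by (intro mult_left_mono) auto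
    finally show ?thesis using k fin by simp
  qed
  show ?case
  proof (rule insert.IH[where C = C'])
    show "C' i j \<ge> 0" if "i \<in> I \<union> Z" "j \<in> J \<union> Z" for i j
      unfolding C'_def using nn that d by (intro add_nonneg_nonneg divide_nonneg_pos mult_nonneg_nonneg) auto
    show "(\<Sum>i\<in>I \<union> Z. C' i j) \<le> 1" if "j \<in> J" for j
      using col'[of j] col[of j] that by simp
    show "(\<Sum>i\<in>I \<union> Z. C' i j) < 1" if "j \<in> Z" for j
      using col'[of j] colZ[of j] that by simp
    show "x k = y k" if "k \<in> Z" for k using prems(10) that by simp
  qed (use prems(1-4) row' bary' in auto)
qed

section \<open>Heine--Stieltjes polynomials\<close>

lemma smult_sum_right: "smult c (\<Sum>i\<in>A. f i) = (\<Sum>i\<in>A. smult c (f i))"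
  by (induction A rule: infinite_finite_induct) (simp_all add: smult_add_right)

lemma poly_weighted_partial_fractions:
  fixes u :: "'i \<Rightarrow> complex"
  assumes "finite I" "\<And>i. i \<in> I \<Longrightarrow> z \<noteq> u i"
  shows "poly (\<Sum>i\<in>I. smult (c i) (\<Prod>k\<in>I-{i}. [:- u k, 1:])) z =
    poly (\<Prod>i\<in>I. [:- u i, 1:]) z * (\<Sum>i\<in>I. c i / (z - u i))"
proof -
  have "poly (\<Prod>i\<in>I. [:- u i, 1:]) z * (c i / (z - u i)) = c i * (\<Prod>k\<in>I-{i}. z - u k)" if "i \<in> I" for i
  proof -
    have "(\<Prod>k\<in>I. z - u k) = (z - u i) * (\<Prod>k\<in>I-{i}. z - u k)"
      using assms(1) that by (rule prod.remove)
    then show ?thesis using assms(2)[OF that] by (simp add: poly_prod)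
  qed
  then show ?thesis by (simp add: poly_sum poly_prod sum_distrib_left)
qed

text \<open>For \<open>\<delta> > 0\<close> the unit factor \<open>b\<close> rotates all the kernels
  into one half plane, where an average cannot cancel.\<close>

lemma norm_weighted_cauchy_ge:
  fixes u :: "'i \<Rightarrow> complex"
  assumes "finite I" "\<And>i. i \<in> I \<Longrightarrow> c i \<ge> 0" "sum c I = 1" "norm b = 1"
    and "\<And>i. i \<in> I \<Longrightarrow> \<delta> \<le> Re (b / (z - u i))"
  shows "\<delta> \<le> norm (\<Sum>i\<in>I. complex_of_real (c i) / (z - u i))"
proof -
  have "\<delta> = (\<Sum>i\<in>I. c i * \<delta>)" using assms(3) by (simp add: sum_distrib_right[symmetric])
  also have "\<dots> \<le> (\<Sum>i\<in>I. c i * Re (b / (z - u i)))" using assms by (intro sum_mono mult_left_mono) auto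
  also have "\<dots> = (\<Sum>i\<in>I. Re (complex_of_real (c i) * (b / (z - u i))))"
    by (simp only: Re_complex_of_real Im_complex_of_real times_complex.sel) simp
  also have "\<dots> = Re (b * (\<Sum>i\<in>I. complex_of_real (c i) / (z - u i)))"
    by (simp add: sum_distrib_left Re_sum mult_ac)
  also have "\<dots> \<le> norm (b * (\<Sum>i\<in>I. complex_of_real (c i) / (z - u i)))" by (rule complex_Re_le_cmod)
  finally show ?thesis using assms(4) by (simp add: norm_mult)
qed

text \<open>A line separating \<open>z\<close> from \<open>K\<close>, with normal \<open>a\<close>,
  provides \<open>b = - a / norm a\<close>. Then the real part of \<open>b / (z - w)\<close> is the
  component of \<open>w - z\<close> along \<open>a\<close>, which is at least the gap, divided by
  \<open>|z - w|^2\<close>, which is at most \<open>D^2\<close>.\<close>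

lemma Re_cauchy_kernel_bounded_below:
  fixes z :: complex
  assumes "convex K" "compact K" "z \<notin> K"
  obtains b \<delta> where "norm b = 1" "\<delta> > 0" "\<And>w. w \<in> K \<Longrightarrow> \<delta> \<le> Re (b / (z - w))"
proof -
  have cl: "closed K" using assms(2) by (rule compact_imp_closed)
  obtain a d where ad: "inner a z < d" "\<And>x. x \<in> K \<Longrightarrow> inner a x > d"
    using separating_hyperplane_closed_point[OF assms(1) cl assms(3)] by blast
  obtain D where D: "D > 0" "\<And>w. w \<in> K \<Longrightarrow> norm (z - w) \<le> D"
  proof -
    have "bounded ((\<lambda>w. z - w) ` K)"
      using assms(2) by (intro compact_imp_bounded compact_continuous_image continuous_intros)
    then show thesis using that unfolding bounded_pos by auto
  qed
  show thesis
  proof (cases "K = {}")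
    case True
    then show thesis using that[of 1 1] by simp
  next
    case False
    then have a: "a \<noteq> 0" using ad by force
    define b where "b = - a / norm a"
    define \<delta> where "\<delta> = (d - inner a z) / (norm a * D\<^sup>2)"
    have "norm b = 1" unfolding b_def using a by (simp add: norm_divide)
    moreover have "\<delta> > 0" unfolding \<delta>_def using ad(1) a D(1) by simp
    moreover have "\<delta> \<le> Re (b / (z - w))" if w: "w \<in> K" for w
    proof -
      have nz: "z - w \<noteq> 0" using w assms(3) by auto
      have "Re (b / (z - w)) = Re (b * cnj (z - w)) / (norm (z - w))\<^sup>2"
        unfolding complex_div_cnj[of b "z - w"] by (rule Re_divide_of_real)
      also have "Re (b * cnj (z - w)) = (inner a w - inner a z) / norm a"
        using a unfolding b_def inner_complex_def by (simp add: field_simps)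
      finally have eq: "Re (b / (z - w)) = (inner a w - inner a z) / (norm a * (norm (z - w))\<^sup>2)" by simp
      show ?thesis unfolding eq \<delta>_def
        using ad(1) ad(2)[OF w] a nz D w by (intro frac_le mult_left_mono power_mono) auto
    qed
    ultimately show thesis using that by blast
  qed
qed

text \<open>Collects what is used about the differential equation: the matrix \<open>M\<close>
  yields the couplings, and the lower bound on \<open>|V / Q2|\<close> yields the
  potentials.\<close>

lemma heine_stieltjes_coupling:
  fixes \<zeta> :: "nat \<Rightarrow> complex" and a :: "nat \<Rightarrow> real" and Q2 Q1 S W V :: "complex poly"
  assumes p: "p \<ge> 2" and a: "\<And>l. l \<in> {1..p} \<Longrightarrow> a l > 0"
    and Q2: "Q2 = (\<Prod>l=1..p. [:- \<zeta> l, 1:])"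
    and Q1: "\<And>z. poly Q2 z \<noteq> 0 \<Longrightarrow>
               poly Q1 z / poly Q2 z = (\<Sum>l=1..p. complex_of_real (a l) / (z - \<zeta> l))"
    and S: "degree S \<ge> 1" "lead_coeff S = 1"
    and W: "degree W = p - 2" "Q2 * pderiv (pderiv S) + Q1 * pderiv S + W * S = 0"
    and V: "V = smult c W" "c \<noteq> 0" "lead_coeff V = 1"
    and K: "convex K" "compact K" "\<And>l. l \<in> {1..p} \<Longrightarrow> \<zeta> l \<in> K"
  shows "\<exists>v M. V = (\<Prod>i<p-2. [:- v i, 1:]) \<and> (\<forall>i<p-2. \<forall>l\<in>{1..p}. M i l \<ge> (0::real)) \<and>
     (\<forall>i<p-2. (\<Sum>l=1..p. M i l) = 1) \<and> (\<forall>i<p-2. (\<Sum>l=1..p. M i l * \<zeta> l) = v i) \<and>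
     (\<forall>l\<in>{1..p}. (\<Sum>i<p-2. M i l) \<le> 1) \<and>
     (\<forall>z \<delta> b. z \<notin> K \<longrightarrow> norm b = 1 \<longrightarrow> \<delta> > 0 \<longrightarrow> (\<forall>w\<in>K. \<delta> \<le> Re (b / (z - w))) \<longrightarrow>
        \<delta>\<^sup>2 * norm (poly Q2 z) \<le> norm (poly V z))"
proof -
  define n where "n = degree S"
  have n: "n \<ge> 1" using S unfolding n_def by simp
  obtain z where z: "S = (\<Prod>k<n. [:- z k, 1:])"
    using complex_poly_decompose'[of S] S unfolding n_def by (metis smult_1_left)
  have degV: "degree V = p - 2" using V W by simp
  obtain v where v: "V = (\<Prod>i<p-2. [:- v i, 1:])"
    using complex_poly_decompose'[of V] V degV by (metis smult_1_left)
  define T where "T = smult (1 / n) (pderiv S)"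
  have T_eq: "T = (\<Sum>k<n. smult (complex_of_real (1 / n)) (\<Prod>k'\<in>{..<n}-{k}. [:- z k', 1:]))"
    unfolding T_def z pderiv_prod by (simp add: pderiv_pCons smult_sum_right)
  have sum1: "(\<Sum>k<n. 1 / real n) = 1" using n by simp
  have T_mon: "lead_coeff T = 1" "degree T = n - 1"
    unfolding T_eq using monic_weighted_partial_fractions[of "{..<n}" "\<lambda>_. 1 / real n" z] sum1 by auto
  obtain w where w: "T = (\<Prod>j<n-1. [:- w j, 1:])"
    using complex_poly_decompose'[of T] T_mon by (metis smult_1_left)
  obtain B where B0: "\<And>j k. j < n - 1 \<Longrightarrow> k < n \<Longrightarrow> B j k \<ge> (0::real)"
    and B1: "\<And>j. j < n - 1 \<Longrightarrow> (\<Sum>k<n. B j k) = 1"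
    and Bz: "\<And>j. j < n - 1 \<Longrightarrow> (\<Sum>k<n. B j k * z k) = w j"
    and Bc: "\<And>k. k < n \<Longrightarrow> (\<Sum>j<n-1. B j k) \<le> 1 - 1 / n"
    using gauss_lucas_majorization[of "{..<n}" "{..<n-1}" "\<lambda>_. 1 / real n" w z] sum1 n T_eq
    unfolding w by (auto simp: Ball_def)
  \<comment> \<open>Total weight of \<open>Q1 / Q2 + T' / T\<close>: the residues
    \<open>a l\<close>, and one for each of the \<open>n - 1\<close> zeros of \<open>T\<close>.
    Dividing by it makes the weights \<open>e\<close> sum to 1.\<close>
  define \<rho> where "\<rho> = (\<Sum>l=1..p. a l) + real (n - 1)"
  have "(\<Sum>l=1..p. a l) > 0" using a p by (intro sum_pos) auto
  then have \<rho>: "\<rho> > 0" unfolding \<rho>_def by simp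
  \<comment> \<open>Indices are tagged so that repeated zeros stay apart: \<open>J\<close> and
    \<open>U\<close> index the zeros of \<open>Q2\<close> and \<open>T\<close>, while
    \<open>I\<close> and \<open>Z\<close> index those of \<open>V\<close> and \<open>S\<close>.
    \<open>J\<close> and \<open>I\<close> overlap as sets, which is harmless because one provides
    columns and the other rows.\<close>
  define J where "J = (Inl ` {1..p} :: (nat + nat) set)"
  define I where "I = (Inl ` {..<p-2} :: (nat + nat) set)"
  define Z where "Z = (Inr ` {..<n} :: (nat + nat) set)"
  define U where "U = (Inr ` {..<n-1} :: (nat + nat) set)"
  define x where "x = case_sum v z"
  define y where "y = case_sum \<zeta> z"
  define u where "u = case_sum \<zeta> w"
  define e where "e = case_sum (\<lambda>l. a l / \<rho>) (\<lambda>_ :: nat. 1 / \<rho>)"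
  have fin: "finite I" "finite J" "finite Z" "finite U" unfolding I_def J_def Z_def U_def by auto
  have disj: "J \<inter> U = {}" "I \<inter> Z = {}" "J \<inter> Z = {}" unfolding I_def J_def Z_def U_def by auto
  have sumJ: "sum g J = (\<Sum>l=1..p. g (Inl l))" for g :: "nat + nat \<Rightarrow> 'b::comm_monoid_add"
    unfolding J_def by (subst sum.reindex) auto
  have sumI: "sum g I = (\<Sum>i<p-2. g (Inl i))" for g :: "nat + nat \<Rightarrow> 'b::comm_monoid_add"
    unfolding I_def by (subst sum.reindex) auto
  have sumZ: "sum g Z = (\<Sum>k<n. g (Inr k))" for g :: "nat + nat \<Rightarrow> 'b::comm_monoid_add"
    unfolding Z_def by (subst sum.reindex) auto
  have sumU: "sum g U = (\<Sum>j<n-1. g (Inr j))" for g :: "nat + nat \<Rightarrow> 'b::comm_monoid_add"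
    unfolding U_def by (subst sum.reindex) auto
  have prodJ: "(\<Prod>i\<in>J. [:- u i, 1:]) = Q2" unfolding J_def Q2 by (subst prod.reindex) (auto simp: u_def)
  have prodU: "(\<Prod>i\<in>U. [:- u i, 1:]) = T" unfolding U_def w by (subst prod.reindex) (auto simp: u_def)
  have prodI: "(\<Prod>i\<in>I. [:- x i, 1:]) = V" unfolding I_def v by (subst prod.reindex) (auto simp: x_def)
  have prodZ: "(\<Prod>i\<in>Z. [:- x i, 1:]) = S" unfolding Z_def z by (subst prod.reindex) (auto simp: x_def)
  define F where "F = (\<Sum>i\<in>J \<union> U. smult (complex_of_real (e i)) (\<Prod>k\<in>(J \<union> U)-{i}. [:- u k, 1:]))"
  have sume: "sum e (J \<union> U) = 1"
    using disj fin \<rho> unfolding \<rho>_def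
    by (simp add: sum.union_disjoint sumJ sumU e_def flip: sum_divide_distrib) (simp add: \<rho>_def flip: add_divide_distrib)
  \<comment> \<open>\<open>Q1\<close> is given only through its values off the zeros of
    \<open>Q2\<close>; polynomials that agree off a finite set are equal.\<close>
  have Q1_eq: "Q1 = (\<Sum>l=1..p. smult (a l) (\<Prod>k\<in>{1..p}-{l}. [:- \<zeta> k, 1:]))" (is "_ = ?R")
  proof (rule ccontr)
    assume "Q1 \<noteq> ?R"
    then have "Q1 - ?R \<noteq> 0" by simp
    then have f1: "finite {z. poly (Q1 - ?R) z = 0}" by (rule poly_roots_finite)
    have "Q2 \<noteq> 0" unfolding Q2 by (simp add: prod_zero_iff)
    then have f2: "finite {z. poly Q2 z = 0}" by (rule poly_roots_finite)
    have "poly Q1 z = poly ?R z" if z: "poly Q2 z \<noteq> 0" for z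
    proof -
      have "z \<noteq> \<zeta> l" if "l \<in> {1..p}" for l
        using z that unfolding Q2 by (auto simp: poly_prod)
      then have "poly ?R z = poly Q2 z * (\<Sum>l=1..p. a l / (z - \<zeta> l))"
        unfolding Q2 by (intro poly_weighted_partial_fractions) auto
      also have "\<dots> = poly Q1 z" using Q1[OF z] z by (simp add: field_simps)
      finally show ?thesis by simp
    qed
    then have "UNIV \<subseteq> {z. poly (Q1 - ?R) z = 0} \<union> {z. poly Q2 z = 0}" by auto
    then show False using f1 f2 infinite_UNIV_char_0[where ?'a=complex] by (meson finite_UnI finite_subset)
  qed
  have F_eq: "smult \<rho> F = Q2 * pderiv T + Q1 * T"
  proof -
    have "smult \<rho> (smult (e i) (\<Prod>k\<in>(J \<union> U)-{i}. [:- u k, 1:])) =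
        smult (\<rho> * e i) (\<Prod>k\<in>J-{i}. [:- u k, 1:]) * T" if "i \<in> J" for i
    proof -
      have eq: "(J \<union> U) - {i} = (J - {i}) \<union> U" using that disj by auto
      have "(\<Prod>k\<in>(J \<union> U)-{i}. [:- u k, 1:]) = (\<Prod>k\<in>J-{i}. [:- u k, 1:]) * T"
        unfolding eq prodU[symmetric] by (rule prod.union_disjoint) (use fin disj in auto)
      then show ?thesis by simp
    qed
    moreover have "smult \<rho> (smult (e i) (\<Prod>k\<in>(J \<union> U)-{i}. [:- u k, 1:])) =
        Q2 * smult (\<rho> * e i) (\<Prod>k\<in>U-{i}. [:- u k, 1:])" if "i \<in> U" for i
    proof -
      have eq: "(J \<union> U) - {i} = J \<union> (U - {i})" using that disj by auto
      have "(\<Prod>k\<in>(J \<union> U)-{i}. [:- u k, 1:]) = Q2 * (\<Prod>k\<in>U-{i}. [:- u k, 1:])"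
        unfolding eq prodJ[symmetric] by (rule prod.union_disjoint) (use fin disj in auto)
      then show ?thesis by simp
    qed
    ultimately have "smult \<rho> F = (\<Sum>i\<in>J. smult (\<rho> * e i) (\<Prod>k\<in>J-{i}. [:- u k, 1:])) * T
        + Q2 * (\<Sum>i\<in>U. smult (\<rho> * e i) (\<Prod>k\<in>U-{i}. [:- u k, 1:]))"
      unfolding F_def sum.union_disjoint[OF fin(2,4) disj(1)] smult_add_right smult_sum_right
        sum_distrib_right sum_distrib_left
      by (intro arg_cong2[where f="(+)"] sum.cong refl) auto
    also have "(\<Sum>i\<in>U. smult (\<rho> * e i) (\<Prod>k\<in>U-{i}. [:- u k, 1:])) = pderiv T"
      unfolding prodU[symmetric] pderiv_prod using \<rho> by (intro sum.cong refl) (auto simp: e_def U_def pderiv_pCons)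
    also have "(\<Sum>i\<in>J. smult (\<rho> * e i) (\<Prod>k\<in>J-{i}. [:- u k, 1:])) = Q1"
    proof -
      have "(\<Prod>k\<in>J-{Inl l}. [:- u k, 1:]) = (\<Prod>k\<in>{1..p}-{l}. [:- \<zeta> k, 1:])" for l
      proof -
        have "J - {Inl l} = Inl ` ({1..p} - {l})" unfolding J_def by auto
        then show ?thesis by (simp add: prod.reindex u_def)
      qed
      then show ?thesis unfolding sumJ Q1_eq using \<rho> by (intro sum.cong refl) (simp add: e_def)
    qed
    finally show ?thesis by (simp add: add.commute)
  qed
  have VS: "V * S = F"
  proof -
    have nz: "complex_of_nat n \<noteq> 0" using n by simp
    have S': "pderiv S = smult (of_nat n) T" unfolding T_def using nz by simp
    have "W * S = - (Q2 * pderiv (pderiv S) + Q1 * pderiv S)" using W(2) by (metis add_eq_0_iff2 minus_add_cancel)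
    also have "\<dots> = - smult (of_nat n) (Q2 * pderiv T + Q1 * T)"
      unfolding S' by (simp add: pderiv_smult smult_add_right)
    also have "\<dots> = smult (- of_nat n * \<rho>) F" unfolding F_eq[symmetric] by simp
    finally have eq: "V * S = smult (c * (- of_nat n * \<rho>)) F" unfolding V(1) by simp
    \<comment> \<open>Both \<open>V * S\<close> and \<open>F\<close> are monic, which fixes the
      scalar between them whatever the normalizing constant \<open>c\<close> is.\<close>
    have "lead_coeff F = 1"
      unfolding F_def by (rule monic_weighted_partial_fractions) (use fin sume in auto)
    moreover have "lead_coeff (V * S) = 1" using V S by (simp add: lead_coeff_mult)
    ultimately have "c * (- of_nat n * \<rho>) = 1"
      unfolding eq lead_coeff_smult by simp
    then show ?thesis using eq by simp
  qed
  have "(\<Prod>j\<in>I \<union> Z. [:- x j, 1:]) = V * S"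
    unfolding prodI[symmetric] prodZ[symmetric] by (rule prod.union_disjoint[OF fin(1,3) disj(2)])
  then have VS': "(\<Prod>j\<in>I \<union> Z. [:- x j, 1:]) =
      (\<Sum>i\<in>J \<union> U. smult (complex_of_real (e i)) (\<Prod>k\<in>J \<union> U - {i}. [:- u k, 1:]))"
    using VS unfolding F_def by simp
  have e_pos: "e i > 0" if "i \<in> J \<union> U" for i
    using that a \<rho> unfolding e_def J_def U_def by auto
  obtain A :: "nat + nat \<Rightarrow> nat + nat \<Rightarrow> real" where
    A: "\<forall>j\<in>I \<union> Z. \<forall>i\<in>J \<union> U. A j i \<ge> 0" "\<forall>j\<in>I \<union> Z. (\<Sum>i\<in>J \<union> U. A j i) = 1"
      "\<forall>j\<in>I \<union> Z. (\<Sum>i\<in>J \<union> U. A j i * u i) = x j"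
      "\<forall>i\<in>J \<union> U. (\<Sum>j\<in>I \<union> Z. A j i) \<le> 1 - e i"
    using gauss_lucas_majorization[OF finite_UnI[OF fin(2,4)] finite_UnI[OF fin(1,3)] _ sume VS'] e_pos
    by blast
  note A0 = A(1)[rule_format] and A1 = A(2)[rule_format] and Au = A(3)[rule_format] and Ac = A(4)[rule_format]
  have e0: "e i \<ge> 0" if "i \<in> J \<union> U" for i
    using that a \<rho> unfolding e_def J_def U_def by (auto intro: less_imp_le)
  \<comment> \<open>In the means given by \<open>A\<close>, each zero \<open>w m\<close> of
    \<open>T\<close> is replaced by its own mean over the zeros of \<open>S\<close>, taken from
    \<open>B\<close>. The zeros of \<open>S\<close> now occur both as rows and as columns.\<close>
  define C where "C i j = (case j of Inl l \<Rightarrow> A i (Inl l) | Inr k \<Rightarrow> (\<Sum>m<n-1. A i (Inr m) * B m k))" for i j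
  have U_in: "Inr m \<in> J \<union> U" if "m < n - 1" for m using that unfolding U_def by auto
  have J_in: "Inl l \<in> J \<union> U" if "l \<in> {1..p}" for l using that unfolding J_def by auto
  have C0: "C i j \<ge> 0" if "i \<in> I \<union> Z" "j \<in> J \<union> Z" for i j
    using that A0[OF that(1)] B0 unfolding C_def
    by (auto simp: J_def Z_def U_def intro!: sum_nonneg mult_nonneg_nonneg)
  have C1: "(\<Sum>j\<in>J \<union> Z. C i j) = 1" if "i \<in> I \<union> Z" for i
  proof -
    have "(\<Sum>k<n. \<Sum>m<n-1. A i (Inr m) * B m k) = (\<Sum>m<n-1. A i (Inr m))"
      by (subst sum.swap) (simp add: sum_distrib_left[symmetric] B1)
    then show ?thesis using A1[OF that]
      by (simp add: sum.union_disjoint fin disj sumJ sumU sumZ C_def)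
  qed
  have Cy: "(\<Sum>j\<in>J \<union> Z. C i j * y j) = x i" if "i \<in> I \<union> Z" for i
  proof -
    have "(\<Sum>k<n. C i (Inr k) * y (Inr k)) = (\<Sum>k<n. \<Sum>m<n-1. A i (Inr m) * (B m k * z k))"
      by (simp add: C_def y_def sum_distrib_right mult.assoc)
    also have "\<dots> = (\<Sum>m<n-1. A i (Inr m) * w m)"
      by (subst sum.swap) (simp add: sum_distrib_left[symmetric] Bz)
    finally show ?thesis using Au[OF that]
      by (simp add: sum.union_disjoint fin disj sumJ sumU sumZ) (simp add: C_def y_def u_def)
  qed
  have CJ: "(\<Sum>i\<in>I \<union> Z. C i j) \<le> 1" if "j \<in> J" for j
    using that Ac[of j] e0[of j] unfolding J_def C_def by auto
  \<comment> \<open>The strict inequality comes from the columns of \<open>B\<close>, with sums at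
    most \<open>1 - 1 / n\<close>; it is what makes every zero of \<open>S\<close>
    transient.\<close>
  have CZ: "(\<Sum>i\<in>I \<union> Z. C i j) < 1" if j: "j \<in> Z" for j
  proof -
    obtain k where k: "k < n" "j = Inr k" using j unfolding Z_def by auto
    have "(\<Sum>i\<in>I \<union> Z. C i j) = (\<Sum>m<n-1. (\<Sum>i\<in>I \<union> Z. A i (Inr m)) * B m k)"
      unfolding k(2) C_def by (simp add: sum_distrib_right) (rule sum.swap)
    also have "\<dots> \<le> (\<Sum>m<n-1. 1 * B m k)"
      using Ac[OF U_in] e0[OF U_in] B0 k(1) by (intro sum_mono mult_right_mono) force+
    also have "\<dots> \<le> 1 - 1 / real n" using Bc[OF k(1)] by simp
    also have "\<dots> < 1" using n by simp
    finally show ?thesis .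
  qed
  have xy: "x i = y i" if "i \<in> Z" for i using that unfolding x_def y_def Z_def by auto
  have disj': "Z \<inter> I = {}" "Z \<inter> J = {}" using disj by auto
  obtain M where M: "\<forall>i\<in>I. \<forall>j\<in>J. M i j \<ge> (0::real)" "\<forall>i\<in>I. (\<Sum>j\<in>J. M i j) = 1"
      "\<forall>i\<in>I. (\<Sum>j\<in>J. M i j * y j) = x i" "\<forall>j\<in>J. (\<Sum>i\<in>I. M i j) \<le> 1"
    using eliminate_transient[OF fin(3,1,2) disj'(1,2) C0 C1 Cy CJ CZ xy] by blast
  \<comment> \<open>The convex function \<open>g\<close> measures how far a point lies beyond a line
    separating \<open>z k\<close> from \<open>K\<close>. It vanishes at the zeros of
    \<open>Q2\<close>, so summing the mean value relations over \<open>Z\<close> bounds the total of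
    \<open>g\<close> on the zeros of \<open>S\<close> by the same total weighted with column sums
    below 1. This forces \<open>g\<close> to vanish there.\<close>
  have zK: "z k \<in> K" if k: "k < n" for k
  proof (rule ccontr)
    assume "z k \<notin> K"
    then obtain \<alpha> d where sep: "inner \<alpha> (z k) < d" "\<And>x. x \<in> K \<Longrightarrow> inner \<alpha> x > d"
      using separating_hyperplane_closed_point[OF K(1) compact_imp_closed[OF K(2)]] by blast
    define g where "g x = max 0 (d - inner \<alpha> x)" for x :: complex
    have g0: "g x \<ge> 0" for x unfolding g_def by simp
    have gJ: "g (y j) = 0" if "j \<in> J" for j
      using that sep(2)[OF K(3)] unfolding g_def y_def J_def by (force simp: max_def)
    have row: "g (x i) \<le> (\<Sum>j\<in>Z. C i j * g (y j))" if i: "i \<in> Z" for i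
    proof -
      have i': "i \<in> I \<union> Z" using i by simp
      have "d - inner \<alpha> (x i) = (\<Sum>j\<in>J \<union> Z. C i j * (d - inner \<alpha> (y j)))"
      proof -
        have "inner \<alpha> (x i) = (\<Sum>j\<in>J \<union> Z. C i j * inner \<alpha> (y j))"
          unfolding Cy[OF i', symmetric] inner_sum_right
          by (intro sum.cong refl) (simp flip: scaleR_conv_of_real)
        moreover have "d = (\<Sum>j\<in>J \<union> Z. C i j * d)" using C1[OF i'] by (simp flip: sum_distrib_right)
        ultimately show ?thesis by (simp add: right_diff_distrib sum_subtractf)
      qed
      also have "\<dots> \<le> (\<Sum>j\<in>J \<union> Z. C i j * g (y j))"
        using C0[OF i'] unfolding g_def by (intro sum_mono mult_left_mono) auto
      also have "\<dots> = (\<Sum>j\<in>Z. C i j * g (y j))"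
        using gJ by (simp add: sum.union_disjoint fin disj)
      finally have "d - inner \<alpha> (x i) \<le> (\<Sum>j\<in>Z. C i j * g (y j))" .
      moreover have "0 \<le> (\<Sum>j\<in>Z. C i j * g (y j))"
        using C0[OF i'] g0 by (intro sum_nonneg mult_nonneg_nonneg) auto
      ultimately show ?thesis unfolding g_def[of "x i"] by simp
    qed
    have "(\<Sum>i\<in>Z. g (y i)) \<le> (\<Sum>i\<in>Z. \<Sum>j\<in>Z. C i j * g (y j))"
      using row xy by (intro sum_mono) force
    also have "\<dots> = (\<Sum>j\<in>Z. (\<Sum>i\<in>Z. C i j) * g (y j))"
      by (subst sum.swap) (simp add: sum_distrib_right)
    finally have "0 \<le> (\<Sum>j\<in>Z. ((\<Sum>i\<in>Z. C i j) - 1) * g (y j))"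
      by (simp add: left_diff_distrib sum_subtractf)
    moreover have "(\<Sum>j\<in>Z. ((\<Sum>i\<in>Z. C i j) - 1) * g (y j)) < (\<Sum>j\<in>Z. 0)"
    proof (rule sum_strict_mono_ex1)
      have lt: "(\<Sum>i\<in>Z. C i j) < 1" if "j \<in> Z" for j
      proof -
        have "(\<Sum>i\<in>Z. C i j) \<le> (\<Sum>i\<in>I \<union> Z. C i j)"
          using fin C0 that by (intro sum_mono2) auto
        then show ?thesis using CZ[OF that] by simp
      qed
      show "\<forall>j\<in>Z. ((\<Sum>i\<in>Z. C i j) - 1) * g (y j) \<le> 0"
        using less_imp_le[OF lt] g0 by (intro ballI mult_nonpos_nonneg) auto
      have "Inr k \<in> Z" using k unfolding Z_def by simp
      moreover have "g (y (Inr k)) > 0" unfolding g_def y_def using sep(1) by simp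
      ultimately show "\<exists>j\<in>Z. ((\<Sum>i\<in>Z. C i j) - 1) * g (y j) < 0"
        using lt by (intro bexI[of _ "Inr k"] mult_neg_pos) auto
    qed (use fin in auto)
    ultimately show False by simp
  qed
  have wK: "w j \<in> K" if "j < n - 1" for j
  proof -
    have "(\<Sum>k<n. B j k *\<^sub>R z k) \<in> K"
      using that B0 B1 zK by (intro convex_sum K) auto
    then show ?thesis using Bz[OF that] by (simp add: scaleR_conv_of_real)
  qed
  have uK: "u i \<in> K" if "i \<in> J \<union> U" for i
    using that wK K(3) unfolding u_def J_def U_def by auto
  \<comment> \<open>Off \<open>K\<close>, \<open>V / Q2\<close> is the product of two Cauchy
    transforms, one of the weights \<open>e\<close> at the points \<open>u i\<close> and one of the
    uniform weights at the \<open>z k\<close>. Each has modulus at least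
    \<open>\<delta>\<close>.\<close>
  have lower: "\<delta>\<^sup>2 * norm (poly Q2 t) \<le> norm (poly V t)"
    if t: "t \<notin> K" "norm b = 1" "\<delta> > 0" "\<forall>w\<in>K. \<delta> \<le> Re (b / (t - w))" for t \<delta> b
  proof -
    have "poly S t \<noteq> 0" using zK t(1) unfolding z by (auto simp: poly_prod)
    have "poly F t = poly (\<Prod>i\<in>J \<union> U. [:- u i, 1:]) t * (\<Sum>i\<in>J \<union> U. e i / (t - u i))"
      unfolding F_def using t(1) uK fin by (intro poly_weighted_partial_fractions) auto
    also have "(\<Prod>i\<in>J \<union> U. [:- u i, 1:]) = Q2 * T"
      using prod.union_disjoint[OF fin(2,4) disj(1)] prodJ prodU by metis
    finally have 1: "norm (poly V t) * norm (poly S t) =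
        norm (poly Q2 t) * norm (poly T t) * norm (\<Sum>i\<in>J \<union> U. e i / (t - u i))"
      unfolding VS[symmetric] by (simp flip: norm_mult)
    have 2: "\<delta> \<le> norm (\<Sum>i\<in>J \<union> U. e i / (t - u i))"
      using fin e0 sume t uK by (intro norm_weighted_cauchy_ge[where b = b]) auto
    have "poly T t = poly (\<Prod>k<n. [:- z k, 1:]) t * (\<Sum>k<n. complex_of_real (1 / n) / (t - z k))"
      unfolding T_eq using t(1) zK by (intro poly_weighted_partial_fractions) auto
    then have 3: "norm (poly T t) = norm (poly S t) * norm (\<Sum>k<n. complex_of_real (1 / n) / (t - z k))"
      unfolding z[symmetric] by (simp only: norm_mult)
    have 4: "\<delta> \<le> norm (\<Sum>k<n. complex_of_real (1 / n) / (t - z k))"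
      using sum1 t zK by (intro norm_weighted_cauchy_ge[where b = b]) auto
    have "\<delta>\<^sup>2 * norm (poly Q2 t) * norm (poly S t) = norm (poly Q2 t) * (norm (poly S t) * \<delta>) * \<delta>"
      by (simp add: power2_eq_square)
    also have "\<dots> \<le> norm (poly V t) * norm (poly S t)"
      unfolding 1 3 using 2 4 t(3) by (intro mult_mono mult_left_mono) auto
    finally show ?thesis using \<open>poly S t \<noteq> 0\<close> by simp
  qed
  show ?thesis
  proof (intro exI[of _ v] exI[of _ "\<lambda>i l. M (Inl i) (Inl l)"] conjI)
    show "V = (\<Prod>i<p-2. [:- v i, 1:])" by (rule v)
    show "\<forall>z \<delta> b. z \<notin> K \<longrightarrow> norm b = 1 \<longrightarrow> \<delta> > 0 \<longrightarrow> (\<forall>w\<in>K. \<delta> \<le> Re (b / (z - w))) \<longrightarrow>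
        \<delta>\<^sup>2 * norm (poly Q2 z) \<le> norm (poly V z)"
      using lower by blast
  qed (use M in \<open>simp_all add: sumI sumJ\<close>, auto simp: I_def J_def x_def y_def)
qed

section \<open>A space-filling curve\<close>

text \<open>An even function of period 2, equal to 0 on \<open>[0, 1/3]\<close> and to 1 on
  \<open>[2/3, 1]\<close>. A clipped cosine takes the place of the usual piecewise linear
  profile.\<close>

definition schoenberg_wave :: "real \<Rightarrow> real" where
  "schoenberg_wave t = max 0 (min 1 (1 / 2 - cos (pi * t)))"

lemma schoenberg_wave_bounds: "0 \<le> schoenberg_wave t" "schoenberg_wave t \<le> 1"
  unfolding schoenberg_wave_def by auto

lemma continuous_on_schoenberg_wave [continuous_intros]:
  fixes f :: "'a::t2_space \<Rightarrow> real"
  shows "continuous_on A f \<Longrightarrow> continuous_on A (\<lambda>t. schoenberg_wave (f t))"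
  unfolding schoenberg_wave_def
  by (intro continuous_on_max continuous_on_min continuous_on_cos continuous_on_diff continuous_on_mult continuous_on_const)

lemma schoenberg_wave_digit:
  assumes b: "b \<in> {0, 1}" and x: "0 \<le> x" "x \<le> 1 / 3"
  shows "schoenberg_wave (2 * of_int k + 2 * b / 3 + x) = b"
proof -
  have "cos (pi * (2 * of_int k + 2 * b / 3 + x)) = cos (pi * (2 * b / 3 + x) + 2 * pi * of_int k)"
    by (simp add: algebra_simps)
  also have "\<dots> = cos (pi * (2 * b / 3 + x))"
    by (simp add: cos_add)
  finally have eq: "cos (pi * (2 * of_int k + 2 * b / 3 + x)) = cos (pi * (2 * b / 3 + x))" .
  show ?thesis
  proof (cases "b = 0")
    case True
    have "cos (pi / 3) \<le> cos (pi * x)"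
      using x by (intro cos_monotone_0_pi_le) auto
    then show ?thesis unfolding schoenberg_wave_def eq using True by (simp add: cos_60)
  next
    case False
    then have b1: "b = 1" using b by simp
    have "cos (pi * (2 / 3 + x)) \<le> cos (2 * pi / 3)"
      using x by (intro cos_monotone_0_pi_le) (auto simp: field_simps)
    also have "\<dots> = - 1 / 2" by (simp add: cos_120)
    finally show ?thesis unfolding schoenberg_wave_def eq using b1 by simp
  qed
qed

text \<open>\<open>t\<close> is the point of the Cantor set with ternary digits
  \<open>2 * b k\<close>. As all digits are even, \<open>3 ^ m * t\<close> differs from the tail
  \<open>r m\<close> by an even integer, invisible to a wave of period 2; the leading digit of the
  tail places it in \<open>[0, 1/3]\<close> or in \<open>[2/3, 1]\<close>.\<close>

lemma ternary_point:
  fixes b :: "nat \<Rightarrow> real"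
  assumes b: "\<And>k. b k \<in> {0, 1}"
  obtains t where "0 \<le> t" "t \<le> 1" "\<And>k. schoenberg_wave (3 ^ k * t) = b k"
proof -
  define f where "f k = 2 * b k / 3 ^ Suc k" for k
  have b01: "0 \<le> b k" "b k \<le> 1" for k using b[of k] by auto
  have g: "(\<lambda>k. 2 / 3 * (1 / 3 :: real) ^ k) sums (2 / 3 * (1 / (1 - 1 / 3)))"
    by (intro sums_mult geometric_sums) auto
  have tail_g: "(\<lambda>k. (2 * b (k + m) / 3 ^ Suc k :: real)) sums (\<Sum>k. 2 * b (k + m) / 3 ^ Suc k)" for m
    by (intro summable_sums summable_comparison_test'[OF sums_summable[OF g]])
       (use b01 in \<open>auto simp: power_one_over divide_simps\<close>)
  define r where "r m = (\<Sum>k. 2 * b (k + m) / 3 ^ Suc k)" for m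
  have r01: "0 \<le> r m" "r m \<le> 1" for m
  proof -
    show "0 \<le> r m" unfolding r_def by (intro suminf_nonneg sums_summable[OF tail_g]) (use b01 in auto)
    have "r m \<le> 2 / 3 * (1 / (1 - 1 / 3))"
      unfolding r_def
      by (rule sums_le[OF _ tail_g g]) (use b01 in \<open>auto simp: power_one_over divide_simps\<close>)
    then show "r m \<le> 1" by simp
  qed
  have step: "3 * r m = 2 * b m + r (Suc m)" for m
  proof -
    have "r m = (\<Sum>k. 2 * b (Suc k + m) / 3 ^ Suc (Suc k)) + 2 * b m / 3"
      unfolding r_def using suminf_split_head[OF sums_summable[OF tail_g[of m]]] by simp
    also have "(\<Sum>k. 2 * b (Suc k + m) / 3 ^ Suc (Suc k)) = (\<Sum>k. 2 * b (k + Suc m) / 3 ^ Suc k / 3)"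
      by (intro suminf_cong) simp
    also have "\<dots> = r (Suc m) / 3"
      unfolding r_def by (rule suminf_divide[OF sums_summable[OF tail_g]])
    finally show ?thesis by simp
  qed
  have main: "\<exists>k::int. 3 ^ m * r 0 = 2 * of_int k + r m" for m
  proof (induction m)
    case 0
    show ?case by (intro exI[of _ 0]) simp
  next
    case (Suc m)
    then obtain k :: int where "3 ^ m * r 0 = 2 * of_int k + r m" by blast
    then have "3 ^ Suc m * r 0 = 6 * of_int k + 2 * b m + r (Suc m)" using step[of m] by simp
    moreover have "b m = of_int \<lfloor>b m\<rfloor>" using b[of m] by auto
    ultimately show ?case by (intro exI[of _ "3 * k + \<lfloor>b m\<rfloor>"]) simp
  qed
  show thesis
  proof (rule that[of "r 0"])
    fix m
    obtain k :: int where k: "3 ^ m * r 0 = 2 * of_int k + r m" using main by blast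
    have "r m = 2 * b m / 3 + r (Suc m) / 3" using step[of m] by simp
    then show "schoenberg_wave (3 ^ m * r 0) = b m"
      unfolding k using schoenberg_wave_digit[OF b[of m], of "r (Suc m) / 3" k] r01[of "Suc m"]
      by (simp add: add.assoc)
  qed (use r01 in auto)
qed

lemma binary_expansion:
  fixes x :: real
  assumes x: "0 \<le> x" "x < 1"
  obtains b :: "nat \<Rightarrow> real" where "\<And>k. b k \<in> {0, 1}" "(\<lambda>k. b k / 2 ^ Suc k) sums x"
proof -
  \<comment> \<open>Successive floors give the binary digits. The partial sums telescope from
    \<open>\<lfloor>x\<rfloor> = 0\<close>, which is where \<open>x < 1\<close> enters.\<close>
  define b :: "nat \<Rightarrow> real" where "b k = of_int (\<lfloor>2 ^ Suc k * x\<rfloor> - 2 * \<lfloor>2 ^ k * x\<rfloor>)" for k :: nat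
  have b: "b k \<in> {0, 1}" for k
  proof -
    define y where "y = 2 ^ k * x"
    have "\<lfloor>2 * y\<rfloor> - 2 * \<lfloor>y\<rfloor> = 0 \<or> \<lfloor>2 * y\<rfloor> - 2 * \<lfloor>y\<rfloor> = 1" by linarith
    then show ?thesis unfolding b_def y_def by (auto simp: mult.assoc)
  qed
  have part: "(\<Sum>k<n. b k / 2 ^ Suc k) = of_int \<lfloor>2 ^ n * x\<rfloor> / 2 ^ n" for n
  proof (induction n)
    case 0
    have "\<lfloor>x\<rfloor> = 0" using x by linarith
    then show ?case by simp
  next
    case (Suc n)
    then show ?case by (simp add: b_def field_simps)
  qed
  have "(\<lambda>n. of_int \<lfloor>2 ^ n * x\<rfloor> / 2 ^ n) \<longlonglongrightarrow> x"
  proof (rule real_tendsto_sandwich)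
    have "(\<lambda>n. x - (1/2)^n) \<longlonglongrightarrow> x - 0"
      by (intro tendsto_intros LIMSEQ_realpow_zero) auto
    then show "(\<lambda>n. x - (1/2)^n) \<longlonglongrightarrow> x" by simp
    show "eventually (\<lambda>n. x - (1/2)^n \<le> of_int \<lfloor>2 ^ n * x\<rfloor> / 2 ^ n) sequentially"
    proof (rule always_eventually, rule allI)
      fix n :: nat
      have "2 ^ n * x - 1 \<le> of_int \<lfloor>2 ^ n * x\<rfloor>" by linarith
      then have "(2 ^ n * x - 1) / 2 ^ n \<le> of_int \<lfloor>2 ^ n * x\<rfloor> / 2 ^ n" by (rule divide_right_mono) simp
      then show "x - (1/2)^n \<le> of_int \<lfloor>2 ^ n * x\<rfloor> / 2 ^ n"
        by (simp add: diff_divide_distrib power_one_over)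
    qed
    show "eventually (\<lambda>n. of_int \<lfloor>2 ^ n * x\<rfloor> / 2 ^ n \<le> x) sequentially"
    proof (rule always_eventually, rule allI)
      fix n :: nat
      have "of_int \<lfloor>2 ^ n * x\<rfloor> \<le> 2 ^ n * x" by linarith
      then show "of_int \<lfloor>2 ^ n * x\<rfloor> / 2 ^ n \<le> x" by (simp add: field_simps)
    qed
  qed simp
  then have "(\<lambda>k. b k / 2 ^ Suc k) sums x" unfolding sums_def part .
  with b show thesis using that by blast
qed

text \<open>Schoenberg's space-filling curve: the ternary digits of the parameter are read off
  alternately as the binary digits of the coordinates.\<close>

definition schoenberg_coord :: "nat \<Rightarrow> nat \<Rightarrow> real \<Rightarrow> real" where
  "schoenberg_coord d j t = (\<Sum>k. schoenberg_wave (3 ^ (d * k + j) * t) / 2 ^ Suc k)"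

lemma summable_half_powers: "summable (\<lambda>k. (1::real) / 2 ^ Suc k)"
  using power_half_series by (simp add: sums_iff power_one_over)

lemma continuous_on_schoenberg_coord: "continuous_on UNIV (schoenberg_coord d j)"
proof -
  have "uniform_limit UNIV (\<lambda>n t. \<Sum>k<n. schoenberg_wave (3 ^ (d * k + j) * t) / 2 ^ Suc k)
      (schoenberg_coord d j) sequentially"
    unfolding schoenberg_coord_def[abs_def]
  proof (rule Weierstrass_m_test)
    show "norm (schoenberg_wave (3 ^ (d * k + j) * t) / 2 ^ Suc k) \<le> 1 / 2 ^ Suc k" for k t
      using schoenberg_wave_bounds by (simp add: divide_simps)
  qed (rule summable_half_powers)
  then show ?thesis
    by (rule uniform_limit_theorem[rotated]) (auto intro!: always_eventually continuous_intros)
qed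

lemma schoenberg_coord_bounds: "0 \<le> schoenberg_coord d j t" "schoenberg_coord d j t \<le> 1"
proof -
  have s: "summable (\<lambda>k. schoenberg_wave (3 ^ (d * k + j) * t) / 2 ^ Suc k)"
    by (intro summable_comparison_test'[OF summable_half_powers])
       (use schoenberg_wave_bounds in \<open>auto simp: divide_simps\<close>)
  show "0 \<le> schoenberg_coord d j t"
    unfolding schoenberg_coord_def by (intro suminf_nonneg s) (use schoenberg_wave_bounds in auto)
  have "schoenberg_coord d j t \<le> (\<Sum>k. 1 / 2 ^ Suc k)"
    unfolding schoenberg_coord_def
    by (intro suminf_le s summable_half_powers) (use schoenberg_wave_bounds in \<open>auto simp: divide_simps\<close>)
  also have "\<dots> = 1" using power_half_series by (simp add: sums_iff power_one_over)
  finally show "schoenberg_coord d j t \<le> 1" .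
qed

lemma schoenberg_coord_surj:
  assumes d: "d > 0" and x: "\<And>j. j < d \<Longrightarrow> 0 \<le> x j \<and> x j < 1"
  obtains t where "0 \<le> t" "t \<le> 1" "\<And>j. j < d \<Longrightarrow> schoenberg_coord d j t = x j"
proof -
  have "\<exists>b :: nat \<Rightarrow> real. (\<forall>k. b k \<in> {0, 1}) \<and> (\<lambda>k. b k / 2 ^ Suc k) sums x j" if "j < d" for j
    using x[OF that] binary_expansion[of "x j"] by metis
  then obtain b :: "nat \<Rightarrow> nat \<Rightarrow> real" where
    b: "\<And>j k. j < d \<Longrightarrow> b j k \<in> {0, 1}" "\<And>j. j < d \<Longrightarrow> (\<lambda>k. b j k / 2 ^ Suc k) sums x j"
    by metis
  have "b (m mod d) (m div d) \<in> {0, 1}" for m using b(1) d by simp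
  then obtain t where t: "0 \<le> t" "t \<le> 1" "\<And>m. schoenberg_wave (3 ^ m * t) = b (m mod d) (m div d)"
    using ternary_point[of "\<lambda>m. b (m mod d) (m div d)"] by blast
  have "schoenberg_coord d j t = x j" if j: "j < d" for j
  proof -
    have "schoenberg_wave (3 ^ (d * k + j) * t) = b j k" for k
      unfolding t(3) using j by simp
    then show ?thesis unfolding schoenberg_coord_def using b(2)[OF j] by (simp add: sums_iff)
  qed
  with t show thesis using that by blast
qed

lemma space_filling_curve:
  fixes K :: "complex set"
  assumes "bounded K"
  obtains X Y :: "real \<Rightarrow> complex" where
    "continuous_on UNIV X" "continuous_on UNIV Y" "bounded (range X)" "bounded (range Y)"
    "\<And>x y. x \<in> K \<Longrightarrow> y \<in> K \<Longrightarrow> \<exists>t\<in>{0..1}. X t = x \<and> Y t = y"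
proof -
  obtain L where L: "L > 0" "\<And>x. x \<in> K \<Longrightarrow> norm x \<le> L"
    using assms unfolding bounded_pos by blast
  \<comment> \<open>Carries \<open>[0, 1]\<close> onto \<open>[- 2 * L, 2 * L]\<close>. The extra
    factor 2 leaves room: prescribed coordinates of the curve must lie in \<open>[0, 1)\<close>, and
    the range \<open>[- L, L]\<close> corresponds to \<open>[1/4, 3/4]\<close>.\<close>
  define h where "h s = 4 * L * (s - 1 / 2)" for s
  define X where "X t = Complex (h (schoenberg_coord 4 0 t)) (h (schoenberg_coord 4 1 t))" for t
  define Y where "Y t = Complex (h (schoenberg_coord 4 2 t)) (h (schoenberg_coord 4 3 t))" for t
  have cont: "continuous_on UNIV (\<lambda>t. Complex (h (schoenberg_coord 4 i t)) (h (schoenberg_coord 4 j t)))" for i j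
    unfolding h_def Complex_eq by (intro continuous_intros continuous_on_schoenberg_coord)
  have h: "\<bar>h (schoenberg_coord 4 i t)\<bar> \<le> 2 * L" for i t
  proof -
    have "\<bar>schoenberg_coord 4 i t - 1 / 2\<bar> \<le> 1 / 2" using schoenberg_coord_bounds[of 4 i t] by linarith
    then have "4 * L * \<bar>schoenberg_coord 4 i t - 1 / 2\<bar> \<le> 4 * L * (1 / 2)"
      using L(1) by (intro mult_left_mono) auto
    then show ?thesis unfolding h_def using L(1) by (simp add: abs_mult)
  qed
  have bdd: "bounded (range (\<lambda>t. Complex (h (schoenberg_coord 4 i t)) (h (schoenberg_coord 4 j t))))" for i j
  proof (rule boundedI[where B = "4 * L"], clarify)
    fix t
    show "norm (Complex (h (schoenberg_coord 4 i t)) (h (schoenberg_coord 4 j t))) \<le> 4 * L"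
      using cmod_le[of "Complex (h (schoenberg_coord 4 i t)) (h (schoenberg_coord 4 j t))"] h[of i t] h[of j t]
      by simp
  qed
  have ex: "\<exists>t\<in>{0..1}. X t = x \<and> Y t = y" if "x \<in> K" "y \<in> K" for x y
  proof -
    define c where "c s = s / (4 * L) + 1 / 2" for s
    have hc: "h (c s) = s" for s unfolding h_def c_def using L(1) by simp
    have c01: "0 \<le> c s \<and> c s < 1" if "\<bar>s\<bar> \<le> L" for s
      unfolding c_def using that L(1) by (auto simp: field_simps abs_le_iff)
    define g where "g j = c (if j = 0 then Re x else if j = 1 then Im x else if j = 2 then Re y else Im y)" for j :: nat
    have "0 \<le> g j \<and> g j < 1" if "j < 4" for j
      unfolding g_def using L(2)[OF \<open>x \<in> K\<close>] L(2)[OF \<open>y \<in> K\<close>]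
        abs_Re_le_cmod[of x] abs_Im_le_cmod[of x] abs_Re_le_cmod[of y] abs_Im_le_cmod[of y]
      by (intro c01) (auto intro: order.trans)
    then obtain t where t: "0 \<le> t" "t \<le> 1" "\<And>j. j < 4 \<Longrightarrow> schoenberg_coord 4 j t = g j"
      using schoenberg_coord_surj[of 4 g] by (metis zero_less_numeral)
    then have "X t = x" "Y t = y" unfolding X_def Y_def by (simp_all add: g_def hc)
    with t show ?thesis by auto
  qed
  show thesis
    using cont bdd ex by (intro that[of X Y]) (auto simp: X_def[abs_def] Y_def[abs_def])
qed

section \<open>Disintegration and dilations\<close>

text \<open>The functions \<open>max 0 (1 - n * infdist x A)\<close> decrease to the indicator of a
  nonempty closed set \<open>A\<close>, and closed sets form an intersection-stable generator of the
  Borel sets. The empty set is treated apart because \<open>infdist x {}\<close> is 0.\<close>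

lemma finite_measure_eqI_continuous:
  fixes M N :: "'a::metric_space measure"
  assumes fin: "finite_measure M" "finite_measure N" and sets: "sets M = sets borel" "sets N = sets borel"
    and eq: "\<And>f :: 'a \<Rightarrow> real. continuous_on UNIV f \<Longrightarrow> bounded (range f) \<Longrightarrow> (LINT x|M. f x) = (LINT x|N. f x)"
  shows "M = N"
proof -
  have lim: "(\<lambda>n. LINT x|M'. max 0 (1 - real n * infdist x A)) \<longlonglongrightarrow> measure M' A"
    if M': "finite_measure M'" "sets M' = sets borel" and A: "closed A" "A \<noteq> {}" for M' :: "'a measure" and A
  proof -
    interpret finite_measure M' by fact
    have [measurable_cong]: "sets M' = sets borel" by fact
    have "(\<lambda>n. LINT x|M'. max 0 (1 - real n * infdist x A)) \<longlonglongrightarrow> (LINT x|M'. indicator A x)"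
    proof (rule integral_dominated_convergence[where w = "\<lambda>_. 1"])
      have "(\<lambda>x. infdist x A) \<in> borel_measurable borel"
        by (intro borel_measurable_continuous_onI continuous_intros)
      then show "(\<lambda>x. max 0 (1 - real n * infdist x A)) \<in> borel_measurable M'" for n
        using M'(2) by (simp cong: measurable_cong_sets)
      show "indicator A \<in> borel_measurable M'"
        using A(1) M'(2) by (simp cong: measurable_cong_sets add: borel_measurable_indicator)
      show "AE x in M'. (\<lambda>n. max 0 (1 - real n * infdist x A)) \<longlonglongrightarrow> indicator A x"
      proof (rule AE_I2)
        fix x
        show "(\<lambda>n. max 0 (1 - real n * infdist x A)) \<longlonglongrightarrow> indicator A x"
        proof (cases "x \<in> A")
          case True
          then show ?thesis by simp
        next
          case False
          then have pos: "infdist x A > 0"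
            using A in_closed_iff_infdist_zero infdist_nonneg[of x A] by (metis less_eq_real_def)
          obtain m where m: "real m * infdist x A > 1" using reals_Archimedean3[OF pos] by blast
          have "max 0 (1 - real n * infdist x A) = 0" if "n \<ge> m" for n
          proof -
            have "real m * infdist x A \<le> real n * infdist x A"
              using that pos by (intro mult_right_mono) auto
            then show ?thesis using m by simp
          qed
          then have "eventually (\<lambda>n. max 0 (1 - real n * infdist x A) = indicator A x) sequentially"
            using False by (auto simp: eventually_sequentially)
          then show ?thesis by (rule tendsto_eventually)
        qed
      qed
    qed (auto simp: infdist_nonneg)
    also have "(LINT x|M'. indicator A x) = measure M' A"
      using sets_eq_imp_space_eq[OF M'(2)] by simp
    finally show ?thesis .
  qed
  have bdd: "bounded (range (\<lambda>x. max 0 (1 - real n * infdist x A)))" for n and A :: "'a set"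
    by (rule boundedI[of _ 1]) (auto simp: infdist_nonneg)
  have closed: "emeasure M A = emeasure N A" if A: "closed A" for A
  proof (cases "A = {}")
    case False
    have "(LINT x|M. max 0 (1 - real n * infdist x A)) = (LINT x|N. max 0 (1 - real n * infdist x A))" for n
      by (intro eq bdd continuous_intros)
    then have "measure M A = measure N A"
      using lim[OF fin(1) sets(1) A False] lim[OF fin(2) sets(2) A False] by (simp add: LIMSEQ_unique)
    then show ?thesis using fin by (simp add: finite_measure.emeasure_eq_measure)
  qed simp
  show ?thesis
  proof (rule measure_eqI_generator_eq[where E = "Collect closed" and \<Omega> = UNIV and A = "\<lambda>_. UNIV"])
    show "Int_stable (Collect (closed :: 'a set \<Rightarrow> bool))" by (auto intro!: Int_stableI)
    show "sets M = sigma_sets UNIV (Collect closed)" "sets N = sigma_sets UNIV (Collect closed)"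
      unfolding sets borel_eq_closed by simp_all
    show "emeasure M UNIV \<noteq> \<infinity>" using finite_measure.emeasure_finite[OF fin(1)] by simp
  qed (use closed in auto)
qed

text \<open>Otherwise integration over the set where \<open>h x < g x\<close> would strictly reverse
  the assumed inequality; finiteness of the integral of \<open>h\<close> makes the reversal
  strict.\<close>

lemma AE_le_of_set_nn_integral_le:
  fixes g h :: "'a \<Rightarrow> ennreal"
  assumes [measurable]: "g \<in> borel_measurable M" "h \<in> borel_measurable M"
    and le: "\<And>A. A \<in> sets M \<Longrightarrow> (\<integral>\<^sup>+x\<in>A. g x \<partial>M) \<le> (\<integral>\<^sup>+x\<in>A. h x \<partial>M)"
    and fin: "(\<integral>\<^sup>+x. h x \<partial>M) \<noteq> \<infinity>"
  shows "AE x in M. g x \<le> h x"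
proof -
  define A where "A = {x \<in> space M. h x < g x}"
  have [measurable]: "A \<in> sets M" unfolding A_def by measurable
  have "AE x in M. g x * indicator A x \<le> h x * indicator A x"
  proof (rule ccontr)
    assume not: "\<not> (AE x in M. g x * indicator A x \<le> h x * indicator A x)"
    have "(\<integral>\<^sup>+x. h x * indicator A x \<partial>M) \<le> (\<integral>\<^sup>+x. h x \<partial>M)"
      by (intro nn_integral_mono) (auto simp: indicator_def)
    then have f: "(\<integral>\<^sup>+x. h x * indicator A x \<partial>M) \<noteq> \<infinity>" using fin by (auto simp: top_unique)
    have "(\<integral>\<^sup>+x. h x * indicator A x \<partial>M) < (\<integral>\<^sup>+x. g x * indicator A x \<partial>M)"
      by (rule nn_integral_less[OF _ _ f _ not]) (auto simp: A_def indicator_def)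
    then show False using le[of A] by simp
  qed
  with AE_space show ?thesis
  proof eventually_elim
    case (elim x)
    then show ?case by (cases "x \<in> A") (auto simp: A_def not_less)
  qed
qed

text \<open>A regular conditional distribution of \<open>t\<close> given \<open>X t\<close>, built
  from conditional distribution functions. The values of \<open>X\<close> need no more structure
  than Borel sets, since only densities with respect to the law of \<open>X\<close> are taken
  there.\<close>

lemma disintegration_unit_interval:
  fixes \<nu> :: "real measure" and X :: "real \<Rightarrow> 'a::topological_space"
  assumes \<nu>: "real_distribution \<nu>" and X: "X \<in> borel_measurable borel"
    and supp: "AE t in \<nu>. t \<in> {0..1}"
  obtains \<kappa> where "\<kappa> \<in> borel \<rightarrow>\<^sub>M prob_algebra borel"
    "\<And>A. A \<in> sets borel \<Longrightarrow>
      density \<nu> (indicator (X -` A)) = density (distr \<nu> borel X) (indicator A) \<bind> \<kappa>"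
proof -
  interpret \<nu>: real_distribution \<nu> by fact
  note [measurable] = X
  define \<mu> where "\<mu> = distr \<nu> borel X"
  interpret \<mu>: prob_space \<mu> unfolding \<mu>_def by (rule \<nu>.prob_space_distr) simp
  have sets_\<mu> [measurable_cong, simp]: "sets \<mu> = sets borel" and space_\<mu> [simp]: "space \<mu> = UNIV"
    unfolding \<mu>_def by simp_all
  have Xs [measurable]: "X -` A \<in> sets borel" if "A \<in> sets borel" for A
    using measurable_sets[OF X that] by simp
  define P where "P A q = emeasure \<nu> (X -` A \<inter> {..q})" for A :: "'a set" and q
  \<comment> \<open>\<open>F q\<close> is the conditional probability of \<open>t \<le> q\<close>: a
    Radon-Nikodym density, with respect to the law of \<open>X\<close>, of the part of that law
    coming from \<open>t \<le> q\<close>.\<close>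
  have "\<exists>F \<in> borel_measurable borel. \<forall>A\<in>sets borel. (\<integral>\<^sup>+x\<in>A. F x \<partial>\<mu>) = P A q" for q
  proof -
    define N where "N = distr (density \<nu> (indicator {..q})) borel X"
    have N: "emeasure N A = P A q" if A: "A \<in> sets borel" for A
    proof -
      have "emeasure N A = emeasure (density \<nu> (indicator {..q})) (X -` A)"
        unfolding N_def using A by (subst emeasure_distr) auto
      also have "\<dots> = (\<integral>\<^sup>+t. indicator {..q} t * indicator (X -` A) t \<partial>\<nu>)"
        using Xs[OF A] by (intro emeasure_density) auto
      also have "\<dots> = (\<integral>\<^sup>+t. indicator (X -` A \<inter> {..q}) t \<partial>\<nu>)"
        by (intro nn_integral_cong) (auto simp: indicator_inter_arith mult.commute)
      also have "\<dots> = P A q" unfolding P_def using Xs[OF A] by (subst nn_integral_indicator) auto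
      finally show ?thesis .
    qed
    have "absolutely_continuous \<mu> N"
      unfolding absolutely_continuous_def
    proof
      fix A assume "A \<in> null_sets \<mu>"
      then have A: "A \<in> sets borel" "emeasure \<mu> A = 0" by auto
      then have "emeasure \<nu> (X -` A) = 0" unfolding \<mu>_def by (simp add: emeasure_distr)
      moreover have "P A q \<le> emeasure \<nu> (X -` A)"
        unfolding P_def using Xs[OF A(1)] by (intro emeasure_mono) auto
      ultimately have "emeasure N A = 0" using N[OF A(1)] by simp
      then show "A \<in> null_sets N" using A unfolding N_def by (intro null_setsI) auto
    qed
    then obtain F where F: "F \<in> borel_measurable \<mu>" "density \<mu> F = N"
      using \<mu>.Radon_Nikodym[of N] unfolding N_def by auto
    have "(\<integral>\<^sup>+x\<in>A. F x \<partial>\<mu>) = P A q" if "A \<in> sets borel" for A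
      using N[OF that] emeasure_density[OF F(1), of A] that unfolding F(2) by simp
    then show ?thesis using F(1) by (auto simp: measurable_cong_sets[OF sets_\<mu> refl])
  qed
  then obtain F where F [measurable]: "\<And>q. F q \<in> borel_measurable borel"
    and FP: "\<And>A q. A \<in> sets borel \<Longrightarrow> (\<integral>\<^sup>+x\<in>A. F q x \<partial>\<mu>) = P A q"
    by metis
  have P_mono: "P A q \<le> P A q'" if "A \<in> sets borel" "q \<le> q'" for A q q'
    unfolding P_def using that Xs[OF that(1)] by (intro emeasure_mono) auto
  have P_le: "P A q \<le> emeasure \<mu> A" if "A \<in> sets borel" for A q
    unfolding P_def \<mu>_def using that Xs[OF that] by (simp add: emeasure_distr) (intro emeasure_mono, auto)
  \<comment> \<open>Support in \<open>[0, 1]\<close> makes the conditional distribution functions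
    exactly 0 below 0 and exactly 1 from 1 on, so their limits at infinity need no separate
    argument.\<close>
  have P0: "P A q = 0" if "A \<in> sets borel" "q < 0" for A q
  proof -
    have "AE t in \<nu>. t \<notin> X -` A \<inter> {..q}" using supp by eventually_elim (use that in auto)
    then have "X -` A \<inter> {..q} \<in> null_sets \<nu>"
      using Xs[OF that(1)] by (subst AE_iff_null_sets) auto
    then show ?thesis unfolding P_def by auto
  qed
  have P1: "P A q = emeasure \<mu> A" if A: "A \<in> sets borel" "q \<ge> 1" for A q
  proof -
    have "AE t in \<nu>. t \<in> X -` A \<inter> {..q} \<longleftrightarrow> t \<in> X -` A" using supp by eventually_elim (use that in auto)
    then have "P A q = emeasure \<nu> (X -` A)"
      unfolding P_def using A Xs[OF A(1)] by (intro emeasure_eq_AE) auto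
    then show ?thesis unfolding \<mu>_def using A by (simp add: emeasure_distr)
  qed
  have Ffin: "(\<integral>\<^sup>+x. F q x \<partial>\<mu>) \<noteq> \<infinity>" for q
    using FP[of UNIV q] P_le[of UNIV q] \<mu>.emeasure_space_1 by (auto simp: top_unique)
  have F_le: "AE x in \<mu>. F q x \<le> F q' x" if "q \<le> q'" for q q'
    by (rule AE_le_of_set_nn_integral_le) (use FP P_mono that Ffin in auto)
  have F_0: "AE x in \<mu>. F q x \<le> 0" if "q < 0" for q
    by (rule AE_le_of_set_nn_integral_le) (use FP P0 that in auto)
  have F_1: "AE x in \<mu>. 1 \<le> F q x" if "q \<ge> 1" for q
    by (rule AE_le_of_set_nn_integral_le) (use FP P1 that Ffin in auto)
  have F_1': "AE x in \<mu>. F q x \<le> 1" for q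
    by (rule AE_le_of_set_nn_integral_le) (use FP P_le \<mu>.emeasure_space_1 in auto)
  have "AE x in \<mu>. \<forall>q\<in>\<rat>. (q < 0 \<longrightarrow> F q x \<le> 0) \<and>
      (q \<ge> 1 \<longrightarrow> 1 \<le> F q x) \<and> F q x \<le> 1"
    using F_0 F_1 F_1' by (intro AE_ball_countable[THEN iffD2] ballI countable_rat AE_conjI AE_impI) auto
  then obtain E where E: "E \<in> null_sets \<mu>"
    and good: "\<And>x q. x \<notin> E \<Longrightarrow> q \<in> \<rat> \<Longrightarrow> q < 0 \<Longrightarrow> F q x \<le> 0"
      "\<And>x q. x \<notin> E \<Longrightarrow> q \<in> \<rat> \<Longrightarrow> q \<ge> 1 \<Longrightarrow> 1 \<le> F q x"
      "\<And>x q. x \<notin> E \<Longrightarrow> q \<in> \<rat> \<Longrightarrow> F q x \<le> 1"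
    by (elim AE_E3) (auto simp: subset_eq)
  have [measurable]: "E \<in> sets borel" using E by auto
  \<comment> \<open>On the exceptional null set the distribution function of the unit mass at 0 is
    substituted, so that \<open>\<kappa> x\<close> will be a probability measure for every
    \<open>x\<close>.\<close>
  define H where "H q x = (if x \<in> E then (if q \<ge> 0 then 1 else 0) else enn2real (F q x))" for q x
  have H_meas [measurable]: "H q \<in> borel_measurable borel" for q
    unfolding H_def[abs_def] by measurable
  have H01: "0 \<le> H q x" "H q x \<le> 1" if "q \<in> \<rat>" for q x
    using good(3)[OF _ that, of x] enn2real_mono[of "F q x" 1] unfolding H_def by auto
  have H0: "H q x = 0" if "q \<in> \<rat>" "q < 0" for q x
    using good(1)[OF _ that, of x] that unfolding H_def by auto
  have H1: "H q x = 1" if "q \<in> \<rat>" "q \<ge> 1" for q x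
  proof (cases "x \<in> E")
    case False
    have "F q x = 1" by (intro antisym good(3)[OF False that(1)] good(2)[OF False that])
    then show ?thesis unfolding H_def using False by simp
  qed (use that in \<open>auto simp: H_def\<close>)
  \<comment> \<open>Taking the infimum over the rationals strictly beyond \<open>t\<close> makes
    \<open>G x\<close> increasing and right continuous for every \<open>x\<close>, even where the
    values \<open>H q x\<close> at different rationals are out of order.\<close>
  define R where "R t = {q \<in> \<rat>. t < q}" for t :: real
  have R_ne: "R t \<noteq> {}" for t using Rats_dense_in_real[of t "t + 1"] unfolding R_def by auto
  have R_rat: "q \<in> \<rat>" if "q \<in> R t" for q t using that unfolding R_def by simp
  define G where "G x t = (INF q\<in>R t. H q x)" for x t
  have bdd: "bdd_below ((\<lambda>q. H q x) ` R t)" for x t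
    using H01(1) R_rat by (intro bdd_belowI2[where m = 0]) auto
  have G_le: "G x t \<le> H q x" if "q \<in> R t" for x t q
    unfolding G_def using bdd that by (rule cINF_lower)
  have G_ge: "m \<le> G x t" if "\<And>q. q \<in> R t \<Longrightarrow> m \<le> H q x" for x t m
    unfolding G_def using R_ne that by (rule cINF_greatest)
  have G_mono: "G x s \<le> G x t" if "s \<le> t" for x s t
    by (rule G_ge, rule G_le) (use that in \<open>auto simp: R_def\<close>)
  have G0: "G x t = 0" if t: "t < 0" for x t
  proof -
    obtain q where q: "q \<in> \<rat>" "t < q" "q < 0" using Rats_dense_in_real[OF t] by blast
    then have "G x t \<le> 0" using G_le[of q t x] H0[of q x] by (simp add: R_def)
    moreover have "0 \<le> G x t" using H01(1) R_rat by (intro G_ge) auto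
    ultimately show ?thesis by simp
  qed
  have G1: "G x t = 1" if t: "t \<ge> 1" for x t
  proof -
    have "H q x = 1" if "q \<in> R t" for q using that t by (intro H1) (auto simp: R_def)
    then show ?thesis unfolding G_def using R_ne by simp
  qed
  have G_rc: "continuous (at_right a) (G x)" for x a
  proof (subst continuous_at_right_real_increasing; (intro allI impI G_mono)?)
    fix \<epsilon> :: real assume "\<epsilon> > 0"
    then have "(INF q\<in>R a. H q x) < G x a + \<epsilon>" unfolding G_def by simp
    then obtain q where q: "q \<in> R a" "H q x < G x a + \<epsilon>"
      using cINF_less_iff[OF R_ne bdd] by blast
    have "a < q" using q(1) unfolding R_def by simp
    have "G x (a + (q - a) / 2) \<le> H q x"
      using q(1) \<open>a < q\<close> by (intro G_le) (auto simp: R_def field_simps)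
    then show "\<exists>\<delta>>0. G x (a + \<delta>) - G x a < \<epsilon>"
      using q(2) \<open>a < q\<close> by (intro exI[of _ "(q - a) / 2"]) auto
  qed
  have G_bot: "(G x \<longlongrightarrow> 0) at_bot" for x
    by (rule tendsto_eventually) (use G0 eventually_at_bot_dense in blast)
  have G_top: "(G x \<longlongrightarrow> 1) at_top" for x
    by (rule tendsto_eventually) (use G1 eventually_at_top_linorder in blast)
  define \<kappa> where "\<kappa> x = interval_measure (G x)" for x
  have \<kappa>_dist: "real_distribution (\<kappa> x)" for x
    unfolding \<kappa>_def by (intro real_distribution_interval_measure G_mono G_rc G_bot G_top)
  have \<kappa>_Iic: "emeasure (\<kappa> x) {..t} = ennreal (G x t)" for x t
    unfolding \<kappa>_def by (intro emeasure_interval_measure_Iic G_mono G_rc G_bot)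
  have G_meas [measurable]: "(\<lambda>x. G x t) \<in> borel_measurable borel" for t
    unfolding G_def
  proof (rule borel_measurable_cINF)
    show "countable (R t)" unfolding R_def using countable_rat by (rule countable_subset[rotated]) auto
  qed (use bdd H_meas in auto)
  have sets_atMost: "sets borel = sigma_sets UNIV (range (\<lambda>a::real. {..a}))"
    unfolding borel_eq_atMost by simp
  have \<kappa>_meas: "\<kappa> \<in> borel \<rightarrow>\<^sub>M prob_algebra borel"
  proof (rule measurable_prob_algebra_generated[where G = "range (\<lambda>a::real. {..a})" and \<Omega> = UNIV])
    show "sets borel = sigma_sets UNIV (range (\<lambda>a::real. {..a}))" by (rule sets_atMost)
    show "Int_stable (range (\<lambda>a::real. {..a}))" by (auto intro!: Int_stableI simp: image_iff)
    show "prob_space (\<kappa> x)" "sets (\<kappa> x) = sets borel" for x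
      using \<kappa>_dist[of x] by (auto simp: real_distribution_def real_distribution_axioms_def)
    show "(\<lambda>x. emeasure (\<kappa> x) A) \<in> borel_measurable borel" if "A \<in> range (\<lambda>a::real. {..a})" for A
      using that by (auto simp: \<kappa>_Iic)
  qed auto
  have EH: "AE x in \<mu>. ennreal (H q x) = F q x" if "q \<in> \<rat>" for q
    using AE_not_in[OF E]
  proof eventually_elim
    case (elim x)
    then have "F q x \<noteq> \<top>" using good(3)[OF elim that] by (auto simp: top_unique)
    then show ?case unfolding H_def using elim by (simp add: less_top)
  qed
  \<comment> \<open>Upper bound: rationals above \<open>t\<close> are let decrease to
    \<open>t\<close>, by continuity of \<open>\<nu>\<close> from above. Lower bound: almost
    everywhere \<open>F t\<close> lies below all of the countably many \<open>H q\<close> with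
    \<open>q > t\<close>.\<close>
  have Iic: "(\<integral>\<^sup>+x\<in>A. ennreal (G x t) \<partial>\<mu>) = P A t" if A: "A \<in> sets borel" for A t
  proof (rule antisym)
    have up: "(\<integral>\<^sup>+x\<in>A. ennreal (G x t) \<partial>\<mu>) \<le> P A s" if "t < s" for s
    proof -
      obtain q where q: "q \<in> \<rat>" "t < q" "q < s" using Rats_dense_in_real[OF \<open>t < s\<close>] by blast
      have "(\<integral>\<^sup>+x\<in>A. ennreal (G x t) \<partial>\<mu>) \<le> (\<integral>\<^sup>+x\<in>A. F q x \<partial>\<mu>)"
      proof (rule nn_integral_mono_AE)
        show "AE x in \<mu>. ennreal (G x t) * indicator A x \<le> F q x * indicator A x"
          using EH[OF q(1)]
        proof eventually_elim
          case (elim x)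
          have "ennreal (G x t) \<le> ennreal (H q x)" using q by (intro ennreal_leI G_le) (auto simp: R_def)
          then show ?case unfolding elim by (intro mult_right_mono) auto
        qed
      qed
      also have "\<dots> \<le> P A s" unfolding FP[OF A] using q A by (intro P_mono) auto
      finally show ?thesis .
    qed
    have "(\<lambda>n. emeasure \<nu> (X -` A \<inter> {..t + 1 / real (Suc n)})) \<longlonglongrightarrow> emeasure \<nu> (\<Inter>n. X -` A \<inter> {..t + 1 / real (Suc n)})"
    proof (rule Lim_emeasure_decseq)
      show "range (\<lambda>n. X -` A \<inter> {..t + 1 / real (Suc n)}) \<subseteq> sets \<nu>" using Xs[OF A] by auto
      show "decseq (\<lambda>n. X -` A \<inter> {..t + 1 / real (Suc n)})"
      proof (rule decseq_SucI)
        fix n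
        have "1 / real (Suc (Suc n)) \<le> 1 / real (Suc n)" by (intro divide_left_mono) auto
        then show "X -` A \<inter> {..t + 1 / real (Suc (Suc n))} \<subseteq> X -` A \<inter> {..t + 1 / real (Suc n)}" by auto
      qed
    qed simp
    also have "(\<Inter>n. X -` A \<inter> {..t + 1 / real (Suc n)}) = X -` A \<inter> {..t}"
    proof (rule set_eqI)
      fix s
      have "s \<le> t" if "\<And>n. s \<le> t + 1 / real (Suc n)"
      proof (rule field_le_epsilon)
        fix e :: real assume "e > 0"
        then obtain n where "inverse (real (Suc n)) < e" using reals_Archimedean by blast
        then show "s \<le> t + e" using that[of n] by (simp add: inverse_eq_divide)
      qed
      moreover have "s \<le> t + 1 / real (Suc n)" if "s \<le> t" for n
        using that by (metis add_increasing2 divide_nonneg_nonneg of_nat_0_le_iff zero_le_one)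
      ultimately show "s \<in> (\<Inter>n. X -` A \<inter> {..t + 1 / real (Suc n)}) \<longleftrightarrow> s \<in> X -` A \<inter> {..t}" by auto
    qed
    finally have "(\<lambda>n. P A (t + 1 / real (Suc n))) \<longlonglongrightarrow> P A t" unfolding P_def .
    then show "(\<integral>\<^sup>+x\<in>A. ennreal (G x t) \<partial>\<mu>) \<le> P A t"
      by (rule LIMSEQ_le_const) (auto intro!: up)
  next
    have "AE x in \<mu>. \<forall>q\<in>R t. F t x \<le> ennreal (H q x)"
    proof (intro AE_ball_countable[THEN iffD2] ballI)
      show "countable (R t)" unfolding R_def using countable_rat by (rule countable_subset[rotated]) auto
      fix q assume "q \<in> R t"
      then have q: "q \<in> \<rat>" "t \<le> q" unfolding R_def by auto
      show "AE x in \<mu>. F t x \<le> ennreal (H q x)" using F_le[OF q(2)] EH[OF q(1)] by eventually_elim simp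
    qed
    then have "AE x in \<mu>. F t x * indicator A x \<le> ennreal (G x t) * indicator A x"
    proof eventually_elim
      case (elim x)
      obtain q0 where q0: "q0 \<in> R t" using R_ne by blast
      have fin: "F t x < \<top>" using elim q0 by (metis ennreal_less_top le_less_trans)
      have "enn2real (F t x) \<le> G x t"
        using elim H01(1) R_rat by (intro G_ge) (auto intro!: enn2real_leI)
      then have "F t x \<le> ennreal (G x t)" using fin by (metis ennreal_enn2real ennreal_leI)
      then show ?case by (intro mult_right_mono) auto
    qed
    then show "P A t \<le> (\<integral>\<^sup>+x\<in>A. ennreal (G x t) \<partial>\<mu>)"
      unfolding FP[OF A, symmetric] by (rule nn_integral_mono_AE)
  qed
  have main: "density \<nu> (indicator (X -` A)) = density \<mu> (indicator A) \<bind> \<kappa>"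
    if A: "A \<in> sets borel" for A
  proof -
    define N1 where "N1 = density \<nu> (indicator (X -` A))"
    define N2 where "N2 = density \<mu> (indicator A) \<bind> \<kappa>"
    have \<kappa>_meas': "\<kappa> \<in> density \<mu> (indicator A) \<rightarrow>\<^sub>M subprob_algebra borel"
      using measurable_prob_algebraD[OF \<kappa>_meas] by (simp cong: measurable_cong_sets)
    have N1: "emeasure N1 B = emeasure \<nu> (X -` A \<inter> B)" if "B \<in> sets borel" for B
      unfolding N1_def using that A Xs[OF A]
      by (subst emeasure_density)
         (auto intro!: nn_integral_cong simp: indicator_inter_arith[symmetric] simp flip: nn_integral_indicator)
    have N2: "emeasure N2 B = (\<integral>\<^sup>+x\<in>A. emeasure (\<kappa> x) B \<partial>\<mu>)" if B: "B \<in> sets borel" for B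
    proof -
      have m: "(\<lambda>x. emeasure (\<kappa> x) B) \<in> borel_measurable \<mu>"
        using measurable_emeasure_kernel[OF measurable_prob_algebraD[OF \<kappa>_meas] B]
        by (simp cong: measurable_cong_sets)
      have "emeasure N2 B = (\<integral>\<^sup>+x. emeasure (\<kappa> x) B \<partial>density \<mu> (indicator A))"
        unfolding N2_def by (rule emeasure_bind[OF _ \<kappa>_meas' B]) simp
      also have "\<dots> = (\<integral>\<^sup>+x\<in>A. emeasure (\<kappa> x) B \<partial>\<mu>)"
        using A m by (subst nn_integral_density) (auto simp: mult.commute)
      finally show ?thesis .
    qed
    have "N1 = N2"
    proof (rule measure_eqI_generator_eq[where E = "range (\<lambda>a::real. {..a})" and \<Omega> = UNIV and A = "\<lambda>n. {..real n}"])
      show "Int_stable (range (\<lambda>a::real. {..a}))" by (auto intro!: Int_stableI simp: image_iff)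
      show "emeasure N1 X' = emeasure N2 X'" if X': "X' \<in> range (\<lambda>a::real. {..a})" for X'
        using X' N1 N2 Iic[OF A] by (auto simp: \<kappa>_Iic P_def)
      show "sets N1 = sigma_sets UNIV (range (\<lambda>a::real. {..a}))"
        unfolding N1_def using sets_atMost by simp
      have "sets N2 = sets borel" unfolding N2_def by (intro sets_bind sets_kernel[OF \<kappa>_meas']) auto
      then show "sets N2 = sigma_sets UNIV (range (\<lambda>a::real. {..a}))"
        using sets_atMost by simp
      show "(\<Union>n. {..real n}) = UNIV" using real_arch_simple by auto
      show "emeasure N1 {..real n} \<noteq> \<infinity>" for n by (subst N1) auto
    qed auto
    then show ?thesis unfolding N1_def N2_def .
  qed
  show thesis using \<kappa>_meas main unfolding \<mu>_def by (rule that)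
qed

text \<open>Adding the bound \<open>B\<close> makes the signed weight \<open>Z\<close> nonnegative.
  The images under \<open>X\<close> of the measures with densities \<open>Z + B\<close> and
  \<open>B\<close> then agree on continuous functions, hence on Borel sets.\<close>

lemma integral_indicator_comp_eq_0:
  fixes X :: "'t \<Rightarrow> 'a::metric_space" and Z :: "'t \<Rightarrow> real"
  assumes "finite_measure \<nu>" and [measurable]: "X \<in> borel_measurable \<nu>" "Z \<in> borel_measurable \<nu>"
    and bound: "\<And>t. \<bar>Z t\<bar> \<le> B"
    and eq0: "\<And>h :: 'a \<Rightarrow> real. continuous_on UNIV h \<Longrightarrow> bounded (range h) \<Longrightarrow> (LINT t|\<nu>. h (X t) * Z t) = 0"
    and [measurable]: "A \<in> sets borel"
  shows "(LINT t|\<nu>. indicator A (X t) * Z t) = 0"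
proof -
  interpret finite_measure \<nu> by fact
  define M where "M g = distr (density \<nu> (\<lambda>t. ennreal (g t))) borel X" for g :: "'t \<Rightarrow> real"
  have fin: "finite_measure (M g)" if [measurable]: "g \<in> borel_measurable \<nu>" and g: "\<And>t. g t \<le> C" for g C
  proof (rule finite_measureI)
    have "emeasure (M g) (space (M g)) = (\<integral>\<^sup>+t. ennreal (g t) \<partial>\<nu>)"
      unfolding M_def by (simp add: emeasure_distr emeasure_density cong: nn_integral_cong)
    also have "\<dots> \<le> (\<integral>\<^sup>+t. ennreal C \<partial>\<nu>)" using g by (intro nn_integral_mono ennreal_leI)
    also have "\<dots> < \<infinity>" by (simp add: ennreal_mult_eq_top_iff less_top[symmetric])
    finally show "emeasure (M g) (space (M g)) \<noteq> \<infinity>" by simp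
  qed
  have int: "(LINT x|M g. h x) = (LINT t|\<nu>. g t * h (X t))"
    if [measurable]: "g \<in> borel_measurable \<nu>" "h \<in> borel_measurable borel" and g: "\<And>t. 0 \<le> g t"
    for g and h :: "'a \<Rightarrow> real"
    unfolding M_def using g by (subst integral_distr) (auto simp: integral_density)
  have integ: "integrable \<nu> (\<lambda>t. g t * k (X t))"
    if [measurable]: "g \<in> borel_measurable \<nu>" "k \<in> borel_measurable borel"
      and g: "\<And>t. \<bar>g t\<bar> \<le> C" and k: "\<And>x. \<bar>k x\<bar> \<le> D" for g C D and k :: "'a \<Rightarrow> real"
  proof (rule integrable_const_bound[where B = "C * D"])
    show "AE t in \<nu>. norm (g t * k (X t)) \<le> C * D"
      using g k by (intro AE_I2) (auto simp: abs_mult intro!: mult_mono intro: order_trans[OF abs_ge_zero])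
  qed measurable
  have B0: "0 \<le> Z t + B" "Z t + B \<le> 2 * B" "0 \<le> B" for t using bound[of t] by (auto simp: abs_le_iff)
  have "M (\<lambda>t. Z t + B) = M (\<lambda>_. B)"
  proof (rule finite_measure_eqI_continuous)
    show "finite_measure (M (\<lambda>t. Z t + B))" using B0 by (intro fin[of _ "2 * B"]) auto
    show "finite_measure (M (\<lambda>_. B))" by (intro fin[of _ B]) auto
    show "sets (M (\<lambda>t. Z t + B)) = sets borel" "sets (M (\<lambda>_. B)) = sets borel" unfolding M_def by auto
    fix h :: "'a \<Rightarrow> real" assume h: "continuous_on UNIV h" "bounded (range h)"
    have [measurable]: "h \<in> borel_measurable borel" using h(1) by (rule borel_measurable_continuous_onI)
    obtain D where D: "\<And>x. \<bar>h x\<bar> \<le> D" using h(2) unfolding bounded_iff by auto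
    have "(LINT x|M (\<lambda>t. Z t + B). h x) = (LINT t|\<nu>. Z t * h (X t) + B * h (X t))"
      using B0 by (subst int) (auto simp: distrib_right)
    also have "\<dots> = (LINT t|\<nu>. Z t * h (X t)) + (LINT t|\<nu>. B * h (X t))"
      using bound D by (intro Bochner_Integration.integral_add integ) auto
    also have "\<dots> = (LINT x|M (\<lambda>_. B). h x)"
      using eq0[OF h] B0 by (subst int) (auto simp: mult.commute)
    finally show "(LINT x|M (\<lambda>t. Z t + B). h x) = (LINT x|M (\<lambda>_. B). h x)" .
  qed
  then have "(LINT x|M (\<lambda>t. Z t + B). indicator A x) = (LINT x|M (\<lambda>_. B). (indicator A x :: real))" by simp
  then have "(LINT t|\<nu>. (Z t + B) * indicator A (X t)) = (LINT t|\<nu>. B * indicator A (X t))"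
    using B0 by (subst (asm) (1 2) int) auto
  also have "(LINT t|\<nu>. (Z t + B) * indicator A (X t)) =
      (LINT t|\<nu>. Z t * indicator A (X t)) + (LINT t|\<nu>. B * indicator A (X t))"
    unfolding distrib_right using bound B0(3)
    by (intro Bochner_Integration.integral_add integ[where D = 1]) (auto simp: indicator_def)
  finally show ?thesis by (simp add: mult.commute)
qed

section \<open>Dilations from martingale couplings\<close>

lemma set_integral_prob_measures_on:
  fixes f g :: "complex \<Rightarrow> real"
  assumes M: "M \<in> prob_measures_on K" and K: "closed K" and g: "g \<in> borel_measurable borel"
    and fg: "\<And>x. x \<in> K \<Longrightarrow> f x = g x"
  shows "(LINT y:K|M. f y) = (LINT y|M. g y)"
proof -
  interpret M: prob_space M using M unfolding prob_measures_on_def by simp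
  have sM [measurable_cong]: "sets M = sets borel" and 1: "M.prob K = 1" using M unfolding prob_measures_on_def by auto
  note [measurable] = g
  have [measurable]: "K \<in> sets borel" using K by simp
  have "(LINT y:K|M. f y) = (LINT y:K|M. g y)"
    unfolding set_lebesgue_integral_def using fg by (intro Bochner_Integration.integral_cong) (auto simp: indicator_def)
  also have "AE y in M. y \<in> K" using 1 by (subst (asm) M.prob_eq_1) (auto simp: sM)
  then have "(LINT y:K|M. g y) = (LINT y|M. g y)" unfolding set_lebesgue_integral_def
    by (intro integral_cong_AE) (measurable, auto elim!: eventually_mono)
  finally show ?thesis .
qed

text \<open>\<open>T x\<close> is the conditional law of \<open>Y t\<close> given
  \<open>X t = x\<close>, the image under \<open>Y\<close> of the disintegration kernel. The
  martingale identities give it barycentre \<open>x\<close> for almost every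
  \<open>x\<close>.\<close>

lemma dilation_of_martingale:
  fixes \<nu> :: "real measure" and X Y :: "real \<Rightarrow> complex"
  assumes \<nu>: "real_distribution \<nu>" and supp: "AE t in \<nu>. t \<in> {0..1}"
    and cont: "continuous_on UNIV X" "continuous_on UNIV Y" and bdd: "bounded (range X)" "bounded (range Y)"
    and K: "compact K" and XK: "AE t in \<nu>. X t \<in> K" and YK: "AE t in \<nu>. Y t \<in> K"
    and mart: "\<And>h :: complex \<Rightarrow> real. continuous_on UNIV h \<Longrightarrow> bounded (range h) \<Longrightarrow>
      (LINT t|\<nu>. h (X t) * Re (Y t - X t)) = 0 \<and> (LINT t|\<nu>. h (X t) * Im (Y t - X t)) = 0"
  shows "\<exists>T. dilation_on K T \<and> distr \<nu> borel Y = dilate K T (distr \<nu> borel X)"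
proof -
  interpret \<nu>: real_distribution \<nu> by fact
  have [measurable]: "X \<in> borel_measurable borel" "Y \<in> borel_measurable borel"
    using cont by (auto intro: borel_measurable_continuous_onI)
  have K_meas [measurable]: "K \<in> sets borel" using K by (intro borel_closed compact_imp_closed)
  obtain \<kappa> where \<kappa>: "\<kappa> \<in> borel \<rightarrow>\<^sub>M prob_algebra borel"
    and bind: "\<And>A. A \<in> sets borel \<Longrightarrow>
      density \<nu> (indicator (X -` A)) = density (distr \<nu> borel X) (indicator A) \<bind> \<kappa>"
    by (rule disintegration_unit_interval[OF \<nu> _ supp, of X]) auto
  define \<mu> where "\<mu> = distr \<nu> borel X"
  interpret \<mu>: prob_space \<mu> unfolding \<mu>_def by (rule \<nu>.prob_space_distr) simp
  have sets_\<mu> [measurable_cong, simp]: "sets \<mu> = sets borel" and space_\<mu> [simp]: "space \<mu> = UNIV"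
    unfolding \<mu>_def by simp_all
  have \<kappa>_prob: "prob_space (\<kappa> x)" and \<kappa>_sets [simp]: "sets (\<kappa> x) = sets borel" for x
    using measurable_space[OF \<kappa>, of x] by (auto simp: space_prob_algebra)
  have \<kappa>_space [simp]: "space (\<kappa> x) = UNIV" for x
    using sets_eq_imp_space_eq[OF \<kappa>_sets] by simp
  have \<kappa>_sub [measurable]: "\<kappa> \<in> borel \<rightarrow>\<^sub>M subprob_algebra borel"
    using \<kappa> by (rule measurable_prob_algebraD)
  have \<kappa>_mborel: "f \<in> borel_measurable (\<kappa> x) \<longleftrightarrow> f \<in> borel_measurable borel" for f :: "real \<Rightarrow> 'b::topological_space" and x
    by (simp cong: measurable_cong_sets)
  have \<kappa>_int: "integrable (\<kappa> x) f"
    if "f \<in> borel_measurable borel" "\<And>t. norm (f t) \<le> B" for f :: "real \<Rightarrow> 'b::{banach, second_countable_topology}" and B x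
    by (rule finite_measure.integrable_const_bound[OF prob_space.finite_measure[OF \<kappa>_prob], where B = B])
       (use that in \<open>auto simp: \<kappa>_mborel\<close>)
  have \<kappa>_le: "\<bar>LINT t|\<kappa> x. f t\<bar> \<le> B" if f: "f \<in> borel_measurable borel" "\<And>t. \<bar>f t\<bar> \<le> B" for f :: "real \<Rightarrow> real" and B x
  proof -
    interpret k: prob_space "\<kappa> x" by (rule \<kappa>_prob)
    have "\<bar>LINT t|\<kappa> x. f t\<bar> \<le> (LINT t|\<kappa> x. \<bar>f t\<bar>)" by (rule integral_abs_bound)
    also have "\<dots> \<le> (LINT t|\<kappa> x. B)"
      using f by (intro integral_mono \<kappa>_int[of _ B]) (auto intro: order_trans[OF abs_ge_zero])
    finally show ?thesis by (simp add: k.prob_space[unfolded \<kappa>_space])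
  qed
  have kern: "(LINT t|\<nu>. indicator A (X t) * f t) = (LINT x|\<mu>. indicator A x * (LINT t|\<kappa> x. f t))"
    if A [measurable]: "A \<in> sets borel" and f [measurable]: "f \<in> borel_measurable borel" and B: "\<And>t. \<bar>f t\<bar> \<le> B"
    for A B and f :: "real \<Rightarrow> real"
  proof -
    have [measurable]: "X -` A \<in> sets borel" using measurable_sets[of X borel borel A] by simp
    have i: "(\<lambda>t. indicator S t) = (\<lambda>t. ennreal (indicator S t))" for S :: "'c set"
      by (auto simp: indicator_def)
    have "(LINT t|\<nu>. indicator A (X t) * f t) = (LINT t|\<nu>. indicator (X -` A) t *\<^sub>R f t)"
      by (intro Bochner_Integration.integral_cong) (auto simp: indicator_def)
    also have "\<dots> = (LINT t|density \<nu> (indicator (X -` A)). f t)"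
      unfolding i[of "X -` A"] by (intro integral_density[symmetric]) auto
    also have "\<dots> = (LINT t|(density \<mu> (indicator A) \<bind> \<kappa>). f t)" unfolding \<mu>_def bind[OF A] ..
    also have "\<dots> = (LINT x|density \<mu> (indicator A). LINT t|\<kappa> x. f t)"
    proof (rule integral_bind[where K = borel and B = B and B' = 1])
      show "\<kappa> \<in> density \<mu> (indicator A) \<rightarrow>\<^sub>M subprob_algebra borel" using \<kappa>_sub by (simp cong: measurable_cong_sets)
      show "finite_measure (density \<mu> (indicator A))"
        by (rule finite_measureI) (simp add: emeasure_density)
      show "AE x in density \<mu> (indicator A). emeasure (\<kappa> x) (space (\<kappa> x)) \<le> ennreal 1"
        using prob_space.emeasure_space_1[OF \<kappa>_prob] by simp
    qed (use B in auto)
    also have "\<dots> = (LINT x|\<mu>. indicator A x *\<^sub>R (LINT t|\<kappa> x. f t))"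
      unfolding i[of A] by (intro integral_density) auto
    finally show ?thesis by simp
  qed
  obtain BX where BX: "\<And>t. norm (X t) \<le> BX" using bdd(1) unfolding bounded_iff by auto
  obtain BY where BY: "\<And>t. norm (Y t) \<le> BY" using bdd(2) unfolding bounded_iff by auto
  \<comment> \<open>A conditional expectation is identified by its integrals over Borel sets of
    \<open>x\<close>, so the identities for continuous \<open>h\<close> are first extended to
    indicators. The argument is run for a real-linear \<open>g\<close>, to be used with
    \<open>Re\<close> and \<open>Im\<close>.\<close>
  have bary: "AE x in \<mu>. (LINT t|\<kappa> x. g (Y t)) = g x"
    if lin: "bounded_linear g" and gn: "\<And>z. \<bar>g z\<bar> \<le> norm z"
      and m0: "\<And>h :: complex \<Rightarrow> real. continuous_on UNIV h \<Longrightarrow> bounded (range h) \<Longrightarrow>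
         (LINT t|\<nu>. h (X t) * g (Y t - X t)) = 0"
    for g :: "complex \<Rightarrow> real"
  proof (rule density_unique_real)
    have [measurable]: "g \<in> borel_measurable borel"
      using lin by (intro borel_measurable_continuous_onI linear_continuous_on)
    have gY: "\<bar>g (Y t)\<bar> \<le> BY" and gX: "\<bar>g (X t)\<bar> \<le> BX" for t
      using gn BX BY by (meson order_trans)+
    show int1: "integrable \<mu> (\<lambda>x. LINT t|\<kappa> x. g (Y t))"
      by (rule \<mu>.integrable_const_bound[where B = BY]) (use \<kappa>_le gY in auto)
    have XB: "AE x in \<mu>. norm x \<le> BX" unfolding \<mu>_def using BX by (subst AE_distr_iff) auto
    show "integrable \<mu> g"
      by (rule \<mu>.integrable_const_bound[where B = BX])
         (use XB in \<open>auto elim!: eventually_mono intro: order_trans[OF gn]\<close>)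
    fix A assume "A \<in> sets \<mu>"
    then have A [measurable]: "A \<in> sets borel" by simp
    have D: "g (Y t - X t) = g (Y t) - g (X t)" for t using lin by (simp add: linear_diff bounded_linear.linear)
    have "(LINT t|\<nu>. indicator A (X t) * g (Y t - X t)) = 0"
    proof (rule integral_indicator_comp_eq_0[where B = "BX + BY"])
      show "\<bar>g (Y t - X t)\<bar> \<le> BX + BY" for t unfolding D using gX[of t] gY[of t] by linarith
    qed (use m0 \<nu>.finite_measure_axioms A in auto)
    moreover have "integrable \<nu> (\<lambda>t. indicator A (X t) * g (Y t))"
      by (rule \<nu>.integrable_const_bound[where B = BY])
         (use gY order_trans[OF abs_ge_zero gY] in \<open>auto simp: indicator_def\<close>)
    moreover have "integrable \<nu> (\<lambda>t. indicator A (X t) * g (X t))"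
      by (rule \<nu>.integrable_const_bound[where B = BX])
         (use gX order_trans[OF abs_ge_zero gX] in \<open>auto simp: indicator_def\<close>)
    ultimately have "(LINT t|\<nu>. indicator A (X t) * g (Y t)) = (LINT t|\<nu>. indicator A (X t) * g (X t))"
      unfolding D by (simp add: right_diff_distrib)
    also have "\<dots> = (LINT x|\<mu>. indicator A x * g x)" unfolding \<mu>_def by (subst integral_distr) auto
    also have "(LINT t|\<nu>. indicator A (X t) * g (Y t)) = (LINT x|\<mu>. indicator A x * (LINT t|\<kappa> x. g (Y t)))"
      by (rule kern[OF A _ gY]) measurable
    finally show "(LINT x:A|\<mu>. (LINT t|\<kappa> x. g (Y t))) = (LINT x:A|\<mu>. g x)"
      unfolding set_lebesgue_integral_def by simp
  qed
  have whole: "\<nu> = \<mu> \<bind> \<kappa>"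
    using bind[of UNIV] unfolding \<mu>_def[symmetric] by (simp add: density_1)
  have "AE x in \<mu>. AE t in \<kappa> x. Y t \<in> K"
  proof -
    have "AE t in \<mu> \<bind> \<kappa>. Y t \<in> K" using YK by (simp only: whole[symmetric])
    moreover have "Measurable.pred borel (\<lambda>t. Y t \<in> K)" by measurable
    ultimately show ?thesis by (subst (asm) AE_bind[where B = borel]) (auto cong: measurable_cong_sets)
  qed
  moreover have "AE x in \<mu>. x \<in> K" unfolding \<mu>_def using XK by (subst AE_distr_iff) auto
  moreover have "AE x in \<mu>. (LINT t|\<kappa> x. Re (Y t)) = Re x"
    using mart abs_Re_le_cmod by (intro bary bounded_linear_Re) auto
  moreover have "AE x in \<mu>. (LINT t|\<kappa> x. Im (Y t)) = Im x"
    using mart abs_Im_le_cmod by (intro bary bounded_linear_Im) auto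
  ultimately have "AE x in \<mu>. (AE t in \<kappa> x. Y t \<in> K) \<and> x \<in> K \<and> (LINT t|\<kappa> x. Re (Y t)) = Re x \<and>
      (LINT t|\<kappa> x. Im (Y t)) = Im x"
    by eventually_elim auto
  then obtain E where E: "E \<in> null_sets \<mu>" and good: "\<And>x. x \<notin> E \<Longrightarrow> AE t in \<kappa> x. Y t \<in> K"
      "\<And>x. x \<notin> E \<Longrightarrow> x \<in> K" "\<And>x. x \<notin> E \<Longrightarrow> (LINT t|\<kappa> x. Re (Y t)) = Re x"
      "\<And>x. x \<notin> E \<Longrightarrow> (LINT t|\<kappa> x. Im (Y t)) = Im x"
    by (elim AE_E3) auto
  have [measurable]: "E \<in> sets borel" using E by auto
  \<comment> \<open>A dilation needs mass 1 on \<open>K\<close> and the right barycentre at every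
    point of \<open>K\<close>, not just almost everywhere; on the null set \<open>E\<close> the unit
    mass at \<open>x\<close> supplies both.\<close>
  define T where "T x = (if x \<in> E then return borel x else distr (\<kappa> x) borel Y)" for x
  have meas_Y: "Y \<in> borel_measurable (\<kappa> x)" for x by (simp add: \<kappa>_mborel)
  have T_prob: "T x \<in> prob_measures_on K" if "x \<in> K" for x
  proof (cases "x \<in> E")
    case True
    then show ?thesis
      using that unfolding T_def prob_measures_on_def by (auto simp: prob_space_return measure_return)
  next
    case False
    interpret k: prob_space "\<kappa> x" by (rule \<kappa>_prob)
    have "k.prob (Y -` K) = 1"
      using good(1)[OF False] measurable_sets[OF meas_Y K_meas, of x]
      by (subst k.prob_eq_1) auto
    then show ?thesis
      unfolding T_def prob_measures_on_def using False k.prob_space_distr[OF meas_Y]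
      by (simp add: measure_distr[OF meas_Y])
  qed
  have T_set: "(LINT y:K|T x. f y) = (if x \<in> E then indicator K x *\<^sub>R f x else (LINT t|\<kappa> x. indicator K (Y t) *\<^sub>R f (Y t)))"
    if [measurable]: "(\<lambda>y. indicator K y *\<^sub>R f y) \<in> borel_measurable borel"
    for f :: "complex \<Rightarrow> 'b::{banach, second_countable_topology}" and x
    unfolding set_lebesgue_integral_def T_def by (auto simp: integral_distr[OF meas_Y] integral_return)
  have T_bary: "(LINT y:K|T x. y) = x" if "x \<in> K" for x
  proof -
    have [measurable]: "(\<lambda>y. indicator K y *\<^sub>R (y::complex)) \<in> borel_measurable borel" by measurable
    show ?thesis
    proof (cases "x \<in> E")
      case True
      then show ?thesis using that by (subst T_set) auto
    next
      case False
      have "(LINT t|\<kappa> x. indicator K (Y t) *\<^sub>R Y t) = (LINT t|\<kappa> x. Y t)"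
        using good(1)[OF False]
        by (intro integral_cong_AE) (auto simp: \<kappa>_mborel elim!: eventually_mono)
      also have "\<dots> = x"
      proof (rule complex_eqI)
        have int: "integrable (\<kappa> x) Y" by (rule \<kappa>_int[OF _ BY]) simp
        show "Re (LINT t|\<kappa> x. Y t) = Re x"
          using integral_bounded_linear[OF bounded_linear_Re int] good(3)[OF False] by simp
        show "Im (LINT t|\<kappa> x. Y t) = Im x"
          using integral_bounded_linear[OF bounded_linear_Im int] good(4)[OF False] by simp
      qed
      finally show ?thesis using False by (subst T_set) auto
    qed
  qed
  have ind_meas: "(\<lambda>y. indicator K y *\<^sub>R f y) \<in> borel_measurable borel" if "continuous_on K f" for f :: "complex \<Rightarrow> real"
    using K_meas that by (rule borel_measurable_continuous_on_indicator)
  have T_f_meas: "(\<lambda>x. LINT y:K|T x. f y) \<in> borel_measurable borel" if f: "continuous_on K f" for f :: "complex \<Rightarrow> real"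
  proof -
    note [measurable] = ind_meas[OF f]
    have "(\<lambda>t. indicator K (Y t) *\<^sub>R f (Y t)) \<in> borel_measurable borel"
      by (rule measurable_compose[OF _ ind_meas[OF f], of Y]) simp
    then have [measurable]: "(\<lambda>x. LINT t|\<kappa> x. indicator K (Y t) *\<^sub>R f (Y t)) \<in> borel_measurable borel"
      by (rule measurable_compose[OF \<kappa>_sub integral_measurable_subprob_algebra])
    show ?thesis unfolding T_set[OF ind_meas[OF f]] by measurable
  qed
  have dil: "dilation_on K T"
    unfolding dilation_on_def
    using T_prob T_bary T_f_meas by (auto intro: measurable_restrict_space1)
  define \<mu>Q where "\<mu>Q = distr \<nu> borel Y"
  have Q: "\<mu>Q \<in> prob_measures_on K"
  proof -
    have "\<nu>.prob (Y -` K) = 1"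
      using YK measurable_sets[of Y borel borel K] by (subst \<nu>.prob_eq_1) auto
    then show ?thesis unfolding \<mu>Q_def prob_measures_on_def
      using \<nu>.prob_space_distr[of Y] by (simp add: measure_distr)
  qed
  have Qint: "(LINT y:K|\<mu>Q. f y) = (LINT x:K|\<mu>. (LINT y:K|T x. f y))" if f: "continuous_on K f" for f :: "complex \<Rightarrow> real"
  proof -
    define \<phi> where "\<phi> y = indicator K y * f y" for y
    have \<phi> [measurable]: "\<phi> \<in> borel_measurable borel" unfolding \<phi>_def[abs_def] using ind_meas[OF f] by simp
    have "bounded (f ` K)" using f K by (intro compact_imp_bounded compact_continuous_image)
    then obtain B where B: "B > 0" "\<And>y. y \<in> K \<Longrightarrow> \<bar>f y\<bar> \<le> B" unfolding bounded_pos by auto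
    have \<phi>B: "\<bar>\<phi> y\<bar> \<le> B" for y unfolding \<phi>_def using B by (auto simp: indicator_def)
    have "(LINT y:K|\<mu>Q. f y) = (LINT y|\<mu>Q. \<phi> y)" unfolding set_lebesgue_integral_def \<phi>_def by simp
    also have "\<dots> = (LINT t|\<nu>. \<phi> (Y t))" unfolding \<mu>Q_def by (subst integral_distr) auto
    also have "\<dots> = (LINT x|\<mu>. LINT t|\<kappa> x. \<phi> (Y t))"
      using kern[of UNIV "\<lambda>t. \<phi> (Y t)" B] \<phi>B by simp
    also have "\<dots> = (LINT x|\<mu>. indicator K x * (LINT y:K|T x. f y))"
    proof (rule integral_cong_AE)
      show "AE x in \<mu>. (LINT t|\<kappa> x. \<phi> (Y t)) = indicator K x * (LINT y:K|T x. f y)"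
        using AE_not_in[OF E] by eventually_elim (simp add: T_set[OF ind_meas[OF f]] good(2) \<phi>_def)
      show "(\<lambda>x. indicator K x * (LINT y:K|T x. f y)) \<in> borel_measurable \<mu>"
        using T_f_meas[OF f] by measurable
    qed measurable
    finally show ?thesis unfolding set_lebesgue_integral_def[of \<mu>] by simp
  qed
  \<comment> \<open>\<open>dilate\<close> is a definite description, so uniqueness is due as well:
    continuous functions determine a finite Borel measure.\<close>
  have "dilate K T \<mu> = \<mu>Q"
    unfolding dilate_def
  proof (rule the_equality)
    show "\<mu>Q \<in> prob_measures_on K \<and> (\<forall>f::complex \<Rightarrow> real. continuous_on K f \<longrightarrow> (LINT y:K|\<mu>Q. f y) = (LINT x:K|\<mu>. LINT y:K|T x. f y))"
      using Q Qint by blast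
    fix N assume N: "N \<in> prob_measures_on K \<and> (\<forall>f::complex \<Rightarrow> real. continuous_on K f \<longrightarrow> (LINT y:K|N. f y) = (LINT x:K|\<mu>. LINT y:K|T x. f y))"
    have drop: "(LINT y:K|M. f y) = (LINT y|M. f y)" if M: "M \<in> prob_measures_on K" and f: "continuous_on UNIV f" for M and f :: "complex \<Rightarrow> real"
      using M compact_imp_closed[OF K] borel_measurable_continuous_onI[OF f]
      by (rule set_integral_prob_measures_on) simp
    show "N = \<mu>Q"
    proof (rule finite_measure_eqI_continuous)
      show "finite_measure N" "finite_measure \<mu>Q" "sets N = sets borel" "sets \<mu>Q = sets borel"
        using N Q unfolding prob_measures_on_def by (auto simp: prob_space.finite_measure)
      show "(LINT y|N. f y) = (LINT y|\<mu>Q. f y)" if f: "continuous_on UNIV f" "bounded (range f)" for f :: "complex \<Rightarrow> real"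
        using N Qint[OF continuous_on_subset[OF f(1) subset_UNIV]]
          continuous_on_subset[OF f(1) subset_UNIV] drop[OF _ f(1)] Q by metis
    qed
  qed
  then show ?thesis using dil unfolding \<mu>_def \<mu>Q_def by auto
qed

section \<open>The limit coupling\<close>

lemma root_measure_prod_linear:
  assumes "finite I" "I \<noteq> {}"
  shows "root_measure (\<Prod>i\<in>I. [:- v i, 1:]) = distr (measure_pmf (map_pmf v (pmf_of_set I))) borel (\<lambda>z. z)"
proof -
  have "proots (\<Prod>i\<in>I. [:- v i, 1:]) = (\<Sum>i\<in>I. {#v i#})"
    by (subst proots_prod) auto
  also have "\<dots> = image_mset v (mset_set I)"
    using assms(1) by (induction I rule: finite_induct) auto
  finally show ?thesis unfolding root_measure_def using assms by (simp add: map_pmf_of_set)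
qed

lemma integral_root_measure:
  fixes f :: "complex \<Rightarrow> real"
  assumes "finite I" "I \<noteq> {}" and [measurable]: "f \<in> borel_measurable borel"
  shows "(LINT z|root_measure (\<Prod>i\<in>I. [:- v i, 1:]). f z) = (\<Sum>i\<in>I. f (v i)) / card I"
  unfolding root_measure_prod_linear[OF assms(1,2)] using assms(1,2)
  by (subst integral_distr) (auto simp: integral_pmf_of_set)

lemma finite_distribution:
  fixes t :: "'a \<Rightarrow> real" and w :: "'a \<Rightarrow> real"
  assumes A: "finite A" and w: "\<And>a. a \<in> A \<Longrightarrow> w a \<ge> 0" "sum w A = 1"
  obtains \<nu> where "real_distribution \<nu>" "\<And>P. (\<And>a. a \<in> A \<Longrightarrow> P (t a)) \<Longrightarrow> AE s in \<nu>. P s"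
    "\<And>f :: real \<Rightarrow> real. f \<in> borel_measurable borel \<Longrightarrow> (LINT s|\<nu>. f s) = (\<Sum>a\<in>A. w a * f (t a))"
proof -
  define g where "g a = (if a \<in> A then w a else 0)" for a
  have g0: "g a \<ge> 0" for a unfolding g_def using w by simp
  have "(\<integral>\<^sup>+a. ennreal (g a) \<partial>count_space UNIV) = (\<Sum>a\<in>A. ennreal (g a))"
    by (rule nn_integral_count_space'[OF A]) (auto simp: g_def)
  also have "\<dots> = ennreal (sum g A)" using g0 by (intro sum_ennreal) auto
  also have "sum g A = 1" using w(2) by (simp add: g_def)
  finally have g1: "(\<integral>\<^sup>+a. ennreal (g a) \<partial>count_space UNIV) = 1" by simp
  define p where "p = embed_pmf g"
  have pmf_p: "pmf p a = g a" for a unfolding p_def by (rule pmf_embed_pmf[OF g0 g1])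
  have set_p: "set_pmf p \<subseteq> A" by (auto simp: set_pmf_eq pmf_p g_def)
  define \<nu> where "\<nu> = distr (measure_pmf p) borel t"
  have "real_distribution \<nu>"
    unfolding \<nu>_def real_distribution_def real_distribution_axioms_def
    by (auto intro!: measure_pmf.prob_space_distr)
  moreover have "AE s in \<nu>. P s" if "\<And>a. a \<in> A \<Longrightarrow> P (t a)" for P
  proof -
    have "AE s in \<nu>. s \<in> t ` A"
      unfolding \<nu>_def using set_p A
      by (subst AE_distr_iff) (auto simp: AE_measure_pmf_iff intro!: borel_closed finite_imp_closed)
    then show ?thesis by eventually_elim (use that in auto)
  qed
  moreover have "(LINT s|\<nu>. f s) = (\<Sum>a\<in>A. w a * f (t a))" if [measurable]: "f \<in> borel_measurable borel" for f :: "real \<Rightarrow> real"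
  proof -
    have "(LINT s|\<nu>. f s) = (\<integral>a. f (t a) \<partial>measure_pmf p)" unfolding \<nu>_def by (subst integral_distr) auto
    also have "\<dots> = (\<Sum>a\<in>A. f (t a) * pmf p a)"
      by (rule integral_measure_pmf_real[OF A]) (use set_p in auto)
    finally show ?thesis by (simp add: pmf_p g_def mult.commute)
  qed
  ultimately show thesis by (rule that)
qed

text \<open>The coupling is the joint law of \<open>X t\<close> and \<open>Y t\<close> when the
  curve parameter \<open>t\<close> has law \<open>\<nu>\<close>. The clauses speak of integrals of
  continuous functions and of full mass on closed sets, so that they pass to weak limits. The first
  marginal is exact, and the second has an error of order \<open>1 / p\<close>.\<close>

definition root_coupling ::
  "complex set \<Rightarrow> (real \<Rightarrow> complex) \<Rightarrow> (real \<Rightarrow> complex) \<Rightarrow> nat \<Rightarrow> complex poly \<Rightarrow> complex poly \<Rightarrow> real measure \<Rightarrow> bool" where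
  "root_coupling K X Y p V Q2 \<nu> \<longleftrightarrow>
    real_distribution \<nu> \<and> (AE t in \<nu>. t \<in> {0..1} \<and> X t \<in> K \<and> Y t \<in> K) \<and>
    (\<forall>f :: complex \<Rightarrow> real. continuous_on UNIV f \<longrightarrow> (LINT t|\<nu>. f (X t)) = (LINT z|root_measure V. f z)) \<and>
    (\<forall>f B. continuous_on UNIV f \<longrightarrow> (\<forall>z. \<bar>f z\<bar> \<le> B) \<longrightarrow>
       \<bar>(LINT t|\<nu>. f (Y t)) - (LINT z|root_measure Q2. f z)\<bar> \<le> 4 * B / (p - 2)) \<and>
    (\<forall>h :: complex \<Rightarrow> real. continuous_on UNIV h \<longrightarrow>
       (LINT t|\<nu>. h (X t) * Re (Y t - X t)) = 0 \<and> (LINT t|\<nu>. h (X t) * Im (Y t - X t)) = 0) \<and>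
    (\<forall>f. continuous_on UNIV f \<longrightarrow> convex_on K f \<longrightarrow> (LINT t|\<nu>. f (X t)) \<le> (LINT t|\<nu>. f (Y t)))"

text \<open>Mass \<open>M i l / (p - 2)\<close> is put at a parameter that the curve sends to
  \<open>(v i, \<zeta> l)\<close>. Row sums give the first marginal, column bounds the second,
  barycentres the martingale identities, and Jensen's inequality in each row the last
  clause.\<close>

lemma coupling_distribution:
  fixes v \<zeta> :: "nat \<Rightarrow> complex" and M :: "nat \<Rightarrow> nat \<Rightarrow> real" and X Y :: "real \<Rightarrow> complex"
  assumes p: "p \<ge> 3" and v: "V = (\<Prod>i<p-2. [:- v i, 1:])" and Q2: "Q2 = (\<Prod>l=1..p. [:- \<zeta> l, 1:])"
    and M0: "\<And>i l. i < p - 2 \<Longrightarrow> l \<in> {1..p} \<Longrightarrow> M i l \<ge> 0"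
    and M1: "\<And>i. i < p - 2 \<Longrightarrow> (\<Sum>l=1..p. M i l) = 1"
    and M\<zeta>: "\<And>i. i < p - 2 \<Longrightarrow> (\<Sum>l=1..p. M i l * \<zeta> l) = v i"
    and Mc: "\<And>l. l \<in> {1..p} \<Longrightarrow> (\<Sum>i<p-2. M i l) \<le> 1"
    and K: "convex K" "\<And>l. l \<in> {1..p} \<Longrightarrow> \<zeta> l \<in> K"
    and cont: "continuous_on UNIV X" "continuous_on UNIV Y"
    and curve: "\<And>x y. x \<in> K \<Longrightarrow> y \<in> K \<Longrightarrow> \<exists>t\<in>{0..1}. X t = x \<and> Y t = y"
  shows "\<exists>\<nu>. root_coupling K X Y p V Q2 \<nu>"
proof -
  define N where "N = p - 2"
  have N: "N > 0" "real N = real p - 2" unfolding N_def using p by auto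
  have vK: "v i \<in> K" if "i < N" for i
  proof -
    have "(\<Sum>l=1..p. M i l *\<^sub>R \<zeta> l) \<in> K"
      using that M0 M1 K unfolding N_def by (intro convex_sum) auto
    then show ?thesis using M\<zeta>[of i] that unfolding N_def by (simp add: scaleR_conv_of_real)
  qed
  define A where "A = {..<N} \<times> {1..p}"
  have "\<exists>t\<in>{0..1}. X t = v (fst a) \<and> Y t = \<zeta> (snd a)" if "a \<in> A" for a
    using that vK K(2) curve unfolding A_def by auto
  then obtain t where t: "\<And>a. a \<in> A \<Longrightarrow> t a \<in> {0..1}" "\<And>a. a \<in> A \<Longrightarrow> X (t a) = v (fst a)"
      "\<And>a. a \<in> A \<Longrightarrow> Y (t a) = \<zeta> (snd a)" by metis
  define w where "w a = M (fst a) (snd a) / N" for a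
  have finA: "finite A" unfolding A_def by simp
  have sumA: "(\<Sum>a\<in>A. w a * F (fst a) (snd a)) = (\<Sum>i<N. \<Sum>l=1..p. M i l * F i l) / N" for F :: "nat \<Rightarrow> nat \<Rightarrow> real"
    unfolding A_def w_def by (simp add: sum.cartesian_product case_prod_beta sum_divide_distrib)
  have w0: "w a \<ge> 0" if "a \<in> A" for a using that M0 unfolding A_def w_def N_def by auto
  have w1: "sum w A = 1" using sumA[of "\<lambda>_ _. 1"] M1 N unfolding N_def by simp
  obtain \<nu> where \<nu>: "real_distribution \<nu>" and AE: "\<And>P. (\<And>a. a \<in> A \<Longrightarrow> P (t a)) \<Longrightarrow> AE s in \<nu>. P s"
    and int: "\<And>f :: real \<Rightarrow> real. f \<in> borel_measurable borel \<Longrightarrow> (LINT s|\<nu>. f s) = (\<Sum>a\<in>A. w a * f (t a))"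
    using finite_distribution[OF finA w0 w1, of t] by blast
  have int_eq: "(LINT s|\<nu>. f s) = (\<Sum>i<N. \<Sum>l=1..p. M i l * F i l) / N"
    if f: "f \<in> borel_measurable borel" and F: "\<And>a. a \<in> A \<Longrightarrow> f (t a) = F (fst a) (snd a)" for f and F :: "nat \<Rightarrow> nat \<Rightarrow> real"
    unfolding int[OF f] sumA[symmetric] using F by (intro sum.cong) auto
  have XY [measurable]: "X \<in> borel_measurable borel" "Y \<in> borel_measurable borel"
    using cont by (auto intro: borel_measurable_continuous_onI)
  have intX: "(LINT s|\<nu>. f (X s)) = (\<Sum>i<N. f (v i)) / N" if f: "continuous_on UNIV f" for f :: "complex \<Rightarrow> real"
  proof -
    have [measurable]: "f \<in> borel_measurable borel" using f by (rule borel_measurable_continuous_onI)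
    have "(LINT s|\<nu>. f (X s)) = (\<Sum>i<N. \<Sum>l=1..p. M i l * f (v i)) / N"
      using t(2) by (intro int_eq) auto
    also have "(\<Sum>i<N. \<Sum>l=1..p. M i l * f (v i)) = (\<Sum>i<N. f (v i))"
      using M1 unfolding N_def by (intro sum.cong refl) (simp flip: sum_distrib_right)
    finally show ?thesis .
  qed
  have intY: "(LINT s|\<nu>. f (Y s)) = (\<Sum>i<N. \<Sum>l=1..p. M i l * f (\<zeta> l)) / N" if f: "continuous_on UNIV f" for f :: "complex \<Rightarrow> real"
  proof -
    have [measurable]: "f \<in> borel_measurable borel" using f by (rule borel_measurable_continuous_onI)
    show ?thesis using t(3) by (intro int_eq) auto
  qed
  have V_int: "(LINT z|root_measure V. f z) = (\<Sum>i<N. f (v i)) / N" if f: "continuous_on UNIV f" for f :: "complex \<Rightarrow> real"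
  proof -
    have [measurable]: "f \<in> borel_measurable borel" using f by (rule borel_measurable_continuous_onI)
    show ?thesis unfolding v N_def[symmetric] using N by (subst integral_root_measure) auto
  qed
  have Q_int: "(LINT z|root_measure Q2. f z) = (\<Sum>l=1..p. f (\<zeta> l)) / p" if f: "continuous_on UNIV f" for f :: "complex \<Rightarrow> real"
  proof -
    have [measurable]: "f \<in> borel_measurable borel" using f by (rule borel_measurable_continuous_onI)
    show ?thesis unfolding Q2 using p by (subst integral_root_measure) auto
  qed
  show ?thesis
    unfolding root_coupling_def
  proof (intro exI[of _ \<nu>] conjI allI impI)
    show "real_distribution \<nu>" by (rule \<nu>)
    show "AE s in \<nu>. s \<in> {0..1} \<and> X s \<in> K \<and> Y s \<in> K"
      by (rule AE) (use t vK K(2) in \<open>auto simp: A_def\<close>)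
    fix f :: "complex \<Rightarrow> real" assume f: "continuous_on UNIV f"
    show "(LINT s|\<nu>. f (X s)) = (LINT z|root_measure V. f z)" unfolding intX[OF f] V_int[OF f] ..
    have [measurable]: "f \<in> borel_measurable borel" using f by (rule borel_measurable_continuous_onI)
    have lin: "(LINT s|\<nu>. f (X s) * g (Y s - X s)) = 0"
      if "bounded_linear g" for g :: "complex \<Rightarrow> real"
    proof -
      interpret g: bounded_linear g by fact
      have [measurable]: "g \<in> borel_measurable borel"
        using that by (intro borel_measurable_continuous_onI linear_continuous_on)
      have "(LINT s|\<nu>. f (X s) * g (Y s - X s)) = (\<Sum>i<N. \<Sum>l=1..p. M i l * (f (v i) * g (\<zeta> l - v i))) / N"
        using t by (intro int_eq) auto
      also have "(\<Sum>i<N. \<Sum>l=1..p. M i l * (f (v i) * g (\<zeta> l - v i))) = (\<Sum>i<N. 0)"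
      proof (intro sum.cong refl)
        fix i assume "i \<in> {..<N}"
        then have i: "i < p - 2" unfolding N_def by simp
        have "(\<Sum>l=1..p. M i l * (f (v i) * g (\<zeta> l - v i))) = f (v i) * g (\<Sum>l=1..p. M i l *\<^sub>R (\<zeta> l - v i))"
          by (simp add: g.sum g.scaleR sum_distrib_left mult_ac)
        also have "(\<Sum>l=1..p. M i l *\<^sub>R (\<zeta> l - v i)) = (\<Sum>l=1..p. M i l * \<zeta> l) - (\<Sum>l=1..p. M i l) *\<^sub>R v i"
          by (simp add: scaleR_conv_of_real right_diff_distrib sum_subtractf sum_distrib_right)
        also have "\<dots> = 0" using M1[OF i] M\<zeta>[OF i] by simp
        finally show "(\<Sum>l=1..p. M i l * (f (v i) * g (\<zeta> l - v i))) = 0" by simp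
      qed
      finally show ?thesis by simp
    qed
    show "(LINT s|\<nu>. f (X s) * Re (Y s - X s)) = 0" by (rule lin[OF bounded_linear_Re])
    show "(LINT s|\<nu>. f (X s) * Im (Y s - X s)) = 0" by (rule lin[OF bounded_linear_Im])
    show "(LINT s|\<nu>. f (X s)) \<le> (LINT s|\<nu>. f (Y s))" if cf: "convex_on K f"
    proof -
      have "f (v i) \<le> (\<Sum>l=1..p. M i l * f (\<zeta> l))" if "i < N" for i
      proof -
        have i: "i < p - 2" using that unfolding N_def .
        have "f (\<Sum>l=1..p. M i l *\<^sub>R \<zeta> l) \<le> (\<Sum>l=1..p. M i l * f (\<zeta> l))"
          using p M0[OF i] M1[OF i] K cf by (intro convex_on_sum) auto
        then show ?thesis using M\<zeta>[OF i] by (simp add: scaleR_conv_of_real)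
      qed
      then show ?thesis unfolding intX[OF f] intY[OF f] by (intro divide_right_mono sum_mono) auto
    qed
    fix B assume B: "\<forall>z. \<bar>f z\<bar> \<le> B"
    have B0: "B \<ge> 0" using B by (meson abs_ge_zero order_trans)
    define s where "s l = (\<Sum>i<N. M i l)" for l
    have s1: "s l \<le> 1" if "l \<in> {1..p}" for l using Mc[OF that] unfolding s_def N_def .
    have ssum: "(\<Sum>l=1..p. s l) = N" unfolding s_def using M1 by (subst sum.swap) (simp add: N_def)
    have "(LINT s|\<nu>. f (Y s)) = (\<Sum>l=1..p. s l / N * f (\<zeta> l))"
      unfolding intY[OF f] s_def sum_divide_distrib
      by (subst sum.swap) (simp add: sum_distrib_right sum_divide_distrib)
    then have "(LINT s|\<nu>. f (Y s)) - (LINT z|root_measure Q2. f z) = (\<Sum>l=1..p. (s l / N - 1 / p) * f (\<zeta> l))"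
      unfolding Q_int[OF f] by (simp add: sum_divide_distrib left_diff_distrib sum_subtractf)
    also have "\<bar>\<dots>\<bar> \<le> (\<Sum>l=1..p. \<bar>(s l / N - 1 / p) * f (\<zeta> l)\<bar>)" by (rule sum_abs)
    \<comment> \<open>Both \<open>(1 - s l) / N\<close> and \<open>1 / N - 1 / p\<close> are
      nonnegative, so the sum can be evaluated without absolute values. As the \<open>s l\<close>
      add up to \<open>N = p - 2\<close>, each of the two parts contributes \<open>2 / N\<close>,
      whence the constant 4.\<close>
    also have "\<dots> \<le> (\<Sum>l=1..p. ((1 - s l) / N + (1 / N - 1 / p)) * B)"
    proof (rule sum_mono)
      fix l assume l: "l \<in> {1..p}"
      have "1 / real p \<le> 1 / N" using N p by (intro divide_left_mono) auto
      moreover have "s l / N \<le> 1 / N" using s1[OF l] N by (intro divide_right_mono) auto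
      ultimately have "\<bar>s l / N - 1 / p\<bar> \<le> (1 - s l) / N + (1 / N - 1 / p)"
        unfolding diff_divide_distrib by linarith
      then show "\<bar>(s l / N - 1 / p) * f (\<zeta> l)\<bar> \<le> ((1 - s l) / N + (1 / N - 1 / p)) * B"
        unfolding abs_mult using B by (intro mult_mono) auto
    qed
    also have "\<dots> = ((real p - N) / N + (real p / N - 1)) * B"
    proof -
      have sN: "(\<Sum>l=1..p. s l / N) = 1" using ssum N(1) by (simp flip: sum_divide_distrib)
      have "(\<Sum>l=1..p. (1 - s l) / N + (1 / N - 1 / p)) = (real p - N) / N + (real p / N - 1)"
        using p sN N(1) by (simp add: sum.distrib sum_subtractf sum_negf diff_divide_distrib)
      then show ?thesis by (simp flip: sum_distrib_right)
    qed
    also have "\<dots> = 4 * B / N"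
    proof -
      have rp: "real p = real N + 2" using N(2) by simp
      show ?thesis unfolding rp using N(1) by (simp add: field_simps)
    qed
    finally show "\<bar>(LINT s|\<nu>. f (Y s)) - (LINT z|root_measure Q2. f z)\<bar> \<le> 4 * B / (p - 2)"
      using N by (simp add: N_def)
  qed
qed

section \<open>Passage to the limit\<close>

lemma convex_on_norm_power: "convex_on (UNIV :: 'a::real_normed_vector set) (\<lambda>x. norm x ^ m)"
proof (rule convex_onI)
  have conv: "convex_on {0..} (\<lambda>x::real. x ^ m)"
    using convex_power_odd[of m] convex_on_subset[OF convex_power_even[of m], of "{0..}"] by (cases "even m") auto
  fix t :: real and x y :: 'a assume t: "0 < t" "t < 1"
  have "norm ((1 - t) *\<^sub>R x + t *\<^sub>R y) \<le> (1 - t) * norm x + t * norm y"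
    using norm_triangle_ineq[of "(1 - t) *\<^sub>R x" "t *\<^sub>R y"] t by simp
  then have "norm ((1 - t) *\<^sub>R x + t *\<^sub>R y) ^ m \<le> ((1 - t) * norm x + t * norm y) ^ m"
    by (intro power_mono) auto
  also have "\<dots> \<le> (1 - t) * norm x ^ m + t * norm y ^ m"
    using convex_onD[OF conv, of t "norm x" "norm y"] t by simp
  finally show "norm ((1 - t) *\<^sub>R x + t *\<^sub>R y) ^ m \<le> (1 - t) * norm x ^ m + t * norm y ^ m" .
qed simp

text \<open>\<open>min 1 (infdist x S)\<close> is bounded, continuous and zero exactly on
  \<open>S\<close>, so full mass on \<open>S\<close> is detected by one integral that behaves well
  under weak limits.\<close>

lemma AE_in_closed_of_integral:
  fixes g :: "'t \<Rightarrow> 'a::metric_space"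
  assumes "finite_measure \<nu>" and [measurable]: "g \<in> borel_measurable \<nu>" and S: "closed S" "S \<noteq> {}"
    and 0: "(LINT t|\<nu>. min 1 (infdist (g t) S)) = 0"
  shows "AE t in \<nu>. g t \<in> S"
proof -
  interpret finite_measure \<nu> by fact
  have [measurable]: "(\<lambda>x. infdist x S) \<in> borel_measurable borel"
    by (intro borel_measurable_continuous_onI continuous_intros)
  have "integrable \<nu> (\<lambda>t. min 1 (infdist (g t) S))"
    by (rule integrable_const_bound[where B = 1]) (auto simp: infdist_nonneg)
  then have "AE t in \<nu>. min 1 (infdist (g t) S) = 0"
    using 0 by (subst (asm) integral_nonneg_eq_0_iff_AE) (auto simp: infdist_nonneg)
  then show ?thesis
    by eventually_elim (use S in_closed_iff_infdist_zero in \<open>auto simp: min_def split: if_splits\<close>)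
qed

lemma tendsto_along_subsequence:
  assumes "strict_mono r" "(\<lambda>k. x (r k)) \<longlonglongrightarrow> L"
  shows "(x \<longlongrightarrow> L) (inf sequentially (principal (range r)))"
  unfolding tendsto_def
proof (intro allI impI)
  fix U assume "open U" "L \<in> U"
  then have "eventually (\<lambda>k. x (r k) \<in> U) sequentially" using assms(2) by (auto dest: topological_tendstoD)
  then obtain k0 where k0: "\<And>k. k \<ge> k0 \<Longrightarrow> x (r k) \<in> U" unfolding eventually_sequentially by blast
  show "eventually (\<lambda>n. x n \<in> U) (inf sequentially (principal (range r)))"
    unfolding eventually_inf_principal eventually_sequentially
  proof (intro exI[of _ "r k0"] allI impI)
    fix n assume "r k0 \<le> n" "n \<in> range r"
    then obtain k where k: "n = r k" by blast
    then have "k0 \<le> k" using \<open>r k0 \<le> n\<close> strict_mono_less_eq[OF assms(1)] by simp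
    then show "x n \<in> U" using k0 k by simp
  qed
qed

text \<open>\<open>f\<close> stands in for \<open>ln (norm (z - w))\<close>, which is singular at
  \<open>w = z\<close>; only its values on \<open>K\<close> matter.\<close>

lemma ln_norm_poly_root_measure:
  fixes f :: "complex \<Rightarrow> real"
  assumes I: "finite I" "I \<noteq> {}" and f: "continuous_on UNIV f" and vK: "\<And>i. i \<in> I \<Longrightarrow> v i \<in> K"
    and fz: "\<And>w. w \<in> K \<Longrightarrow> f w = ln (norm (z - w))" and z: "z \<notin> K"
  shows "ln (norm (poly (\<Prod>i\<in>I. [:- v i, 1:]) z)) = card I * (LINT w|root_measure (\<Prod>i\<in>I. [:- v i, 1:]). f w)"
proof -
  have [measurable]: "f \<in> borel_measurable borel" using f by (rule borel_measurable_continuous_onI)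
  have "ln (norm (poly (\<Prod>i\<in>I. [:- v i, 1:]) z)) = ln (\<Prod>i\<in>I. norm (z - v i))"
    by (simp add: poly_prod prod_norm)
  also have "\<dots> = (\<Sum>i\<in>I. f (v i))"
    using I z vK fz by (subst ln_prod) auto
  finally show ?thesis using I by (simp add: integral_root_measure)
qed

text \<open>Logarithms turn \<open>\<delta>^2 * |Q2 z| \<le> |V z|\<close> into an inequality
  between \<open>p\<close> and \<open>p - 2\<close> times the potentials. The bound
  \<open>p \<ge> 3\<close> ensures that \<open>V\<close> has zeros, without which its root measure
  is meaningless.\<close>

lemma heine_stieltjes_distribution:
  fixes \<zeta> :: "nat \<Rightarrow> complex" and a :: "nat \<Rightarrow> real" and Q2 Q1 S W V :: "complex poly" and X Y :: "real \<Rightarrow> complex"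
  assumes p: "p \<ge> 3" and a: "\<And>l. l \<in> {1..p} \<Longrightarrow> a l > 0"
    and Q2: "Q2 = (\<Prod>l=1..p. [:- \<zeta> l, 1:])"
    and Q1: "\<And>z. poly Q2 z \<noteq> 0 \<Longrightarrow>
               poly Q1 z / poly Q2 z = (\<Sum>l=1..p. complex_of_real (a l) / (z - \<zeta> l))"
    and S: "degree S \<ge> 1" "lead_coeff S = 1"
    and W: "degree W = p - 2" "Q2 * pderiv (pderiv S) + Q1 * pderiv S + W * S = 0"
    and V: "V = smult c W" "c \<noteq> 0" "lead_coeff V = 1"
    and K: "convex K" "compact K" "\<And>l. l \<in> {1..p} \<Longrightarrow> \<zeta> l \<in> K"
    and cont: "continuous_on UNIV X" "continuous_on UNIV Y"
    and curve: "\<And>x y. x \<in> K \<Longrightarrow> y \<in> K \<Longrightarrow> \<exists>t\<in>{0..1}. X t = x \<and> Y t = y"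
  shows "(\<exists>\<nu>. root_coupling K X Y p V Q2 \<nu>) \<and>
    (\<forall>z \<delta> b f. z \<notin> K \<longrightarrow> norm b = 1 \<longrightarrow> \<delta> > 0 \<longrightarrow> (\<forall>w\<in>K. \<delta> \<le> Re (b / (z - w))) \<longrightarrow>
       continuous_on UNIV f \<longrightarrow> (\<forall>w\<in>K. f w = ln (norm (z - w))) \<longrightarrow>
       p * (LINT w|root_measure Q2. f w) + 2 * ln \<delta> \<le> (real p - 2) * (LINT w|root_measure V. f w))"
proof -
  have p2: "p \<ge> 2" using p by simp
  obtain v M where v: "V = (\<Prod>i<p-2. [:- v i, 1:])"
    and M: "\<forall>i<p-2. \<forall>l\<in>{1..p}. M i l \<ge> (0::real)" "\<forall>i<p-2. (\<Sum>l=1..p. M i l) = 1"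
      "\<forall>i<p-2. (\<Sum>l=1..p. M i l * \<zeta> l) = v i" "\<forall>l\<in>{1..p}. (\<Sum>i<p-2. M i l) \<le> 1"
    and lower: "\<forall>z \<delta> b. z \<notin> K \<longrightarrow> norm b = 1 \<longrightarrow> \<delta> > 0 \<longrightarrow> (\<forall>w\<in>K. \<delta> \<le> Re (b / (z - w))) \<longrightarrow>
        \<delta>\<^sup>2 * norm (poly Q2 z) \<le> norm (poly V z)"
    using heine_stieltjes_coupling[OF p2 _ Q2 _ S W V K(1,2)] a Q1 K(3) by blast
  have vK: "v i \<in> K" if "i < p - 2" for i
  proof -
    have "(\<Sum>l=1..p. M i l *\<^sub>R \<zeta> l) \<in> K"
      using that M(1,2) K by (intro convex_sum) auto
    then show ?thesis using M(3) that by (simp add: scaleR_conv_of_real)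
  qed
  have pot: "p * (LINT w|root_measure Q2. f w) + 2 * ln \<delta> \<le> (real p - 2) * (LINT w|root_measure V. f w)"
    if z: "z \<notin> K" "norm b = 1" "\<delta> > 0" "\<forall>w\<in>K. \<delta> \<le> Re (b / (z - w))"
      and f: "continuous_on UNIV f" "\<forall>w\<in>K. f w = ln (norm (z - w))" for z \<delta> b f
  proof -
    have Qz: "poly Q2 z \<noteq> 0" using z(1) K(3) unfolding Q2 by (auto simp: poly_prod)
    have "ln (\<delta>\<^sup>2 * norm (poly Q2 z)) \<le> ln (norm (poly V z))"
      using lower z Qz by (intro ln_mono) (auto intro: mult_pos_pos less_le_trans)
    moreover have "ln (\<delta>\<^sup>2 * norm (poly Q2 z)) = 2 * ln \<delta> + ln (norm (poly Q2 z))"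
      using z(3) Qz by (simp add: ln_mult ln_realpow)
    moreover have "ln (norm (poly Q2 z)) = p * (LINT w|root_measure Q2. f w)"
      unfolding Q2 using p f K(3) z(1) by (subst ln_norm_poly_root_measure[where f = f and K = K]) auto
    moreover have "ln (norm (poly V z)) = (real p - 2) * (LINT w|root_measure V. f w)"
      unfolding v using p f vK z(1) lessThan_empty_iff[of "p - 2"]
      by (subst ln_norm_poly_root_measure[where f = f and K = K]) auto
    ultimately show ?thesis by simp
  qed
  show ?thesis
    using coupling_distribution[OF p v Q2 M(1)[rule_format] M(2)[rule_format] M(3)[rule_format] M(4)[rule_format]
        K(1,3) cont curve] pot by blast
qed

lemma tight_unit_interval:
  assumes "\<And>n. real_distribution (\<mu> n)" "\<And>n. AE t in \<mu> n. t \<in> {0..1::real}"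
  shows "tight \<mu>"
  unfolding tight_def
proof (intro conjI allI impI assms(1))
  fix \<epsilon> :: real assume \<epsilon>: "\<epsilon> > 0"
  have "measure (\<mu> n) {- 1<..1} = 1" for n
  proof -
    interpret real_distribution "\<mu> n" by (rule assms(1))
    show ?thesis using assms(2)[of n] by (subst prob_eq_1) (auto elim!: eventually_mono)
  qed
  then show "\<exists>a b. a < b \<and> (\<forall>n. 1 - \<epsilon> < measure (\<mu> n) {a<..b})"
    using \<epsilon> by (intro exI[of _ "-1"] exI[of _ 1]) auto
qed

section \<open>Extraction of the limits and their comparison\<close>

theorem corollary3:
  fixes \<zeta> :: "nat \<Rightarrow> nat \<Rightarrow> complex"
    and a :: "nat \<Rightarrow> nat \<Rightarrow> real"
    and Q2 Q1 :: "nat \<Rightarrow> complex poly"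
    and K :: "complex set"
    and S V :: "nat \<Rightarrow> nat \<Rightarrow> complex poly"
    and n :: "nat \<Rightarrow> nat"
  assumes a_pos: "\<And>p l. p \<ge> 2 \<Longrightarrow> l \<in> {1..p} \<Longrightarrow> a l p > 0"
    and Q2: "\<And>p. p \<ge> 2 \<Longrightarrow> Q2 p = (\<Prod>l=1..p. [:- \<zeta> l p, 1:])"
    and Q1: "\<And>p z. p \<ge> 2 \<Longrightarrow> poly (Q2 p) z \<noteq> 0 \<Longrightarrow>
               poly (Q1 p) z / poly (Q2 p) z = (\<Sum>l=1..p. complex_of_real (a l p) / (z - \<zeta> l p))"
    and solvable: "\<And>p. p \<ge> 2 \<Longrightarrow> solvable_eq p (Q2 p) (Q1 p)"
    and K: "convex K" "compact K"
    and zeros_in_K: "\<And>p. p \<ge> 2 \<Longrightarrow> {z. poly (Q2 p) z = 0} \<subseteq> K"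
    and S: "\<And>p k. p \<ge> 2 \<Longrightarrow> k \<ge> 1 \<Longrightarrow> degree (S p k) = k \<and> lead_coeff (S p k) = 1"
    and V: "\<And>p k. p \<ge> 2 \<Longrightarrow> k \<ge> 1 \<Longrightarrow> lead_coeff (V p k) = 1 \<and>
              (\<exists>W c. stieltjes_pair p (Q2 p) (Q1 p) W (S p k) \<and> degree W = p - 2 \<and>
                     c \<noteq> 0 \<and> V p k = smult c W)"
    and n: "\<And>p. p \<ge> 2 \<Longrightarrow> n p \<ge> 1"
  shows "\<exists>\<Gamma> \<mu>V \<mu>Q.
      \<Gamma> \<subseteq> {2..} \<and> infinite \<Gamma> \<and>
      weak_star_lim \<Gamma> (\<lambda>p. root_measure (V p (n p))) \<mu>V \<and>
      weak_star_lim \<Gamma> (\<lambda>p. root_measure (Q2 p)) \<mu>Q \<and>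
      choquet_le K \<mu>V \<mu>Q \<and>
      (\<exists>T. dilation_on K T \<and> \<mu>Q = dilate K T \<mu>V) \<and>
      (\<forall>m. abs_moment m \<mu>V \<le> abs_moment m \<mu>Q) \<and>
      (\<forall>z. z \<notin> K \<longrightarrow> log_potential \<mu>V z \<ge> log_potential \<mu>Q z)"
proof -
  obtain X Y :: "real \<Rightarrow> complex" where cont: "continuous_on UNIV X" "continuous_on UNIV Y"
    and bdd: "bounded (range X)" "bounded (range Y)"
    and curve: "\<And>x y. x \<in> K \<Longrightarrow> y \<in> K \<Longrightarrow> \<exists>t\<in>{0..1}. X t = x \<and> Y t = y"
    using space_filling_curve[OF compact_imp_bounded[OF K(2)]] by blast
  have K_closed: "closed K" using K(2) by (rule compact_imp_closed)
  have \<zeta>K: "\<zeta> l p \<in> K" if "p \<ge> 2" "l \<in> {1..p}" for p l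
  proof -
    have "poly (Q2 p) (\<zeta> l p) = 0" using that unfolding Q2[OF that(1)] by (auto simp: poly_prod)
    then show ?thesis using zeros_in_K[OF that(1)] by blast
  qed
  have K_ne: "K \<noteq> {}" using \<zeta>K[of 2 1] by auto
  have HS: "(\<exists>\<nu>. root_coupling K X Y p (V p (n p)) (Q2 p) \<nu>) \<and>
    (\<forall>z \<delta> b f. z \<notin> K \<longrightarrow> norm b = 1 \<longrightarrow> \<delta> > 0 \<longrightarrow> (\<forall>w\<in>K. \<delta> \<le> Re (b / (z - w))) \<longrightarrow>
       continuous_on UNIV f \<longrightarrow> (\<forall>w\<in>K. f w = ln (norm (z - w))) \<longrightarrow>
       p * (LINT w|root_measure (Q2 p). f w) + 2 * ln \<delta> \<le> (real p - 2) * (LINT w|root_measure (V p (n p)). f w))"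
    if p: "p \<ge> 3" for p
  proof -
    have p2: "p \<ge> 2" using p by simp
    obtain W c where W: "degree W = p - 2"
        "Q2 p * pderiv (pderiv (S p (n p))) + Q1 p * pderiv (S p (n p)) + W * S p (n p) = 0"
      and c: "c \<noteq> 0" "V p (n p) = smult c W" "lead_coeff (V p (n p)) = 1"
      using V[OF p2 n[OF p2]] unfolding stieltjes_pair_def by blast
    have Sn: "degree (S p (n p)) \<ge> 1" "lead_coeff (S p (n p)) = 1"
      using S[OF p2 n[OF p2]] n[OF p2] by auto
    show ?thesis
      by (rule heine_stieltjes_distribution[OF p a_pos[OF p2] Q2[OF p2] Q1[OF p2] Sn W c(2,1,3) K \<zeta>K[OF p2] cont curve])
  qed
  then have "\<forall>p\<in>{3..}. \<exists>\<nu>. root_coupling K X Y p (V p (n p)) (Q2 p) \<nu>" by blast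
  then obtain \<nu> where P: "\<And>p. p \<ge> 3 \<Longrightarrow> root_coupling K X Y p (V p (n p)) (Q2 p) (\<nu> p)"
    by (auto dest!: bchoice)
  have \<nu>: "\<And>p. p \<ge> 3 \<Longrightarrow> real_distribution (\<nu> p)"
    and \<nu>_AE: "\<And>p. p \<ge> 3 \<Longrightarrow> AE t in \<nu> p. t \<in> {0..1} \<and> X t \<in> K \<and> Y t \<in> K"
    and \<nu>_X: "\<And>p f. p \<ge> 3 \<Longrightarrow> continuous_on UNIV f \<Longrightarrow>
       (LINT t|\<nu> p. f (X t)) = (LINT z|root_measure (V p (n p)). (f z :: real))"
    and \<nu>_Y: "\<And>p f B. p \<ge> 3 \<Longrightarrow> continuous_on UNIV f \<Longrightarrow> \<forall>z. \<bar>f z\<bar> \<le> B \<Longrightarrow>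
       \<bar>(LINT t|\<nu> p. f (Y t)) - (LINT z|root_measure (Q2 p). f z)\<bar> \<le> 4 * B / (p - 2)"
    and \<nu>_mart: "\<And>p (h :: complex \<Rightarrow> real). p \<ge> 3 \<Longrightarrow> continuous_on UNIV h \<Longrightarrow>
       (LINT t|\<nu> p. h (X t) * Re (Y t - X t)) = 0 \<and> (LINT t|\<nu> p. h (X t) * Im (Y t - X t)) = 0"
    and \<nu>_convex: "\<And>p f. p \<ge> 3 \<Longrightarrow> continuous_on UNIV f \<Longrightarrow> convex_on K f \<Longrightarrow>
       (LINT t|\<nu> p. f (X t)) \<le> (LINT t|\<nu> p. f (Y t))"
    using P unfolding root_coupling_def by blast+
  have \<nu>_pot: "\<And>p z \<delta> b f. p \<ge> 3 \<Longrightarrow> z \<notin> K \<Longrightarrow> norm b = 1 \<Longrightarrow> \<delta> > 0 \<Longrightarrow> \<forall>w\<in>K. \<delta> \<le> Re (b / (z - w)) \<Longrightarrow>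
       continuous_on UNIV f \<Longrightarrow> \<forall>w\<in>K. f w = ln (norm (z - w)) \<Longrightarrow>
       p * (LINT w|root_measure (Q2 p). f w) + 2 * ln \<delta> \<le> (real p - 2) * (LINT w|root_measure (V p (n p)). f w)"
    using HS by blast
  \<comment> \<open>For \<open>p = 2\<close> the polynomial \<open>V\<close> is constant and its
    root measure is meaningless, so the sequence starts at \<open>p = 3\<close>.\<close>
  define \<nu>' where "\<nu>' k = \<nu> (k + 3)" for k
  have "tight \<nu>'"
  proof (rule tight_unit_interval)
    show "AE t in \<nu>' k. t \<in> {0..1}" for k
      unfolding \<nu>'_def using \<nu>_AE[of "k + 3"] by (auto elim!: eventually_mono)
  qed (simp add: \<nu>'_def \<nu>)
  then obtain r N where r: "strict_mono (r :: nat \<Rightarrow> nat)" and N: "real_distribution N"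
    and conv: "weak_conv_m (\<nu>' \<circ> (\<lambda>k. k) \<circ> r) N"
    using tight_imp_convergent_subsubsequence[of \<nu>' "\<lambda>k. k"] by (auto simp: strict_mono_def)
  interpret N: real_distribution N by fact
  define q where "q k = r k + 3" for k
  have q: "strict_mono q" and q3: "\<And>k. q k \<ge> 3" using r unfolding q_def strict_mono_def by auto
  have qk: "q k \<ge> k + 3" for k unfolding q_def using seq_suble[OF r] by simp
  have lim: "(\<lambda>k. LINT t|\<nu> (q k). f t) \<longlonglongrightarrow> (LINT t|N. f t)"
    if f: "continuous_on UNIV f" "bounded (range f)" for f :: "real \<Rightarrow> real"
  proof -
    obtain B where B: "\<And>t. norm (f t) \<le> B" using f(2) unfolding bounded_iff by auto
    have "(\<lambda>k. LINT t|(\<nu>' \<circ> (\<lambda>k. k) \<circ> r) k. f t) \<longlonglongrightarrow> (LINT t|N. f t)"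
    proof (rule weak_conv_imp_integral_bdd_continuous_conv[OF _ N conv])
      show "real_distribution ((\<nu>' \<circ> (\<lambda>k. k) \<circ> r) k)" for k by (simp add: \<nu>'_def \<nu>)
      show "isCont f t" for t using f(1) by (simp add: continuous_on_eq_continuous_at)
    qed (rule B)
    then show ?thesis by (simp add: \<nu>'_def q_def)
  qed
  have comp: "continuous_on UNIV (\<lambda>t. f (g t))" "bounded (range (\<lambda>t. f (g t)))"
    if f: "continuous_on UNIV f" and g: "continuous_on UNIV g" "bounded (range g)"
    for f :: "complex \<Rightarrow> real" and g :: "real \<Rightarrow> complex"
  proof -
    show "continuous_on UNIV (\<lambda>t. f (g t))"
      using continuous_on_compose2[OF f g(1)] by simp
    have "compact (f ` closure (range g))"
      using g(2) continuous_on_subset[OF f] by (intro compact_continuous_image) (auto simp: compact_closure)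
    then have "bounded (f ` closure (range g))" by (rule compact_imp_bounded)
    then show "bounded (range (\<lambda>t. f (g t)))"
      by (rule bounded_subset) (use closure_subset[of "range g"] in auto)
  qed
  have lim_X: "(\<lambda>k. LINT t|\<nu> (q k). f (X t)) \<longlonglongrightarrow> (LINT t|N. f (X t))"
    and lim_Y: "(\<lambda>k. LINT t|\<nu> (q k). f (Y t)) \<longlonglongrightarrow> (LINT t|N. f (Y t))"
    if f: "continuous_on UNIV f" for f :: "complex \<Rightarrow> real"
    by (intro lim comp f cont bdd)+
  have XY_meas [measurable]: "X \<in> borel_measurable borel" "Y \<in> borel_measurable borel"
    using cont by (auto intro: borel_measurable_continuous_onI)
  define \<mu>V where "\<mu>V = distr N borel X"
  define \<mu>Q where "\<mu>Q = distr N borel Y"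
  have int_V: "(LINT z|\<mu>V. f z) = (LINT t|N. f (X t))" and int_Q: "(LINT z|\<mu>Q. f z) = (LINT t|N. f (Y t))"
    if "continuous_on UNIV f" for f :: "complex \<Rightarrow> real"
    using borel_measurable_continuous_onI[OF that] unfolding \<mu>V_def \<mu>Q_def by (simp_all add: integral_distr)
  have root_V: "(\<lambda>k. LINT z|root_measure (V (q k) (n (q k))). f z) \<longlonglongrightarrow> (LINT z|\<mu>V. f z)"
    if f: "continuous_on UNIV f" for f :: "complex \<Rightarrow> real"
    using lim_X[OF f] unfolding int_V[OF f] \<nu>_X[OF q3 f] .
  have e_lim: "(\<lambda>k. 1 / (real (q k) - 2)) \<longlonglongrightarrow> 0"
  proof (rule real_tendsto_sandwich[OF _ _ tendsto_const LIMSEQ_inverse_real_of_nat])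
    show "\<forall>\<^sub>F k in sequentially. 0 \<le> 1 / (real (q k) - 2)" using le_trans[OF _ q3, of 2] by (auto intro!: always_eventually)
    have "1 / (real (q k) - 2) \<le> inverse (real (Suc k))" for k
    proof -
      have "real (Suc k) \<le> real (q k) - 2" using qk[of k] by linarith
      then show ?thesis unfolding inverse_eq_divide by (intro divide_left_mono mult_pos_pos) auto
    qed
    then show "\<forall>\<^sub>F k in sequentially. 1 / (real (q k) - 2) \<le> inverse (real (Suc k))" by simp
  qed
  have root_Q: "(\<lambda>k. LINT z|root_measure (Q2 (q k)). f z) \<longlonglongrightarrow> (LINT z|\<mu>Q. f z)"
    if f: "continuous_on UNIV f" "bounded (range f)" for f :: "complex \<Rightarrow> real"
  proof -
    obtain B where B: "\<forall>z. \<bar>f z\<bar> \<le> B" using f(2) unfolding bounded_iff by auto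
    have "(\<lambda>k. (LINT t|\<nu> (q k). f (Y t)) - (LINT z|root_measure (Q2 (q k)). f z)) \<longlonglongrightarrow> 0"
    proof (rule Lim_null_comparison)
      have "norm ((LINT t|\<nu> (q k). f (Y t)) - (LINT z|root_measure (Q2 (q k)). f z)) \<le> 4 * B * (1 / (real (q k) - 2))" for k
        using \<nu>_Y[OF q3 f(1) B, of k] q3[of k] by (simp add: of_nat_diff)
      then show "\<forall>\<^sub>F k in sequentially. norm ((LINT t|\<nu> (q k). f (Y t)) - (LINT z|root_measure (Q2 (q k)). f z))
          \<le> 4 * B * (1 / (real (q k) - 2))" by simp
      show "(\<lambda>k. 4 * B * (1 / (real (q k) - 2))) \<longlonglongrightarrow> 0" using tendsto_mult_right_zero[OF e_lim] .
    qed
    from tendsto_diff[OF lim_Y[OF f(1)] this] show ?thesis unfolding int_Q[OF f(1)] by simp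
  qed
  have AE_g: "AE t in N. g t \<in> K"
    if g: "continuous_on UNIV g" "bounded (range g)" and gk: "\<And>k. AE t in \<nu> (q k). g t \<in> K" for g :: "real \<Rightarrow> complex"
  proof (rule AE_in_closed_of_integral[OF N.finite_measure_axioms _ K_closed K_ne])
    have [measurable]: "g \<in> borel_measurable borel" using g(1) by (rule borel_measurable_continuous_onI)
    show "g \<in> borel_measurable N" by simp
    have c: "continuous_on UNIV (\<lambda>x. min 1 (infdist x K))" by (intro continuous_intros)
    have "(\<lambda>k. LINT t|\<nu> (q k). min 1 (infdist (g t) K)) \<longlonglongrightarrow> (LINT t|N. min 1 (infdist (g t) K))"
      by (intro lim comp[OF c g])
    moreover have "(LINT t|\<nu> (q k). min 1 (infdist (g t) K)) = 0" for k
      by (rule integral_eq_zero_AE) (use gk[of k] in \<open>auto elim!: eventually_mono\<close>)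
    ultimately show "(LINT t|N. min 1 (infdist (g t) K)) = 0" by (simp add: LIMSEQ_const_iff)
  qed
  have AE_X: "AE t in N. X t \<in> K"
    by (rule AE_g[OF cont(1) bdd(1)]) (use \<nu>_AE[OF q3] in \<open>auto elim!: eventually_mono\<close>)
  have AE_Y: "AE t in N. Y t \<in> K"
    by (rule AE_g[OF cont(2) bdd(2)]) (use \<nu>_AE[OF q3] in \<open>auto elim!: eventually_mono\<close>)
  have AE_01: "AE t in N. t \<in> {0..1}"
  proof (rule AE_in_closed_of_integral[OF N.finite_measure_axioms])
    have "(\<lambda>k. LINT t|\<nu> (q k). min 1 (infdist t {0..1})) \<longlonglongrightarrow> (LINT t|N. min 1 (infdist t {0..1}))"
    proof (rule lim)
      show "continuous_on UNIV (\<lambda>x::real. min 1 (infdist x {0..1}))" by (intro continuous_intros)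
      show "bounded (range (\<lambda>x::real. min 1 (infdist x {0..1})))"
        by (rule boundedI[of _ 1]) (auto simp: infdist_nonneg)
    qed
    moreover have "(LINT t|\<nu> (q k). min 1 (infdist t {0..1})) = 0" for k
    proof (rule integral_eq_zero_AE)
      show "AE t in \<nu> (q k). min 1 (infdist t {0..1}) = 0"
        using \<nu>_AE[OF q3, of k] by eventually_elim (metis infdist_zero min.absorb2 zero_le_one)
    qed
    ultimately show "(LINT t|N. min 1 (infdist t {0..1})) = 0" by (simp add: LIMSEQ_const_iff)
  qed auto
  have K_meas [measurable]: "K \<in> sets borel" using K_closed by simp
  have prob_on: "distr N borel g \<in> prob_measures_on K"
    if [measurable]: "g \<in> borel_measurable borel" and g: "AE t in N. g t \<in> K" for g
  proof -
    have "N.prob (g -` K) = 1"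
      using g measurable_sets[of g borel borel K] by (subst N.prob_eq_1) auto
    then show ?thesis unfolding prob_measures_on_def
      using N.prob_space_distr[of g] by (simp add: measure_distr)
  qed
  have V_on: "\<mu>V \<in> prob_measures_on K" and Q_on: "\<mu>Q \<in> prob_measures_on K"
    unfolding \<mu>V_def \<mu>Q_def using AE_X AE_Y by (intro prob_on; simp)+
  have mart: "(LINT t|N. h (X t) * Re (Y t - X t)) = 0 \<and> (LINT t|N. h (X t) * Im (Y t - X t)) = 0"
    if h: "continuous_on UNIV h" "bounded (range h)" for h :: "complex \<Rightarrow> real"
  proof -
    have bl: "(LINT t|N. h (X t) * g (Y t - X t)) = 0"
      if g: "bounded_linear g" and 0: "\<And>k. (LINT t|\<nu> (q k). h (X t) * g (Y t - X t)) = 0" for g :: "complex \<Rightarrow> real"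
    proof -
      have gc: "continuous_on UNIV g" using g by (rule linear_continuous_on)
      have c: "continuous_on UNIV (\<lambda>t. Y t - X t)" "bounded (range (\<lambda>t. Y t - X t))"
        using cont bdd by (auto intro: continuous_intros bounded_minus_comp)
      have b: "bounded (range (\<lambda>t. h (X t) * g (Y t - X t)))"
      proof -
        obtain B1 where B1: "\<And>t. norm (h (X t)) \<le> B1"
          using comp(2)[OF h(1) cont(1) bdd(1)] unfolding bounded_iff by auto
        obtain B2 where B2: "\<And>t. norm (g (Y t - X t)) \<le> B2"
          using comp(2)[OF gc c] unfolding bounded_iff by auto
        have "norm (h (X t) * g (Y t - X t)) \<le> B1 * B2" for t
          unfolding norm_mult by (intro mult_mono B1 B2 order_trans[OF norm_ge_zero B1] norm_ge_zero)
        then show ?thesis by (intro boundedI[of _ "B1 * B2"]) auto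
      qed
      have "(\<lambda>k. LINT t|\<nu> (q k). h (X t) * g (Y t - X t)) \<longlonglongrightarrow> (LINT t|N. h (X t) * g (Y t - X t))"
        using comp(1)[OF h(1) cont(1) bdd(1)] comp(1)[OF gc c] by (intro lim b continuous_on_mult)
      then show ?thesis unfolding 0 by (simp add: LIMSEQ_const_iff)
    qed
    show ?thesis using \<nu>_mart[OF q3 h(1)] by (intro conjI bl bounded_linear_Re bounded_linear_Im) auto
  qed
  have dil: "\<exists>T. dilation_on K T \<and> \<mu>Q = dilate K T \<mu>V"
    unfolding \<mu>V_def \<mu>Q_def
    by (rule dilation_of_martingale[OF N AE_01 cont bdd K(2) AE_X AE_Y mart])
  have choquet: "(LINT x:K|\<mu>V. f x) \<le> (LINT x:K|\<mu>Q. f x)"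
    if f: "continuous_on K f" "convex_on K f" for f :: "complex \<Rightarrow> real"
  proof -
    have "bounded (f ` K)" using f(1) K(2) by (intro compact_imp_bounded compact_continuous_image)
    then obtain B where B: "B > 0" "\<And>x. x \<in> K \<Longrightarrow> norm (f x) \<le> B" unfolding bounded_pos by auto
    \<comment> \<open>Weak limits call for a function continuous on the plane. The Tietze extension
      is known to be convex only on \<open>K\<close>, which suffices because all the couplings live
      there.\<close>
    obtain g where g: "continuous_on UNIV g" "\<And>x. x \<in> K \<Longrightarrow> g x = f x" "\<And>x. x \<in> UNIV \<Longrightarrow> norm (g x) \<le> B"
      by (rule Tietze[OF f(1), of UNIV B]) (use B K_closed in auto)
    have cg: "convex_on K g" using f(2) g(2) K(1) unfolding convex_on_def convex_def by simp
    have "(LINT t|N. g (X t)) \<le> (LINT t|N. g (Y t))"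
      by (rule LIMSEQ_le[OF lim_X[OF g(1)] lim_Y[OF g(1)]]) (use \<nu>_convex[OF q3 g(1) cg] in auto)
    moreover have "(LINT x:K|\<mu>V. f x) = (LINT x|\<mu>V. g x)" "(LINT x:K|\<mu>Q. f x) = (LINT x|\<mu>Q. g x)"
      using g by (auto intro!: set_integral_prob_measures_on V_on Q_on K_closed borel_measurable_continuous_onI)
    ultimately show ?thesis unfolding int_V[OF g(1)] int_Q[OF g(1)] by simp
  qed
  have moments: "abs_moment m \<mu>V \<le> abs_moment m \<mu>Q" for m
  proof -
    have c: "continuous_on A (\<lambda>x::complex. norm x ^ m)" for A by (intro continuous_intros)
    have "abs_moment m \<mu> = (LINT x:K|\<mu>. norm x ^ m)" if "\<mu> \<in> prob_measures_on K" for \<mu>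
      unfolding abs_moment_def
      by (rule set_integral_prob_measures_on[symmetric, OF that K_closed]) auto
    then show ?thesis
      using choquet[OF c convex_on_subset[OF convex_on_norm_power]] K(1) V_on Q_on by simp
  qed
  have potential: "log_potential \<mu>Q z \<le> log_potential \<mu>V z" if z: "z \<notin> K" for z
  proof -
    obtain b \<delta> where b: "norm b = 1" "\<delta> > 0" "\<And>w. w \<in> K \<Longrightarrow> \<delta> \<le> Re (b / (z - w))"
      using Re_cauchy_kernel_bounded_below[OF K z] by blast
    obtain d where d: "d > 0" "\<And>w. w \<in> K \<Longrightarrow> d \<le> norm (z - w)"
      using separate_point_closed[OF K_closed z] by (auto simp: dist_norm)
    have "bounded ((\<lambda>w. z - w) ` K)"
      using K(2) by (intro compact_imp_bounded compact_continuous_image continuous_intros)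
    then obtain D where D: "\<And>w. w \<in> K \<Longrightarrow> norm (z - w) \<le> D" unfolding bounded_iff by auto
    \<comment> \<open>Clamping between the bounds \<open>d\<close> and \<open>D\<close> for the
      distance from \<open>z\<close> to points of \<open>K\<close> removes the singularity at
      \<open>z\<close> and the growth at infinity, and leaves the kernel unchanged on
      \<open>K\<close>.\<close>
    define f where "f w = ln (max d (min D (norm (z - w))))" for w
    have fK: "f w = ln (norm (z - w))" if "w \<in> K" for w
      unfolding f_def using d(2)[OF that] D[OF that] by (simp add: max_def min_def)
    have f: "continuous_on UNIV f"
      unfolding f_def[abs_def] using d(1) by (intro continuous_intros) (auto simp: max_def)
    have "d \<le> D" using d(2) D K_ne by (meson all_not_in_conv order_trans)
    have fb: "bounded (range f)"
    proof (rule boundedI[of _ "max \<bar>ln d\<bar> \<bar>ln D\<bar>"], clarify)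
      fix w
      have m: "d \<le> max d (min D (norm (z - w)))" "max d (min D (norm (z - w))) \<le> D"
        using \<open>d \<le> D\<close> by auto
      then have "ln d \<le> f w" "f w \<le> ln D" unfolding f_def using d(1) by (auto intro!: ln_mono)
      then show "norm (f w) \<le> max \<bar>ln d\<bar> \<bar>ln D\<bar>" by auto
    qed
    have log_eq: "log_potential \<mu> z = (LINT w|\<mu>. f w)" if \<mu>: "\<mu> \<in> prob_measures_on K" for \<mu>
    proof -
      have "log_potential \<mu> z = (LINT w:K|\<mu>. f w)"
        unfolding log_potential_def
        by (rule set_integral_prob_measures_on[symmetric, OF \<mu> K_closed]) (auto simp: fK)
      also have "\<dots> = (LINT w|\<mu>. f w)"
        by (rule set_integral_prob_measures_on[OF \<mu> K_closed borel_measurable_continuous_onI[OF f]]) simp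
      finally show ?thesis .
    qed
    define x where "x k = (LINT w|root_measure (V (q k) (n (q k))). f w)" for k
    define y where "y k = (LINT w|root_measure (Q2 (q k)). f w)" for k
    have x: "x \<longlonglongrightarrow> log_potential \<mu>V z" unfolding x_def[abs_def] log_eq[OF V_on] by (rule root_V[OF f])
    have y: "y \<longlonglongrightarrow> log_potential \<mu>Q z" unfolding y_def[abs_def] log_eq[OF Q_on] by (rule root_Q[OF f fb])
    \<comment> \<open>The finite inequality divided by \<open>q k - 2\<close>, with
      \<open>q k / (q k - 2) = 1 + 2 / (q k - 2)\<close>. As \<open>\<delta>\<close> does not depend
      on \<open>k\<close> and \<open>y\<close> converges, the correction tends to 0.\<close>
    have le: "y k + (2 * y k + 2 * ln \<delta>) * (1 / (real (q k) - 2)) \<le> x k" for k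
    proof -
      have "real (q k) * y k + 2 * ln \<delta> \<le> (real (q k) - 2) * x k"
        unfolding x_def y_def using b fK by (intro \<nu>_pot[OF q3 z, where b = b] f) auto
      moreover have "real (q k) - 2 > 0" using q3[of k] by simp
      ultimately show ?thesis by (simp add: field_simps)
    qed
    have "(\<lambda>k. y k + (2 * y k + 2 * ln \<delta>) * (1 / (real (q k) - 2))) \<longlonglongrightarrow>
        log_potential \<mu>Q z + (2 * log_potential \<mu>Q z + 2 * ln \<delta>) * 0"
      by (intro tendsto_intros y e_lim)
    then show ?thesis using LIMSEQ_le[OF _ x] le by fastforce
  qed
  have "weak_star_lim (range q) (\<lambda>p. root_measure (V p (n p))) \<mu>V"
    unfolding weak_star_lim_def using V_on tendsto_along_subsequence[OF q root_V]
    by (auto simp: prob_measures_on_def)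
  moreover have "weak_star_lim (range q) (\<lambda>p. root_measure (Q2 p)) \<mu>Q"
    unfolding weak_star_lim_def using Q_on tendsto_along_subsequence[OF q root_Q]
    by (auto simp: prob_measures_on_def)
  moreover have "range q \<subseteq> {2..}" using le_trans[OF _ q3, of 2] by auto
  moreover have "infinite (range q)" using q by (intro range_inj_infinite strict_mono_imp_inj_on)
  moreover have "choquet_le K \<mu>V \<mu>Q" unfolding choquet_le_def using V_on Q_on choquet by blast
  ultimately show ?thesis using dil moments potential by blast
qed

end
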